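(* Let $(\Omega,\Sigma,\mu)$ be a localizable $\sigma$-finite measure space (with $L_1(\mu)\neq\{0\}$). The following are equivalent: (1) $L_1(\mu)\widehat{\otimes}_\varepsilon X$ has the diametral diameter two property (DD2P) for every (real, non-trivial) Banach space $X$. (2) $L_1(\mu)$ has the DD2P. (3) $L_1(\mu)$ has the Daugavet property. (4) $\mu$ does not contain any atom.
   Context: All Banach spaces are real and non-trivial (i.e. $\neq\{0\}$). $B_Z$ and $S_Z$ denote the closed unit ball and the unit sphere of a Banach space $Z$, and $Z^*$ its topological dual. $L_1(\mu)$ is the real space of ($\mu$-a.e. classes of) integrable functions with its usual norm. DD2P: a Banach space $Z$ has the diametral diameter two property (DD2P) if for every non-empty relatively weakly open subset $W$ of $B_Z$, every $z\in W\cap S_Z$ and every $\varepsilon>0$ there exists $w\in W$ with $\|w-z\|>2-\varepsilon$. Daugavet property: a Banach space $Z$ has the Daugavet property if $\|T+I\|=1+\|T\|$ for every rank-one bounded linear operator $T:Z\to Z$, where $I$ is the identity operator on $Z$. Injective tensor product: $Z\widehat{\otimes}_\varepsilon X$ is the completion of the algebraic tensor product $Z\otimes X$ under the norm $\|u\|_\varepsilon=\sup\{|\sum_{i=1}^n z^*(z_i)x^*(x_i)|: z^*\in S_{Z^*},\ x^*\in S_{X^*}\}$ for $u=\sum_{i=1}^n z_i\otimes x_i$. *)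

theory Defs
  imports "HOL-Analysis.Analysis"
begin

text \<open>
  Spaces such as \<open>L\<^sub>1(\<mu>)\<close> and its injective tensor products depend on a term \<open>\<mu>\<close> and hence are
  not types, and a statement about ``every Banach space'' inside a formula cannot quantify over
  types of class \<open>banach\<close>. Normed spaces are therefore records with an explicit carrier.
  The values of the operations outside of the carrier are irrelevant throughout.
  ``Every Banach space'' then means every Banach space structure on any subset of a type
  \<open>'x\<close>, where \<open>'x\<close> is an arbitrary type admitting at least one non-trivial such structure.
\<close>

record 'a nspace =
  vcarrier :: "'a set"
  vzero :: 'a
  vadd :: "'a \<Rightarrow> 'a \<Rightarrow> 'a"
  vscale :: "real \<Rightarrow> 'a \<Rightarrow> 'a"
  vnorm :: "'a \<Rightarrow> real"

definition vdiff :: "'a nspace \<Rightarrow> 'a \<Rightarrow> 'a \<Rightarrow> 'a" where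
  "vdiff Z x y = vadd Z x (vscale Z (-1) y)"

locale normed_vspace =
  fixes Z :: "'a nspace"
  assumes zero_closed: "vzero Z \<in> vcarrier Z"
    and add_closed: "\<lbrakk>x \<in> vcarrier Z; y \<in> vcarrier Z\<rbrakk> \<Longrightarrow> vadd Z x y \<in> vcarrier Z"
    and scale_closed: "x \<in> vcarrier Z \<Longrightarrow> vscale Z a x \<in> vcarrier Z"
    and add_assoc: "\<lbrakk>x \<in> vcarrier Z; y \<in> vcarrier Z; z \<in> vcarrier Z\<rbrakk>
          \<Longrightarrow> vadd Z (vadd Z x y) z = vadd Z x (vadd Z y z)"
    and add_commute: "\<lbrakk>x \<in> vcarrier Z; y \<in> vcarrier Z\<rbrakk> \<Longrightarrow> vadd Z x y = vadd Z y x"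
    and add_zero: "x \<in> vcarrier Z \<Longrightarrow> vadd Z (vzero Z) x = x"
    and add_inverse: "x \<in> vcarrier Z \<Longrightarrow> vadd Z x (vscale Z (-1) x) = vzero Z"
    and scale_add_right: "\<lbrakk>x \<in> vcarrier Z; y \<in> vcarrier Z\<rbrakk>
          \<Longrightarrow> vscale Z a (vadd Z x y) = vadd Z (vscale Z a x) (vscale Z a y)"
    and scale_add_left: "x \<in> vcarrier Z
          \<Longrightarrow> vscale Z (a + b) x = vadd Z (vscale Z a x) (vscale Z b x)"
    and scale_scale: "x \<in> vcarrier Z \<Longrightarrow> vscale Z a (vscale Z b x) = vscale Z (a * b) x"
    and scale_one: "x \<in> vcarrier Z \<Longrightarrow> vscale Z 1 x = x"
    and norm_eq_zero: "x \<in> vcarrier Z \<Longrightarrow> vnorm Z x = 0 \<longleftrightarrow> x = vzero Z"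
    and norm_triangle: "\<lbrakk>x \<in> vcarrier Z; y \<in> vcarrier Z\<rbrakk>
          \<Longrightarrow> vnorm Z (vadd Z x y) \<le> vnorm Z x + vnorm Z y"
    and norm_scale: "x \<in> vcarrier Z \<Longrightarrow> vnorm Z (vscale Z a x) = \<bar>a\<bar> * vnorm Z x"

definition cauchy_seqs :: "'a nspace \<Rightarrow> (nat \<Rightarrow> 'a) set" where
  "cauchy_seqs Z = {s. range s \<subseteq> vcarrier Z \<and>
     (\<forall>e>0. \<exists>N. \<forall>m\<ge>N. \<forall>n\<ge>N. vnorm Z (vdiff Z (s m) (s n)) < e)}"

locale banach_vspace = normed_vspace +
  assumes complete: "s \<in> cauchy_seqs Z
    \<Longrightarrow> \<exists>x\<in>vcarrier Z. (\<lambda>n. vnorm Z (vdiff Z (s n) x)) \<longlonglongrightarrow> 0"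

definition nontrivial :: "'a nspace \<Rightarrow> bool" where
  "nontrivial Z \<longleftrightarrow> vcarrier Z \<noteq> {vzero Z}"

definition real_nspace :: "real nspace" where
  "real_nspace = \<lparr>vcarrier = UNIV, vzero = 0, vadd = (+), vscale = (*), vnorm = abs\<rparr>"

definition unit_ball :: "'a nspace \<Rightarrow> 'a set" where
  "unit_ball Z = {z \<in> vcarrier Z. vnorm Z z \<le> 1}"

definition unit_sphere :: "'a nspace \<Rightarrow> 'a set" where
  "unit_sphere Z = {z \<in> vcarrier Z. vnorm Z z = 1}"

subsection \<open>Operators, the dual space and the weak topology\<close>

definition linear_op :: "'a nspace \<Rightarrow> 'b nspace \<Rightarrow> ('a \<Rightarrow> 'b) \<Rightarrow> bool" where
  "linear_op Z Y T \<longleftrightarrow>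
     T ` vcarrier Z \<subseteq> vcarrier Y \<and>
     (\<forall>x\<in>vcarrier Z. \<forall>y\<in>vcarrier Z. T (vadd Z x y) = vadd Y (T x) (T y)) \<and>
     (\<forall>a. \<forall>x\<in>vcarrier Z. T (vscale Z a x) = vscale Y a (T x))"

definition bounded_op :: "'a nspace \<Rightarrow> 'b nspace \<Rightarrow> ('a \<Rightarrow> 'b) \<Rightarrow> bool" where
  "bounded_op Z Y T \<longleftrightarrow> linear_op Z Y T \<and>
     (\<exists>K. \<forall>x\<in>vcarrier Z. vnorm Y (T x) \<le> K * vnorm Z x)"

definition op_norm :: "'a nspace \<Rightarrow> 'b nspace \<Rightarrow> ('a \<Rightarrow> 'b) \<Rightarrow> real" where
  "op_norm Z Y T = (SUP x\<in>unit_ball Z. vnorm Y (T x))"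

text \<open>
  Functionals are total functions on the underlying type, so one functional on the carrier has
  several representatives.  All notions below only use its values on the carrier.
\<close>

definition dual :: "'a nspace \<Rightarrow> ('a \<Rightarrow> real) set" where
  "dual Z = {f. bounded_op Z real_nspace f}"

definition dual_sphere :: "'a nspace \<Rightarrow> ('a \<Rightarrow> real) set" where
  "dual_sphere Z = {f \<in> dual Z. op_norm Z real_nspace f = 1}"

definition weak_topology :: "'a nspace \<Rightarrow> 'a topology" where
  "weak_topology Z =
     topology_generated_by {{z \<in> vcarrier Z. f z \<in> V} | f V. f \<in> dual Z \<and> open V}"

definition DD2P :: "'a nspace \<Rightarrow> bool" where
  "DD2P Z \<longleftrightarrow>
     (\<forall>W. openin (subtopology (weak_topology Z) (unit_ball Z)) W \<and> W \<noteq> {} \<longrightarrow>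
        (\<forall>z \<in> W \<inter> unit_sphere Z. \<forall>\<epsilon>>0. \<exists>w\<in>W. vnorm Z (vdiff Z w z) > 2 - \<epsilon>))"

definition rank_one :: "'a nspace \<Rightarrow> 'b nspace \<Rightarrow> ('a \<Rightarrow> 'b) \<Rightarrow> bool" where
  "rank_one Z Y T \<longleftrightarrow>
     (\<exists>y\<in>vcarrier Y. y \<noteq> vzero Y \<and> T ` vcarrier Z = range (\<lambda>a. vscale Y a y))"

definition daugavet_property :: "'a nspace \<Rightarrow> bool" where
  "daugavet_property Z \<longleftrightarrow>
     (\<forall>T. bounded_op Z Z T \<and> rank_one Z Z T \<longrightarrow>
        op_norm Z Z (\<lambda>x. vadd Z (T x) x) = 1 + op_norm Z Z T)"

subsection \<open>Completion\<close>

definition null_diff :: "'a nspace \<Rightarrow> ((nat \<Rightarrow> 'a) \<times> (nat \<Rightarrow> 'a)) set" where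
  "null_diff Z = {(s, t). s \<in> cauchy_seqs Z \<and> t \<in> cauchy_seqs Z \<and>
     (\<lambda>n. vnorm Z (vdiff Z (s n) (t n))) \<longlonglongrightarrow> 0}"

definition nspace_completion :: "'a nspace \<Rightarrow> (nat \<Rightarrow> 'a) set nspace" where
  "nspace_completion Z =
     \<lparr>vcarrier = cauchy_seqs Z // null_diff Z,
      vzero = null_diff Z `` {\<lambda>_. vzero Z},
      vadd = (\<lambda>A B. \<Union>s\<in>A. \<Union>t\<in>B. null_diff Z `` {\<lambda>n. vadd Z (s n) (t n)}),
      vscale = (\<lambda>a A. \<Union>s\<in>A. null_diff Z `` {\<lambda>n. vscale Z a (s n)}),
      vnorm = (\<lambda>A. the_elem ((\<lambda>s. lim (\<lambda>n. vnorm Z (s n))) ` A))\<rparr>"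

subsection \<open>Injective tensor product\<close>

definition bilinear_form :: "'a nspace \<Rightarrow> 'b nspace \<Rightarrow> ('a \<Rightarrow> 'b \<Rightarrow> real) \<Rightarrow> bool" where
  "bilinear_form Z X B \<longleftrightarrow>
     (\<forall>x\<in>vcarrier X. linear_op Z real_nspace (\<lambda>z. B z x)) \<and>
     (\<forall>z\<in>vcarrier Z. linear_op X real_nspace (\<lambda>x. B z x))"

text \<open>
  The algebraic tensor product is realised as the span of the evaluation functionals
  \<open>B \<mapsto> B z x\<close> on the space of all (not necessarily bounded) bilinear forms \<open>B\<close> on \<open>Z \<times> X\<close>.
  The value 0 at functions that are not bilinear on the carriers is a dummy.
\<close>

definition elem_tensor ::
    "'a nspace \<Rightarrow> 'b nspace \<Rightarrow> 'a \<Rightarrow> 'b \<Rightarrow> ('a \<Rightarrow> 'b \<Rightarrow> real) \<Rightarrow> real" where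
  "elem_tensor Z X z x = (\<lambda>B. if bilinear_form Z X B then B z x else 0)"

text \<open>
  If \<open>u\<close> is the sum of the \<open>z\<^sub>i \<otimes> x\<^sub>i\<close>, then its value at the bilinear form \<open>(z, x) \<mapsto> f z * g x\<close>
  is the sum of the \<open>f z\<^sub>i * g x\<^sub>i\<close>, independently of the representation of \<open>u\<close>.
\<close>

definition inj_tensor ::
    "'a nspace \<Rightarrow> 'b nspace \<Rightarrow> (('a \<Rightarrow> 'b \<Rightarrow> real) \<Rightarrow> real) nspace" where
  "inj_tensor Z X =
     \<lparr>vcarrier = {\<lambda>B. \<Sum>i<n. elem_tensor Z X (z i) (x i) B | (n :: nat) z x.
                    (\<forall>i<n. z i \<in> vcarrier Z \<and> x i \<in> vcarrier X)},
      vzero = (\<lambda>_. 0),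
      vadd = (\<lambda>u v B. u B + v B),
      vscale = (\<lambda>a u B. a * u B),
      vnorm = (\<lambda>u. SUP (f, g) \<in> dual_sphere Z \<times> dual_sphere X. \<bar>u (\<lambda>z x. f z * g x)\<bar>)\<rparr>"

definition inj_tensor_hat ::
    "'a nspace \<Rightarrow> 'b nspace \<Rightarrow> (nat \<Rightarrow> ('a \<Rightarrow> 'b \<Rightarrow> real) \<Rightarrow> real) set nspace" where
  "inj_tensor_hat Z X = nspace_completion (inj_tensor Z X)"

subsection \<open>Measure spaces\<close>

definition ae_eq :: "'a measure \<Rightarrow> (('a \<Rightarrow> real) \<times> ('a \<Rightarrow> real)) set" where
  "ae_eq M = {(f, g). integrable M f \<and> integrable M g \<and> (AE x in M. f x = g x)}"

definition L1 :: "'a measure \<Rightarrow> ('a \<Rightarrow> real) set nspace" where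
  "L1 M =
     \<lparr>vcarrier = Collect (integrable M) // ae_eq M,
      vzero = ae_eq M `` {\<lambda>_. 0},
      vadd = (\<lambda>A B. \<Union>f\<in>A. \<Union>g\<in>B. ae_eq M `` {\<lambda>x. f x + g x}),
      vscale = (\<lambda>a A. \<Union>f\<in>A. ae_eq M `` {\<lambda>x. a * f x}),
      vnorm = (\<lambda>A. the_elem ((\<lambda>f. \<integral>x. \<bar>f x\<bar> \<partial>M) ` A))\<rparr>"

text \<open>
  Localizable in the usual sense: semifinite, and every family of measurable sets has an
  essential supremum.  The library's \<open>semifinite_measure\<close> does not require the subset of
  finite measure to be non-null and so holds trivially; semifiniteness is therefore spelled out.
\<close>

definition localizable :: "'a measure \<Rightarrow> bool" where
  "localizable M \<longleftrightarrow>
     (\<forall>A\<in>sets M. emeasure M A = \<infinity> \<longrightarrow>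
        (\<exists>B\<in>sets M. B \<subseteq> A \<and> 0 < emeasure M B \<and> emeasure M B < \<infinity>)) \<and>
     (\<forall>\<E>\<subseteq>sets M. \<exists>H\<in>sets M.
        (\<forall>E\<in>\<E>. E - H \<in> null_sets M) \<and>
        (\<forall>G\<in>sets M. (\<forall>E\<in>\<E>. E - G \<in> null_sets M) \<longrightarrow> H - G \<in> null_sets M))"

definition atom :: "'a measure \<Rightarrow> 'a set \<Rightarrow> bool" where
  "atom M A \<longleftrightarrow> A \<in> sets M \<and> emeasure M A > 0 \<and>
     (\<forall>B\<in>sets M. B \<subseteq> A \<longrightarrow> emeasure M B = 0 \<or> emeasure M (A - B) = 0)"

end

theory Submission
  imports Defs
begin

text \<open>
  Everything turns on the atoms of \<open>\<mu>\<close>.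

  An integrable function is constant on an atom \<open>A\<close>. Hence the normalised indicator \<open>e\<close> of \<open>A\<close>
  spans an \<open>\<ell>\<^sub>1\<close>-summand: with \<open>\<phi> f\<close> the integral of \<open>f\<close> over \<open>A\<close>, the norm of \<open>f\<close> is
  \<open>\<bar>\<phi> f\<bar>\<close> plus the norm of \<open>f - \<phi> f e\<close> (\<open>L_line_if_atom\<close>). Such a line destroys both
  properties. The slice \<open>\<phi> > 1/2\<close> of the unit ball contains \<open>e\<close> but no point whose distance to
  \<open>e\<close> exceeds 1, and for the rank-one operator \<open>T f = - \<phi> f e\<close> of norm 1 the norm of \<open>I + T\<close> is
  at most 1. For the tensor products a line is taken as the second factor. Then every tensor is
  elementary, so the algebraic tensor product is a copy of \<open>L\<^sub>1(\<mu>)\<close> and has the same kind of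
  summand (\<open>L_line_tensor\<close>), and the splitting of the norm survives completion
  (\<open>L_line_completion\<close>).

  Suppose now that there are no atoms. Let \<open>f\<close> and \<open>g\<close> be step functions over common cells, and
  let \<open>A\<close> contain exactly the fraction \<open>1/N\<close> of each cell. Then \<open>N 1\<^sub>A f\<close> has the same norm as
  \<open>f\<close>, but lives on a set that carries only \<open>1/N\<close> of the norm of \<open>g\<close>, so that its distance to
  \<open>g\<close> is almost the sum of the two norms (\<open>norm_thin_diff\<close>). At the same time \<open>A\<close> can be chosen
  so that finitely many given functionals hardly distinguish \<open>N 1\<^sub>A f\<close> from \<open>f\<close>
  (\<open>thin_set_exists\<close>): on sets of finite measure a functional is a set function dominated by
  \<open>\<mu>\<close>, its Radon-Nikodym density cuts a cell into finitely many slices on which it is nearly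
  proportional to \<open>\<mu>\<close>, and by Sierpinski's theorem the fraction \<open>1/N\<close> of every slice can be
  taken. The resulting property of a pair of vectors, called \<open>spread\<close> below, passes from step
  functions to all of \<open>L\<^sub>1(\<mu>)\<close>. For equal vectors it gives the DD2P, for arbitrary pairs the
  Daugavet property.

  A tensor \<open>\<Sum>i. f\<^sub>i \<otimes> x\<^sub>i\<close> is an operator \<open>g \<mapsto> \<Sum>i. g(x\<^sub>i) f\<^sub>i\<close> from the dual of \<open>X\<close> to
  \<open>L\<^sub>1(\<mu>)\<close>, and its injective norm is the operator norm. If the \<open>f\<^sub>i\<close> are step functions, then
  all values of the operator are step functions over the same cells, and multiplication by
  \<open>N 1\<^sub>A\<close> acts on all of them as above with one and the same \<open>A\<close>. So a tensor of step functions
  forms a spreading pair with itself, and by density every element of the completion does.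
\<close>


section \<open>Seminormed spaces on a carrier\<close>

text \<open>
  Definiteness of the norm is left out: the remaining axioms can be checked termwise for the
  injective norm on the algebraic tensor product, and the completion divides out the vectors of
  norm 0.
\<close>

locale seminormed_vspace =
  fixes Z :: "'a nspace"
  assumes zero_closed: "vzero Z \<in> vcarrier Z"
    and add_closed: "\<lbrakk>x \<in> vcarrier Z; y \<in> vcarrier Z\<rbrakk> \<Longrightarrow> vadd Z x y \<in> vcarrier Z"
    and scale_closed: "x \<in> vcarrier Z \<Longrightarrow> vscale Z a x \<in> vcarrier Z"
    and add_assoc: "\<lbrakk>x \<in> vcarrier Z; y \<in> vcarrier Z; z \<in> vcarrier Z\<rbrakk>
          \<Longrightarrow> vadd Z (vadd Z x y) z = vadd Z x (vadd Z y z)"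
    and add_commute: "\<lbrakk>x \<in> vcarrier Z; y \<in> vcarrier Z\<rbrakk> \<Longrightarrow> vadd Z x y = vadd Z y x"
    and add_zero: "x \<in> vcarrier Z \<Longrightarrow> vadd Z (vzero Z) x = x"
    and add_inverse: "x \<in> vcarrier Z \<Longrightarrow> vadd Z x (vscale Z (-1) x) = vzero Z"
    and scale_add_right: "\<lbrakk>x \<in> vcarrier Z; y \<in> vcarrier Z\<rbrakk>
          \<Longrightarrow> vscale Z a (vadd Z x y) = vadd Z (vscale Z a x) (vscale Z a y)"
    and scale_add_left: "x \<in> vcarrier Z
          \<Longrightarrow> vscale Z (a + b) x = vadd Z (vscale Z a x) (vscale Z b x)"
    and scale_scale: "x \<in> vcarrier Z \<Longrightarrow> vscale Z a (vscale Z b x) = vscale Z (a * b) x"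
    and scale_one: "x \<in> vcarrier Z \<Longrightarrow> vscale Z 1 x = x"
    and norm_triangle: "\<lbrakk>x \<in> vcarrier Z; y \<in> vcarrier Z\<rbrakk>
          \<Longrightarrow> vnorm Z (vadd Z x y) \<le> vnorm Z x + vnorm Z y"
    and norm_scale: "x \<in> vcarrier Z \<Longrightarrow> vnorm Z (vscale Z a x) = \<bar>a\<bar> * vnorm Z x"

sublocale normed_vspace \<subseteq> seminormed_vspace
  by unfold_locales
    (fact zero_closed add_closed scale_closed add_assoc add_commute add_zero add_inverse
      scale_add_right scale_add_left scale_scale scale_one norm_triangle norm_scale)+

context seminormed_vspace
begin

lemma diff_closed: "\<lbrakk>x \<in> vcarrier Z; y \<in> vcarrier Z\<rbrakk> \<Longrightarrow> vdiff Z x y \<in> vcarrier Z"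
  by (simp add: vdiff_def add_closed scale_closed)

lemmas closed = zero_closed add_closed scale_closed diff_closed

lemma add_left_commute:
  "\<lbrakk>x \<in> vcarrier Z; y \<in> vcarrier Z; z \<in> vcarrier Z\<rbrakk>
    \<Longrightarrow> vadd Z x (vadd Z y z) = vadd Z y (vadd Z x z)"
  by (metis add_assoc add_commute)

lemma scale_zero_left: "x \<in> vcarrier Z \<Longrightarrow> vscale Z 0 x = vzero Z"
  using scale_add_left[of x 1 "-1"] by (simp add: scale_one add_inverse)

lemma scale_zero_right: "vscale Z a (vzero Z) = vzero Z"
  by (metis mult_zero_right scale_scale scale_zero_left zero_closed)

lemma add_zero_right: "x \<in> vcarrier Z \<Longrightarrow> vadd Z x (vzero Z) = x"
  by (metis add_commute add_zero zero_closed)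

lemma diff_self: "x \<in> vcarrier Z \<Longrightarrow> vdiff Z x x = vzero Z"
  by (simp add: vdiff_def add_inverse)

lemma diff_add_cancel:
  assumes "x \<in> vcarrier Z" "y \<in> vcarrier Z"
  shows "vadd Z (vdiff Z x y) y = x"
proof -
  have "vadd Z (vdiff Z x y) y = vadd Z x (vadd Z y (vscale Z (-1) y))"
    using assms by (simp add: vdiff_def add_assoc add_commute add_left_commute closed)
  then show ?thesis
    using assms by (simp add: add_inverse add_zero_right)
qed

lemma add_diff_cancel:
  assumes "x \<in> vcarrier Z" "y \<in> vcarrier Z"
  shows "vdiff Z (vadd Z x y) x = y"
proof -
  have "vdiff Z (vadd Z x y) x = vadd Z y (vadd Z x (vscale Z (-1) x))"
    using assms by (simp add: vdiff_def add_assoc add_left_commute add_commute closed)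
  then show ?thesis
    using assms by (simp add: add_inverse add_zero_right)
qed

lemma diff_add_diff:
  assumes "x \<in> vcarrier Z" "y \<in> vcarrier Z" "z \<in> vcarrier Z"
  shows "vadd Z (vdiff Z x y) (vdiff Z y z) = vdiff Z x z"
proof -
  have "vadd Z (vdiff Z x y) (vdiff Z y z)
      = vadd Z (vadd Z (vdiff Z x y) y) (vscale Z (-1) z)"
    using assms by (simp add: vdiff_def[of _ y z] add_assoc closed)
  then show ?thesis
    using assms by (simp add: diff_add_cancel) (simp add: vdiff_def)
qed

lemma add_diff_add:
  assumes "x \<in> vcarrier Z" "y \<in> vcarrier Z" "x' \<in> vcarrier Z" "y' \<in> vcarrier Z"
  shows "vdiff Z (vadd Z x y) (vadd Z x' y') = vadd Z (vdiff Z x x') (vdiff Z y y')"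
  using assms
  by (simp add: vdiff_def scale_add_right add_assoc add_left_commute closed)

lemma scale_diff:
  assumes "x \<in> vcarrier Z" "y \<in> vcarrier Z"
  shows "vscale Z a (vdiff Z x y) = vdiff Z (vscale Z a x) (vscale Z a y)"
  using assms by (simp add: vdiff_def scale_add_right scale_scale closed)

lemma minus_diff:
  assumes "x \<in> vcarrier Z" "y \<in> vcarrier Z"
  shows "vscale Z (-1) (vdiff Z x y) = vdiff Z y x"
  using assms
  by (simp add: vdiff_def scale_add_right scale_scale scale_one closed)
     (simp add: add_commute closed)

lemma norm_zero: "vnorm Z (vzero Z) = 0"
  by (metis abs_zero mult_zero_left norm_scale scale_zero_left zero_closed)

lemma norm_minus: "x \<in> vcarrier Z \<Longrightarrow> vnorm Z (vscale Z (-1) x) = vnorm Z x"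
  by (simp add: norm_scale)

lemma norm_nonneg: "x \<in> vcarrier Z \<Longrightarrow> 0 \<le> vnorm Z x"
  using norm_triangle[of x "vscale Z (-1) x"]
  by (simp add: closed add_inverse norm_zero norm_minus)

lemma norm_diff_commute:
  "\<lbrakk>x \<in> vcarrier Z; y \<in> vcarrier Z\<rbrakk> \<Longrightarrow> vnorm Z (vdiff Z x y) = vnorm Z (vdiff Z y x)"
  by (metis diff_closed minus_diff norm_minus)

lemma norm_diff_triangle:
  "\<lbrakk>x \<in> vcarrier Z; y \<in> vcarrier Z; z \<in> vcarrier Z\<rbrakk>
    \<Longrightarrow> vnorm Z (vdiff Z x z) \<le> vnorm Z (vdiff Z x y) + vnorm Z (vdiff Z y z)"
  by (metis diff_add_diff diff_closed norm_triangle)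

lemma norm_le_add_diff:
  "\<lbrakk>x \<in> vcarrier Z; y \<in> vcarrier Z\<rbrakk> \<Longrightarrow> vnorm Z x \<le> vnorm Z y + vnorm Z (vdiff Z x y)"
  by (metis add_commute diff_add_cancel diff_closed norm_triangle)

lemma abs_norm_diff_le:
  "\<lbrakk>x \<in> vcarrier Z; y \<in> vcarrier Z\<rbrakk> \<Longrightarrow> \<bar>vnorm Z x - vnorm Z y\<bar> \<le> vnorm Z (vdiff Z x y)"
  using norm_le_add_diff[of x y] norm_le_add_diff[of y x] norm_diff_commute[of x y] by linarith

end

lemma unit_vector_exists:
  assumes "normed_vspace X" "nontrivial X"
  obtains x where "x \<in> vcarrier X" "vnorm X x = 1" "x \<noteq> vzero X"
proof -
  interpret normed_vspace X by fact
  obtain x where x: "x \<in> vcarrier X" "vnorm X x \<noteq> 0"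
    using assms(2) zero_closed by (auto simp: nontrivial_def norm_eq_zero)
  have x': "vscale X (inverse (vnorm X x)) x \<in> vcarrier X"
      "vnorm X (vscale X (inverse (vnorm X x)) x) = 1"
    using x norm_nonneg[OF x(1)] by (simp_all add: scale_closed norm_scale)
  then show thesis using that norm_zero by fastforce
qed

lemma seminormed_real: "seminormed_vspace real_nspace"
  by unfold_locales (auto simp: real_nspace_def algebra_simps abs_mult)

lemma linear_op_diff:
  assumes "seminormed_vspace Z" "linear_op Z Y T" "x \<in> vcarrier Z" "y \<in> vcarrier Z"
  shows "T (vdiff Z x y) = vdiff Y (T x) (T y)"
  using assms unfolding linear_op_def vdiff_def
  by (simp add: seminormed_vspace.scale_closed)

lemma bounded_opE:
  assumes "seminormed_vspace Z" "bounded_op Z Y T"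
  obtains K where "K > 0" "\<And>x. x \<in> vcarrier Z \<Longrightarrow> vnorm Y (T x) \<le> K * vnorm Z x"
proof -
  obtain K where K: "\<forall>x\<in>vcarrier Z. vnorm Y (T x) \<le> K * vnorm Z x"
    using assms(2) unfolding bounded_op_def by blast
  show thesis
  proof
    show "max K 1 > 0" by simp
    fix x assume x: "x \<in> vcarrier Z"
    have "K * vnorm Z x \<le> max K 1 * vnorm Z x"
      by (intro mult_right_mono) (auto simp: seminormed_vspace.norm_nonneg[OF assms(1) x])
    then show "vnorm Y (T x) \<le> max K 1 * vnorm Z x"
      using K x by force
  qed
qed

lemma bdd_above_op_norm:
  assumes "seminormed_vspace Z" "bounded_op Z Y T"
  shows "bdd_above ((\<lambda>x. vnorm Y (T x)) ` unit_ball Z)"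
proof -
  obtain K where "K > 0" and K: "\<And>x. x \<in> vcarrier Z \<Longrightarrow> vnorm Y (T x) \<le> K * vnorm Z x"
    using bounded_opE[OF assms] by blast
  have "vnorm Y (T x) \<le> K" if "x \<in> unit_ball Z" for x
  proof -
    have "K * vnorm Z x \<le> K * 1"
      using that \<open>K > 0\<close> by (intro mult_left_mono) (auto simp: unit_ball_def)
    then show ?thesis using K[of x] that by (auto simp: unit_ball_def)
  qed
  then show ?thesis
    by (auto intro!: bdd_aboveI2)
qed

lemma zero_in_unit_ball: "seminormed_vspace Z \<Longrightarrow> vzero Z \<in> unit_ball Z"
  by (simp add: unit_ball_def seminormed_vspace.zero_closed seminormed_vspace.norm_zero)

lemma op_norm_bound:
  assumes "seminormed_vspace Z" "seminormed_vspace Y" "bounded_op Z Y T" "x \<in> vcarrier Z"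
  shows "vnorm Y (T x) \<le> op_norm Z Y T * vnorm Z x"
proof -
  interpret Z: seminormed_vspace Z by fact
  interpret Y: seminormed_vspace Y by fact
  have lin: "linear_op Z Y T"
    using assms(3) by (simp add: bounded_op_def)
  have Tx: "T x \<in> vcarrier Y"
    using lin assms(4) by (auto simp: linear_op_def)
  show ?thesis
  proof (cases "vnorm Z x = 0")
    case True
    obtain K where "vnorm Y (T x) \<le> K * vnorm Z x"
      using bounded_opE[OF assms(1,3)] assms(4) by metis
    then show ?thesis using True by simp
  next
    case False
    then have pos: "vnorm Z x > 0"
      using Z.norm_nonneg[OF assms(4)] by simp
    define x' where "x' = vscale Z (inverse (vnorm Z x)) x"
    have "x' \<in> unit_ball Z"
      using pos assms(4) by (simp add: x'_def unit_ball_def Z.norm_scale Z.closed)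
    then have "vnorm Y (T x') \<le> op_norm Z Y T"
      unfolding op_norm_def by (intro cSUP_upper bdd_above_op_norm assms)
    moreover have "T x' = vscale Y (inverse (vnorm Z x)) (T x)"
      using lin assms(4) by (simp add: linear_op_def x'_def)
    ultimately show ?thesis
      using pos Tx by (simp add: Y.norm_scale field_simps)
  qed
qed

lemma dualI:
  assumes "\<And>x y. \<lbrakk>x \<in> vcarrier Z; y \<in> vcarrier Z\<rbrakk> \<Longrightarrow> f (vadd Z x y) = f x + f y"
    and "\<And>a x. x \<in> vcarrier Z \<Longrightarrow> f (vscale Z a x) = a * f x"
    and "\<And>x. x \<in> vcarrier Z \<Longrightarrow> \<bar>f x\<bar> \<le> K * vnorm Z x"
  shows "f \<in> dual Z"
  unfolding dual_def bounded_op_def linear_op_def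
  using assms by (auto simp: real_nspace_def intro!: exI[of _ K])

lemma dual_add: "\<lbrakk>f \<in> dual Z; x \<in> vcarrier Z; y \<in> vcarrier Z\<rbrakk> \<Longrightarrow> f (vadd Z x y) = f x + f y"
  by (simp add: dual_def bounded_op_def linear_op_def real_nspace_def)

lemma dual_scale: "\<lbrakk>f \<in> dual Z; x \<in> vcarrier Z\<rbrakk> \<Longrightarrow> f (vscale Z a x) = a * f x"
  by (simp add: dual_def bounded_op_def linear_op_def real_nspace_def)

lemma dual_diff:
  "\<lbrakk>seminormed_vspace Z; f \<in> dual Z; x \<in> vcarrier Z; y \<in> vcarrier Z\<rbrakk>
    \<Longrightarrow> f (vdiff Z x y) = f x - f y"
  by (simp add: vdiff_def dual_add dual_scale seminormed_vspace.scale_closed)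

lemma dual_zero:
  "\<lbrakk>seminormed_vspace Z; f \<in> dual Z\<rbrakk> \<Longrightarrow> f (vzero Z) = 0"
  by (metis dual_scale mult_zero_left seminormed_vspace.scale_zero_left seminormed_vspace.zero_closed)

lemma dual_bounded:
  assumes "seminormed_vspace Z" "f \<in> dual Z"
  obtains K where "K > 0" "\<And>x. x \<in> vcarrier Z \<Longrightarrow> \<bar>f x\<bar> \<le> K * vnorm Z x"
  using bounded_opE[of Z real_nspace f] assms by (auto simp: dual_def real_nspace_def)

lemma finite_dual_bounded:
  assumes "seminormed_vspace Z" "finite \<Phi>" "\<Phi> \<subseteq> dual Z"
  obtains K where "K > 0" "\<And>f x. \<lbrakk>f \<in> \<Phi>; x \<in> vcarrier Z\<rbrakk> \<Longrightarrow> \<bar>f x\<bar> \<le> K * vnorm Z x"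
proof -
  have "\<exists>K. 0 < K \<and> (\<forall>x\<in>vcarrier Z. \<bar>f x\<bar> \<le> K * vnorm Z x)" if "f \<in> \<Phi>" for f
    using dual_bounded[of Z f] assms that by (metis subsetD)
  then obtain k where k: "\<And>f. f \<in> \<Phi> \<Longrightarrow> 0 < k f"
      "\<And>f x. \<lbrakk>f \<in> \<Phi>; x \<in> vcarrier Z\<rbrakk> \<Longrightarrow> \<bar>f x\<bar> \<le> k f * vnorm Z x"
    by metis
  show thesis
  proof
    have "0 \<le> sum k \<Phi>"
      using k(1) by (simp add: sum_nonneg less_imp_le)
    then show "1 + sum k \<Phi> > 0" by simp
    fix f x assume fx: "f \<in> \<Phi>" "x \<in> vcarrier Z"
    have "k f \<le> sum k \<Phi>"
      using fx k(1) \<open>finite \<Phi>\<close> by (intro member_le_sum) (auto intro: less_imp_le)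
    then have "k f * vnorm Z x \<le> (1 + sum k \<Phi>) * vnorm Z x"
      by (intro mult_right_mono) (auto simp: seminormed_vspace.norm_nonneg[OF assms(1)] fx)
    then show "\<bar>f x\<bar> \<le> (1 + sum k \<Phi>) * vnorm Z x"
      using k(2)[OF fx] by linarith
  qed
qed

lemma dual_sphere_bound:
  assumes "seminormed_vspace Z" "f \<in> dual_sphere Z" "x \<in> vcarrier Z"
  shows "\<bar>f x\<bar> \<le> vnorm Z x"
  using op_norm_bound[OF assms(1) seminormed_real, of f x] assms(2,3)
  by (simp add: dual_sphere_def dual_def real_nspace_def)

lemma dual_sphere_subset: "f \<in> dual_sphere Z \<Longrightarrow> f \<in> dual Z"
  by (simp add: dual_sphere_def)

lemma dual_sphereI:
  assumes "seminormed_vspace Z" "f \<in> dual Z" "\<And>x. x \<in> vcarrier Z \<Longrightarrow> \<bar>f x\<bar> \<le> vnorm Z x"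
    and "e \<in> vcarrier Z" "vnorm Z e = 1" "\<bar>f e\<bar> = 1"
  shows "f \<in> dual_sphere Z"
proof -
  have bdd: "bdd_above ((\<lambda>x. vnorm real_nspace (f x)) ` unit_ball Z)"
    using assms(1,2) by (intro bdd_above_op_norm) (auto simp: dual_def)
  have "op_norm Z real_nspace f \<le> 1"
    unfolding op_norm_def using assms(3) zero_in_unit_ball[OF assms(1)]
    by (intro cSUP_least) (fastforce simp: unit_ball_def real_nspace_def)+
  moreover have "vnorm real_nspace (f e) \<le> op_norm Z real_nspace f"
    unfolding op_norm_def using assms(4,5) by (intro cSUP_upper bdd) (auto simp: unit_ball_def)
  ultimately show ?thesis
    using assms(2,6) by (simp add: dual_sphere_def real_nspace_def)
qed

section \<open>Spreading pairs\<close>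

text \<open>
  The common core of both properties: a point weakly close to \<open>x\<close> and hardly longer than \<open>x\<close>
  whose distance to \<open>y\<close> is nearly the largest that the triangle inequality permits. The norm
  condition carries a slack, like the others, so that the notion passes from dense subspaces to
  the whole space.
\<close>

definition spread :: "'a nspace \<Rightarrow> 'a \<Rightarrow> 'a \<Rightarrow> bool" where
  "spread Z x y \<longleftrightarrow>
     (\<forall>\<Phi> \<eta>. finite \<Phi> \<and> \<Phi> \<subseteq> dual Z \<and> \<eta> > 0 \<longrightarrow>
        (\<exists>w\<in>vcarrier Z. vnorm Z w \<le> vnorm Z x + \<eta> \<and> (\<forall>f\<in>\<Phi>. \<bar>f w - f x\<bar> \<le> \<eta>) \<and>
           vnorm Z (vdiff Z w y) \<ge> vnorm Z x + vnorm Z y - \<eta>))"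

lemma spreadD:
  assumes "spread Z x y" "finite \<Phi>" "\<Phi> \<subseteq> dual Z" "\<eta> > 0"
  obtains w where "w \<in> vcarrier Z" "vnorm Z w \<le> vnorm Z x + \<eta>"
    "\<And>f. f \<in> \<Phi> \<Longrightarrow> \<bar>f w - f x\<bar> \<le> \<eta>"
    "vnorm Z (vdiff Z w y) \<ge> vnorm Z x + vnorm Z y - \<eta>"
  using assms unfolding spread_def by meson

text \<open>
  Dividing a point of norm at most \<open>1 + \<theta>\<close> by \<open>1 + \<theta>\<close> moves it by at most \<open>\<theta>\<close>, and its values
  under functionals of norm at most \<open>K\<close> by at most \<open>K \<theta>\<close>.
\<close>

lemma spread_in_unit_ball:
  assumes Z: "seminormed_vspace Z" and x: "x \<in> unit_ball Z" and y: "y \<in> vcarrier Z"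
    and "spread Z x y" and \<Phi>: "finite \<Phi>" "\<Phi> \<subseteq> dual Z" and "\<eta> > 0"
  obtains w where "w \<in> unit_ball Z" "\<And>f. f \<in> \<Phi> \<Longrightarrow> \<bar>f w - f x\<bar> < \<eta>"
    "vnorm Z (vdiff Z w y) > vnorm Z x + vnorm Z y - \<eta>"
proof -
  interpret seminormed_vspace Z by fact
  obtain K where K: "K > 0" "\<And>f x. \<lbrakk>f \<in> \<Phi>; x \<in> vcarrier Z\<rbrakk> \<Longrightarrow> \<bar>f x\<bar> \<le> K * vnorm Z x"
    using finite_dual_bounded[OF Z \<Phi>] by blast
  define \<theta> where "\<theta> = \<eta> / (3 + K)"
  have \<theta>: "\<theta> > 0" "(2 + K) * \<theta> < \<eta>"
    using \<open>\<eta> > 0\<close> \<open>K > 0\<close> by (auto simp: \<theta>_def field_simps)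
  obtain w where w: "w \<in> vcarrier Z" "vnorm Z w \<le> vnorm Z x + \<theta>"
      "\<And>f. f \<in> \<Phi> \<Longrightarrow> \<bar>f w - f x\<bar> \<le> \<theta>"
      "vnorm Z (vdiff Z w y) \<ge> vnorm Z x + vnorm Z y - \<theta>"
    using spreadD[OF \<open>spread Z x y\<close> \<Phi> \<theta>(1)] by blast
  have wle: "vnorm Z w \<le> 1 + \<theta>"
    using w(2) x by (simp add: unit_ball_def)
  define w' where "w' = vscale Z (inverse (1 + \<theta>)) w"
  have w'c: "w' \<in> vcarrier Z"
    using w by (simp add: w'_def scale_closed)
  have norm': "vnorm Z w' = inverse (1 + \<theta>) * vnorm Z w"
    using w \<theta> by (simp add: w'_def norm_scale)
  have w'b: "w' \<in> unit_ball Z"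
    using w'c wle \<theta> by (simp add: unit_ball_def norm' field_simps)
  have w_eq: "w = vadd Z w' (vscale Z \<theta> w')"
    using w \<theta> w'c scale_add_left[of w' 1 \<theta>] by (simp add: w'_def scale_scale scale_one)
  have "vdiff Z w w' = vdiff Z (vadd Z w' (vscale Z \<theta> w')) w'"
    by (simp only: w_eq[symmetric])
  also have "\<dots> = vscale Z \<theta> w'"
    using w'c add_diff_cancel[of w' "vscale Z \<theta> w'"] by (simp add: scale_closed)
  finally have "vnorm Z (vdiff Z w w') = \<theta> * vnorm Z w'"
    using w'c \<theta> by (simp add: norm_scale)
  then have dist: "vnorm Z (vdiff Z w w') \<le> \<theta>"
    using w'b \<theta> mult_left_mono[of "vnorm Z w'" 1 \<theta>] by (simp add: unit_ball_def)
  show thesis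
  proof
    show "w' \<in> unit_ball Z" by fact
    fix f assume f: "f \<in> \<Phi>"
    have "\<bar>f w - f w'\<bar> \<le> K * vnorm Z (vdiff Z w w')"
      using K(2)[OF f, of "vdiff Z w w'"] f \<Phi> w w'c by (simp add: diff_closed dual_diff Z subsetD)
    also have "\<dots> \<le> K * \<theta>"
      using dist K by simp
    finally show "\<bar>f w' - f x\<bar> < \<eta>"
      using w(3)[OF f] \<theta> by (simp add: algebra_simps)
  next
    have "vnorm Z (vdiff Z w y) \<le> vnorm Z (vdiff Z w w') + vnorm Z (vdiff Z w' y)"
      using w w'c y by (simp add: norm_diff_triangle)
    moreover have "2 * \<theta> < \<eta>"
      using \<theta> mult_pos_pos[OF K(1) \<theta>(1)] by (simp add: distrib_right)
    ultimately show "vnorm Z (vdiff Z w' y) > vnorm Z x + vnorm Z y - \<eta>"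
      using dist w(4) by linarith
  qed
qed

text \<open>
  Subbasic weakly open sets are preimages of open sets of reals under functionals. The sets with
  the claimed property are closed under finite intersections and arbitrary unions.
\<close>

lemma weak_basic_neighbourhood:
  assumes "openin (weak_topology Z) W" "z \<in> W"
  obtains \<Phi> \<delta> where "finite \<Phi>" "\<Phi> \<subseteq> dual Z" "\<delta> > 0"
    "\<And>w. \<lbrakk>w \<in> vcarrier Z; \<And>f. f \<in> \<Phi> \<Longrightarrow> \<bar>f w - f z\<bar> < \<delta>\<rbrakk> \<Longrightarrow> w \<in> W"
proof -
  have "generate_topology_on {{z \<in> vcarrier Z. f z \<in> V} | f V. f \<in> dual Z \<and> open V} W"
    using assms(1) unfolding weak_topology_def by (rule openin_topology_generated_by)
  then have "z \<in> W \<Longrightarrow> \<exists>\<Phi> \<delta>. finite \<Phi> \<and> \<Phi> \<subseteq> dual Z \<and> \<delta> > 0 \<and>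
    (\<forall>w\<in>vcarrier Z. (\<forall>f\<in>\<Phi>. \<bar>f w - f z\<bar> < \<delta>) \<longrightarrow> w \<in> W)"
  proof (induction arbitrary: z)
    case Empty
    then show ?case by simp
  next
    case (Int a b)
    obtain \<Phi> \<delta> where 1: "finite \<Phi> \<and> \<Phi> \<subseteq> dual Z \<and> \<delta> > 0 \<and>
        (\<forall>w\<in>vcarrier Z. (\<forall>f\<in>\<Phi>. \<bar>f w - f z\<bar> < \<delta>) \<longrightarrow> w \<in> a)"
      using Int.IH(1)[OF IntD1[OF Int.prems]] by (elim exE)
    obtain \<Psi> \<epsilon> where 2: "finite \<Psi> \<and> \<Psi> \<subseteq> dual Z \<and> \<epsilon> > 0 \<and>
        (\<forall>w\<in>vcarrier Z. (\<forall>f\<in>\<Psi>. \<bar>f w - f z\<bar> < \<epsilon>) \<longrightarrow> w \<in> b)"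
      using Int.IH(2)[OF IntD2[OF Int.prems]] by (elim exE)
    show ?case
      using 1 2 by (intro exI[of _ "\<Phi> \<union> \<Psi>"] exI[of _ "min \<delta> \<epsilon>"]) auto
  next
    case (UN K)
    then obtain k where k: "k \<in> K" "z \<in> k" by blast
    obtain \<Phi> \<delta> where "finite \<Phi> \<and> \<Phi> \<subseteq> dual Z \<and> \<delta> > 0 \<and>
        (\<forall>w\<in>vcarrier Z. (\<forall>f\<in>\<Phi>. \<bar>f w - f z\<bar> < \<delta>) \<longrightarrow> w \<in> k)"
      using UN.IH[OF k] by (elim exE)
    then show ?case using k(1) by (intro exI[of _ \<Phi>] exI[of _ \<delta>]) auto
  next
    case (Basis s)
    then obtain f V where f: "s = {z \<in> vcarrier Z. f z \<in> V}" "f \<in> dual Z" "open V"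
      by blast
    then obtain \<delta> where "\<delta> > 0" "\<And>t. \<bar>t - f z\<bar> < \<delta> \<Longrightarrow> t \<in> V"
      using Basis.prems by (auto simp: open_dist dist_real_def)
    then show ?case
      using f by (intro exI[of _ "{f}"] exI[of _ \<delta>]) auto
  qed
  then show thesis
    using assms(2) that by meson
qed

lemma DD2P_if_spread:
  assumes Z: "seminormed_vspace Z" and sp: "\<And>x. x \<in> vcarrier Z \<Longrightarrow> spread Z x x"
  shows "DD2P Z"
  unfolding DD2P_def
proof (intro allI impI ballI)
  fix W z and \<epsilon> :: real
  assume W: "openin (subtopology (weak_topology Z) (unit_ball Z)) W \<and> W \<noteq> {}"
    and z: "z \<in> W \<inter> unit_sphere Z" and \<epsilon>: "\<epsilon> > 0"
  obtain W' where W': "openin (weak_topology Z) W'" "W = W' \<inter> unit_ball Z"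
    using W by (auto simp: openin_subtopology)
  then obtain \<Phi> \<delta> where \<Phi>: "finite \<Phi>" "\<Phi> \<subseteq> dual Z" "\<delta> > 0"
      and sub: "\<And>w. \<lbrakk>w \<in> vcarrier Z; \<And>f. f \<in> \<Phi> \<Longrightarrow> \<bar>f w - f z\<bar> < \<delta>\<rbrakk> \<Longrightarrow> w \<in> W'"
    using weak_basic_neighbourhood[of Z W' z] z by blast
  have zc: "z \<in> vcarrier Z" "vnorm Z z = 1" "z \<in> unit_ball Z"
    using z by (auto simp: unit_sphere_def unit_ball_def)
  obtain w where w: "w \<in> unit_ball Z" "\<And>f. f \<in> \<Phi> \<Longrightarrow> \<bar>f w - f z\<bar> < min \<delta> \<epsilon>"
      "vnorm Z (vdiff Z w z) > vnorm Z z + vnorm Z z - min \<delta> \<epsilon>"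
    using spread_in_unit_ball[OF Z zc(3,1) sp[OF zc(1)] \<Phi>(1,2), of "min \<delta> \<epsilon>"] \<Phi>(3) \<epsilon> by auto
  have "w \<in> W"
    using sub[of w] w(1,2) W'(2) by (auto simp: unit_ball_def)
  then show "\<exists>w\<in>W. vnorm Z (vdiff Z w z) > 2 - \<epsilon>"
    using w(3) zc by (intro bexI[of _ w]) auto
qed

text \<open>
  Functionals on \<open>Y\<close> pull back along \<open>J\<close> to functionals on \<open>U\<close>, so the points that witness
  spreading in \<open>U\<close> are mapped to witnesses in \<open>Y\<close>. With approximation error \<open>\<theta>\<close>, the norm
  condition loses \<open>2 \<theta>\<close>, the functionals lose \<open>(1 + K) \<theta>\<close> and the distance loses \<open>4 \<theta>\<close>.
\<close>

lemma spread_dense: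
  assumes U: "seminormed_vspace U" and Y: "seminormed_vspace Y"
    and J: "linear_op U Y J" "\<And>u. u \<in> vcarrier U \<Longrightarrow> vnorm Y (J u) = vnorm U u"
    and x: "x \<in> vcarrier Y" and y: "y \<in> vcarrier Y"
    and approx: "\<And>\<eta>. \<eta> > 0 \<Longrightarrow> \<exists>x'\<in>vcarrier U. \<exists>y'\<in>vcarrier U. spread U x' y' \<and>
        vnorm Y (vdiff Y x (J x')) \<le> \<eta> \<and> vnorm Y (vdiff Y y (J y')) \<le> \<eta>"
  shows "spread Y x y"
  unfolding spread_def
proof (intro allI impI, elim conjE)
  fix \<Phi> and \<eta> :: real
  assume \<Phi>: "finite \<Phi>" "\<Phi> \<subseteq> dual Y" and \<eta>: "\<eta> > 0"
  interpret U: seminormed_vspace U by fact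
  interpret Y: seminormed_vspace Y by fact
  have Jc: "J u \<in> vcarrier Y" if "u \<in> vcarrier U" for u
    using J(1) that by (auto simp: linear_op_def)
  obtain K where K: "K > 0" "\<And>f x. \<lbrakk>f \<in> \<Phi>; x \<in> vcarrier Y\<rbrakk> \<Longrightarrow> \<bar>f x\<bar> \<le> K * vnorm Y x"
    using finite_dual_bounded[OF Y \<Phi>] by blast
  define \<theta> where "\<theta> = \<eta> / (4 + K)"
  have "\<theta> > 0" "(4 + K) * \<theta> = \<eta>"
    using \<eta> K(1) by (simp_all add: \<theta>_def)
  then have \<theta>: "\<theta> > 0" "4 * \<theta> + K * \<theta> = \<eta>"
    by (simp_all add: distrib_right)
  have K\<theta>: "K * \<theta> \<ge> 0" using K(1) \<theta> by simp
  obtain x' y' where x': "x' \<in> vcarrier U" and y': "y' \<in> vcarrier U" and sp: "spread U x' y'"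
      and dx: "vnorm Y (vdiff Y x (J x')) \<le> \<theta>" and dy: "vnorm Y (vdiff Y y (J y')) \<le> \<theta>"
    using approx[OF \<theta>(1)] by blast
  have pull: "f \<circ> J \<in> dual U" if "f \<in> \<Phi>" for f
  proof (rule dualI)
    fix u v assume "u \<in> vcarrier U" "v \<in> vcarrier U"
    then show "(f \<circ> J) (vadd U u v) = (f \<circ> J) u + (f \<circ> J) v"
      using J(1) that \<Phi> Jc by (auto simp: linear_op_def dual_add subset_iff)
  next
    fix a u assume "u \<in> vcarrier U"
    then show "(f \<circ> J) (vscale U a u) = a * (f \<circ> J) u"
      using J(1) that \<Phi> Jc by (auto simp: linear_op_def dual_scale subset_iff)
  next
    fix u assume "u \<in> vcarrier U"
    then show "\<bar>(f \<circ> J) u\<bar> \<le> K * vnorm U u"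
      using K(2)[OF that, of "J u"] Jc J(2) by simp
  qed
  obtain w where w: "w \<in> vcarrier U" "vnorm U w \<le> vnorm U x' + \<theta>"
      "\<And>f. f \<in> (\<lambda>f. f \<circ> J) ` \<Phi> \<Longrightarrow> \<bar>f w - f x'\<bar> \<le> \<theta>"
      "vnorm U (vdiff U w y') \<ge> vnorm U x' + vnorm U y' - \<theta>"
    using spreadD[OF sp, of "(\<lambda>f. f \<circ> J) ` \<Phi>" \<theta>] \<Phi> pull \<theta> by blast
  have nx: "\<bar>vnorm Y x - vnorm U x'\<bar> \<le> \<theta>" and ny: "\<bar>vnorm Y y - vnorm U y'\<bar> \<le> \<theta>"
    using Y.abs_norm_diff_le[OF x Jc[OF x']] Y.abs_norm_diff_le[OF y Jc[OF y']] dx dy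
    by (simp_all add: J(2) x' y')
  show "\<exists>w\<in>vcarrier Y. vnorm Y w \<le> vnorm Y x + \<eta> \<and> (\<forall>f\<in>\<Phi>. \<bar>f w - f x\<bar> \<le> \<eta>) \<and>
      vnorm Y (vdiff Y w y) \<ge> vnorm Y x + vnorm Y y - \<eta>"
  proof (intro bexI conjI ballI)
    show "J w \<in> vcarrier Y" using Jc w(1) .
    show "vnorm Y (J w) \<le> vnorm Y x + \<eta>"
      using w(1,2) nx \<theta> K\<theta> by (simp add: J(2))
  next
    fix f assume f: "f \<in> \<Phi>"
    have "\<bar>f x - f (J x')\<bar> \<le> K * vnorm Y (vdiff Y x (J x'))"
      using K(2)[OF f, of "vdiff Y x (J x')"] f \<Phi> x Jc[OF x']
      by (simp add: Y.diff_closed dual_diff[OF Y] subset_iff)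
    also have "\<dots> \<le> K * \<theta>" using dx K(1) by simp
    finally have "\<bar>f x - f (J x')\<bar> \<le> K * \<theta>" .
    moreover have "\<bar>f (J w) - f (J x')\<bar> \<le> \<theta>"
      using w(3)[of "f \<circ> J"] f by simp
    ultimately show "\<bar>f (J w) - f x\<bar> \<le> \<eta>" using \<theta> by linarith
  next
    have "vnorm Y (vdiff Y (J w) (J y')) = vnorm U (vdiff U w y')"
      using linear_op_diff[OF U J(1) w(1) y'] J(2)[of "vdiff U w y'"] w(1) y'
      by (simp add: U.diff_closed)
    moreover have "vnorm Y (vdiff Y (J w) (J y')) \<le>
        vnorm Y (vdiff Y (J w) y) + vnorm Y (vdiff Y y (J y'))"
      using Jc w(1) y y' by (simp add: Y.norm_diff_triangle)
    ultimately show "vnorm Y (vdiff Y (J w) y) \<ge> vnorm Y x + vnorm Y y - \<eta>"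
      using w(4) dy nx ny \<theta> K\<theta> by linarith
  qed
qed

lemma rank_one_functional:
  assumes Z: "seminormed_vspace Z" and T: "bounded_op Z Z T" "rank_one Z Z T"
    and nz: "\<And>x. \<lbrakk>x \<in> vcarrier Z; vnorm Z x = 0\<rbrakk> \<Longrightarrow> x = vzero Z"
  obtains f y where "f \<in> dual Z" "y \<in> vcarrier Z" "y \<noteq> vzero Z"
    "y \<in> T ` vcarrier Z" "\<And>x. x \<in> vcarrier Z \<Longrightarrow> T x = vscale Z (f x) y"
proof -
  interpret seminormed_vspace Z by fact
  obtain y where y: "y \<in> vcarrier Z" "y \<noteq> vzero Z"
      and ran: "T ` vcarrier Z = range (\<lambda>a. vscale Z a y)"
    using T(2) by (auto simp: rank_one_def)
  have ny: "vnorm Z y > 0"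
    using nz[OF y(1)] y norm_nonneg[OF y(1)] by fastforce
  have inj: "a = b" if "vscale Z a y = vscale Z b y" for a b
  proof -
    have "vscale Z (a - b) y = vdiff Z (vscale Z a y) (vscale Z b y)"
      using y scale_add_left[of y a "-b"] by (simp add: vdiff_def scale_scale)
    also have "\<dots> = vzero Z" using that y by (simp add: diff_self scale_closed)
    finally have "\<bar>a - b\<bar> * vnorm Z y = 0"
      using norm_scale[OF y(1), of "a - b"] norm_zero by simp
    then show ?thesis using ny by simp
  qed
  have "\<exists>a. T x = vscale Z a y" if "x \<in> vcarrier Z" for x
    using ran that by blast
  then obtain f where f: "\<And>x. x \<in> vcarrier Z \<Longrightarrow> T x = vscale Z (f x) y"
    by metis
  have lin: "linear_op Z Z T" using T by (simp add: bounded_op_def)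
  obtain K where K: "\<And>x. x \<in> vcarrier Z \<Longrightarrow> vnorm Z (T x) \<le> K * vnorm Z x"
    using bounded_opE[OF Z T(1)] by blast
  have "f \<in> dual Z"
  proof (rule dualI)
    fix u v assume uv: "u \<in> vcarrier Z" "v \<in> vcarrier Z"
    show "f (vadd Z u v) = f u + f v"
      using lin uv y by (intro inj) (auto simp: linear_op_def f[symmetric] add_closed scale_add_left)
  next
    fix a u assume u: "u \<in> vcarrier Z"
    show "f (vscale Z a u) = a * f u"
      using lin u y f[OF u] by (intro inj) (auto simp: linear_op_def f[symmetric] scale_closed scale_scale[symmetric])
  next
    fix u assume u: "u \<in> vcarrier Z"
    show "\<bar>f u\<bar> \<le> K / vnorm Z y * vnorm Z u"
      using K[OF u] ny y by (simp add: f[OF u] norm_scale field_simps)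
  qed
  moreover have "y \<in> T ` vcarrier Z"
    unfolding ran using scale_one[OF y(1)] by (metis rangeI)
  ultimately show thesis using that y f by blast
qed

text \<open>
  Write \<open>T x = f x y\<close> and choose \<open>x\<close> in the unit ball such that \<open>T x\<close> is almost as long as
  possible. Spreading \<open>x\<close> away from \<open>- T x\<close> gives a point \<open>w\<close> for which \<open>T x + w\<close> has norm
  nearly \<open>\<parallel>T\<parallel> + 1\<close>. Since \<open>f\<close> hardly distinguishes \<open>w\<close> from \<open>x\<close>, the same holds for \<open>T w + w\<close>.
\<close>

lemma daugavet_if_spread:
  assumes "normed_vspace Z" and sp: "\<And>x y. \<lbrakk>x \<in> vcarrier Z; y \<in> vcarrier Z\<rbrakk> \<Longrightarrow> spread Z x y"
  shows "daugavet_property Z"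
  unfolding daugavet_property_def
proof (intro allI impI, elim conjE)
  fix T assume T: "bounded_op Z Z T" "rank_one Z Z T"
  interpret normed_vspace Z by fact
  have Z: "seminormed_vspace Z" by unfold_locales
  obtain f y where f: "f \<in> dual Z" and y: "y \<in> vcarrier Z" "y \<noteq> vzero Z" "y \<in> T ` vcarrier Z"
      and Tf: "\<And>x. x \<in> vcarrier Z \<Longrightarrow> T x = vscale Z (f x) y"
    using rank_one_functional[OF Z T] norm_eq_zero by blast
  let ?S = "\<lambda>x. vadd Z (T x) x" and ?t = "op_norm Z Z T"
  have Tc: "T x \<in> vcarrier Z" if "x \<in> vcarrier Z" for x
    using that y by (simp add: Tf scale_closed)
  have bddT: "bdd_above ((\<lambda>x. vnorm Z (T x)) ` unit_ball Z)"
    using bdd_above_op_norm[OF Z T(1)] .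
  have S_le: "vnorm Z (?S x) \<le> 1 + ?t" if "x \<in> unit_ball Z" for x
  proof -
    have "vnorm Z (?S x) \<le> vnorm Z (T x) + vnorm Z x"
      using that by (intro norm_triangle Tc) (auto simp: unit_ball_def)
    moreover have "vnorm Z (T x) \<le> ?t"
      unfolding op_norm_def using that by (intro cSUP_upper bddT)
    ultimately show ?thesis using that by (auto simp: unit_ball_def)
  qed
  have "op_norm Z Z ?S \<le> 1 + ?t"
    unfolding op_norm_def[of _ _ ?S] using zero_in_unit_ball[OF Z]
    by (intro cSUP_least) (auto intro: S_le)
  moreover have "1 + ?t \<le> op_norm Z Z ?S"
  proof -
    have t_pos: "?t > 0"
    proof -
      obtain x where x: "x \<in> vcarrier Z" "T x = y" using y(3) by blast
      have "0 < vnorm Z y"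
        using norm_eq_zero[OF y(1)] norm_nonneg[OF y(1)] y(2) by linarith
      also have "\<dots> \<le> ?t * vnorm Z x"
        using op_norm_bound[OF Z Z T(1) x(1)] x(2) by simp
      finally show ?thesis
        using norm_nonneg[OF x(1)] by (simp add: zero_less_mult_iff)
    qed
    have "(1 - \<eta>) * (1 + ?t) - (1 + vnorm Z y) * \<eta> \<le> op_norm Z Z ?S" if \<eta>: "\<eta> > 0" for \<eta>
    proof -
      have "\<exists>x\<in>unit_ball Z. (1 - \<eta>) * ?t < vnorm Z (T x)"
        using t_pos \<eta> zero_in_unit_ball[OF Z] bddT
        by (subst less_cSUP_iff[symmetric]) (auto simp: op_norm_def[symmetric])
      then obtain x where x: "x \<in> unit_ball Z" "(1 - \<eta>) * ?t < vnorm Z (T x)" by blast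
      then have xc: "x \<in> vcarrier Z" by (simp add: unit_ball_def)
      \<comment> \<open>a point of the ball at which \<open>T\<close> almost attains its norm is itself almost normalised\<close>
      have "(1 - \<eta>) * ?t < ?t * vnorm Z x"
        using op_norm_bound[OF Z Z T(1) xc] x(2) by linarith
      then have nx: "1 - \<eta> \<le> vnorm Z x"
        using t_pos by (simp add: mult.commute)
      define v where "v = vscale Z (-1) (T x)"
      have v: "v \<in> vcarrier Z" "vnorm Z v = vnorm Z (T x)"
        using Tc[OF xc] by (simp_all add: v_def norm_scale scale_closed)
      obtain w where w: "w \<in> unit_ball Z" "\<bar>f w - f x\<bar> < \<eta>"
          "vnorm Z (vdiff Z w v) > vnorm Z x + vnorm Z v - \<eta>"
        using spread_in_unit_ball[OF Z x(1) v(1) sp[OF xc v(1)], of "{f}" \<eta>] f \<eta> by auto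
      then have wc: "w \<in> vcarrier Z" by (simp add: unit_ball_def)
      have "vdiff Z w v = vadd Z (T x) w"
        using Tc[OF xc] wc by (simp add: vdiff_def v_def scale_scale scale_one add_commute)
      then have "vnorm Z (vdiff Z w v) \<le> vnorm Z (?S w) + vnorm Z (vdiff Z (vadd Z (T x) w) (?S w))"
        using norm_le_add_diff[of "vadd Z (T x) w" "?S w"] Tc xc wc by (simp add: add_closed)
      also have "vdiff Z (vadd Z (T x) w) (?S w) = vscale Z (f x - f w) y"
        using Tc[OF xc] Tc[OF wc] wc xc y scale_add_left[of y "f x" "- f w"]
        by (simp add: add_diff_add diff_self add_zero_right diff_closed)
           (simp add: Tf vdiff_def scale_scale)
      also have "vnorm Z \<dots> = \<bar>f w - f x\<bar> * vnorm Z y"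
        using y by (simp add: norm_scale abs_minus_commute)
      also have "\<dots> \<le> \<eta> * vnorm Z y"
        using w(2) norm_nonneg[OF y(1)] by (intro mult_right_mono) auto
      also have "vnorm Z (?S w) \<le> op_norm Z Z ?S"
        unfolding op_norm_def using w(1) S_le by (intro cSUP_upper) (auto intro!: bdd_aboveI2)
      finally show ?thesis
        using w(3) v(2) nx x(2) by (simp add: algebra_simps)
    qed
    then have "\<forall>\<^sub>F \<eta> in at_right 0. (1 - \<eta>) * (1 + ?t) - (1 + vnorm Z y) * \<eta> \<le> op_norm Z Z ?S"
      by (auto simp: eventually_at_right_less eventually_at intro!: exI[of _ 1])
    moreover have "((\<lambda>\<eta>. (1 - \<eta>) * (1 + ?t) - (1 + vnorm Z y) * \<eta>) \<longlongrightarrow>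
        (1 - 0) * (1 + ?t) - (1 + vnorm Z y) * 0) (at_right 0)"
      by (intro tendsto_intros)
    ultimately show ?thesis
      using tendsto_upperbound[of _ "1 + ?t"] by force
  qed
  ultimately show "op_norm Z Z ?S = 1 + ?t" by linarith
qed

section \<open>One-dimensional L-summands\<close>

text \<open>
  The line spanned by \<open>e\<close> is an \<open>\<ell>\<^sub>1\<close>-summand of \<open>Z\<close>, with complement the kernel of \<open>f\<close>.
\<close>

definition L_line :: "'a nspace \<Rightarrow> ('a \<Rightarrow> real) \<Rightarrow> 'a \<Rightarrow> bool" where
  "L_line Z f e \<longleftrightarrow> f \<in> dual Z \<and> e \<in> vcarrier Z \<and> vnorm Z e = 1 \<and> f e = 1 \<and>
     (\<forall>x\<in>vcarrier Z. vnorm Z x = \<bar>f x\<bar> + vnorm Z (vdiff Z x (vscale Z (f x) e)))"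

text \<open>
  A point \<open>w\<close> of the unit ball with \<open>f w > 1/2\<close> satisfies
  \<open>\<parallel>w - e\<parallel> \<le> \<bar>f w - 1\<bar> + \<parallel>w - f w e\<parallel> \<le> (1 - f w) + (1 - f w) < 1\<close>, so \<open>e\<close> has no nearly
  diametral point in this slice.
\<close>

lemma not_DD2P_if_L_line:
  assumes Z: "seminormed_vspace Z" and "L_line Z f e"
  shows "\<not> DD2P Z"
proof
  assume DD2P: "DD2P Z"
  interpret seminormed_vspace Z by fact
  have f: "f \<in> dual Z" and e: "e \<in> vcarrier Z" "vnorm Z e = 1" "f e = 1"
    and split: "\<And>x. x \<in> vcarrier Z \<Longrightarrow> vnorm Z x = \<bar>f x\<bar> + vnorm Z (vdiff Z x (vscale Z (f x) e))"
    using assms(2) by (auto simp: L_line_def)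
  define W where "W = {z \<in> vcarrier Z. f z \<in> {1/2<..}} \<inter> unit_ball Z"
  have "openin (weak_topology Z) {z \<in> vcarrier Z. f z \<in> {1/2<..}}"
    unfolding weak_topology_def
    by (rule topology_generated_by_Basis) (use f open_greaterThan in blast)
  then have "openin (subtopology (weak_topology Z) (unit_ball Z)) W"
    by (auto simp: openin_subtopology W_def)
  moreover have "e \<in> W \<inter> unit_sphere Z"
    using e by (simp add: W_def unit_ball_def unit_sphere_def)
  ultimately obtain w where w: "w \<in> W" "vnorm Z (vdiff Z w e) > 2 - 1"
    using DD2P unfolding DD2P_def by (metis IntE empty_iff zero_less_one)
  have wc: "w \<in> vcarrier Z" "f w > 1/2" "vnorm Z w \<le> 1"
    using w(1) by (auto simp: W_def unit_ball_def)
  have fe: "vscale Z (f w) e \<in> vcarrier Z" using e by (simp add: scale_closed)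
  have "vdiff Z (vscale Z (f w) e) e = vscale Z (f w - 1) e"
    using e scale_add_left[of e "f w" "-1"] by (simp add: vdiff_def)
  then have "vnorm Z (vdiff Z (vscale Z (f w) e) e) = \<bar>f w - 1\<bar>"
    using e by (simp add: norm_scale)
  then have "vnorm Z (vdiff Z w e) \<le> vnorm Z (vdiff Z w (vscale Z (f w) e)) + \<bar>f w - 1\<bar>"
    using norm_diff_triangle[OF wc(1) fe e(1)] by simp
  then show False
    using split[OF wc(1)] wc w(2) norm_nonneg[OF diff_closed[OF wc(1) fe]] by linarith
qed

text \<open>
  The operator \<open>T x = - f x e\<close> has norm at least 1, while \<open>I + T\<close> is the projection onto the
  complementary summand and has norm at most 1.
\<close>

lemma not_daugavet_if_L_line:
  assumes Z: "seminormed_vspace Z" and "L_line Z f e"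
  shows "\<not> daugavet_property Z"
proof
  assume D: "daugavet_property Z"
  interpret seminormed_vspace Z by fact
  have f: "f \<in> dual Z" and e: "e \<in> vcarrier Z" "vnorm Z e = 1" "f e = 1"
    and split: "\<And>x. x \<in> vcarrier Z \<Longrightarrow> vnorm Z x = \<bar>f x\<bar> + vnorm Z (vdiff Z x (vscale Z (f x) e))"
    using assms(2) by (auto simp: L_line_def)
  define T where "T x = vscale Z (- f x) e" for x
  have f_le: "\<bar>f x\<bar> \<le> vnorm Z x" if "x \<in> vcarrier Z" for x
    using split[OF that] norm_nonneg[of "vdiff Z x (vscale Z (f x) e)"] that e
    by (simp add: closed)
  have norm_T: "vnorm Z (T x) = \<bar>f x\<bar>" for x
    using e by (simp add: T_def norm_scale)
  have "linear_op Z Z T"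
    using e f by (auto simp: linear_op_def T_def closed dual_add dual_scale scale_scale
      scale_add_left[symmetric])
  then have bT: "bounded_op Z Z T"
    unfolding bounded_op_def using f_le by (auto simp: norm_T intro!: exI[of _ 1])
  have "vscale Z a e \<in> T ` vcarrier Z" for a
    using e f by (intro image_eqI[of _ _ "vscale Z (-a) e"]) (auto simp: T_def closed dual_scale)
  then have "T ` vcarrier Z = range (\<lambda>a. vscale Z a e)"
    by (auto simp: T_def)
  moreover have "e \<noteq> vzero Z"
    using e norm_zero by auto
  ultimately have "rank_one Z Z T"
    using e by (auto simp: rank_one_def)
  then have eq: "op_norm Z Z (\<lambda>x. vadd Z (T x) x) = 1 + op_norm Z Z T"
    using D bT by (auto simp: daugavet_property_def)
  have "vnorm Z (vadd Z (T x) x) \<le> 1" if "x \<in> unit_ball Z" for x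
  proof -
    have "vadd Z (T x) x = vdiff Z x (vscale Z (f x) e)"
      using that e by (simp add: T_def vdiff_def scale_scale add_commute closed unit_ball_def)
    then show ?thesis
      using split[of x] that abs_ge_zero[of "f x"] unfolding unit_ball_def by auto
  qed
  then have "op_norm Z Z (\<lambda>x. vadd Z (T x) x) \<le> 1"
    unfolding op_norm_def using zero_in_unit_ball[OF Z] by (intro cSUP_least) auto
  moreover have "1 \<le> op_norm Z Z T"
    using op_norm_bound[OF Z Z bT e(1)] e by (simp add: norm_T)
  ultimately show False using eq by linarith
qed


section \<open>Completions\<close>

abbreviation compl_class :: "'a nspace \<Rightarrow> (nat \<Rightarrow> 'a) \<Rightarrow> (nat \<Rightarrow> 'a) set" where
  "compl_class Z s \<equiv> null_diff Z `` {s}"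

context seminormed_vspace
begin

lemma cauchy_seqs_carrier: "s \<in> cauchy_seqs Z \<Longrightarrow> s n \<in> vcarrier Z"
  by (auto simp: cauchy_seqs_def)

lemma cauchy_seqsD:
  assumes "s \<in> cauchy_seqs Z" "e > 0"
  obtains N where "\<And>m n. \<lbrakk>m \<ge> N; n \<ge> N\<rbrakk> \<Longrightarrow> vnorm Z (vdiff Z (s m) (s n)) < e"
proof -
  have "\<exists>N. \<forall>m\<ge>N. \<forall>n\<ge>N. vnorm Z (vdiff Z (s m) (s n)) < e"
    using assms by (simp add: cauchy_seqs_def)
  then show thesis using that by blast
qed

lemma const_in_cauchy_seqs: "x \<in> vcarrier Z \<Longrightarrow> (\<lambda>_. x) \<in> cauchy_seqs Z"
  by (auto simp: cauchy_seqs_def diff_self norm_zero)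

lemma add_in_cauchy_seqs:
  assumes s: "s \<in> cauchy_seqs Z" and t: "t \<in> cauchy_seqs Z"
  shows "(\<lambda>n. vadd Z (s n) (t n)) \<in> cauchy_seqs Z"
  unfolding cauchy_seqs_def
proof (intro CollectI conjI allI impI)
  note sc = cauchy_seqs_carrier[OF s] cauchy_seqs_carrier[OF t]
  show "range (\<lambda>n. vadd Z (s n) (t n)) \<subseteq> vcarrier Z"
    using s t by (auto simp: add_closed sc)
  fix e :: real assume "e > 0"
  then have "e / 2 > 0" by simp
  obtain N where N: "\<And>m n. \<lbrakk>m \<ge> N; n \<ge> N\<rbrakk> \<Longrightarrow> vnorm Z (vdiff Z (s m) (s n)) < e / 2"
    using cauchy_seqsD[OF s \<open>e / 2 > 0\<close>] by metis
  obtain N' where N': "\<And>m n. \<lbrakk>m \<ge> N'; n \<ge> N'\<rbrakk> \<Longrightarrow> vnorm Z (vdiff Z (t m) (t n)) < e / 2"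
    using cauchy_seqsD[OF t \<open>e / 2 > 0\<close>] by metis
  have "vnorm Z (vdiff Z (vadd Z (s m) (t m)) (vadd Z (s n) (t n))) < e"
    if "m \<ge> max N N'" "n \<ge> max N N'" for m n
  proof -
    have "vnorm Z (vdiff Z (vadd Z (s m) (t m)) (vadd Z (s n) (t n)))
        \<le> vnorm Z (vdiff Z (s m) (s n)) + vnorm Z (vdiff Z (t m) (t n))"
      using s t by (simp add: add_diff_add sc norm_triangle diff_closed)
    moreover have "vnorm Z (vdiff Z (s m) (s n)) < e / 2" "vnorm Z (vdiff Z (t m) (t n)) < e / 2"
      using N N' that by auto
    ultimately show ?thesis by linarith
  qed
  then show "\<exists>N. \<forall>m\<ge>N. \<forall>n\<ge>N. vnorm Z (vdiff Z (vadd Z (s m) (t m)) (vadd Z (s n) (t n))) < e"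
    by blast
qed

lemma scale_in_cauchy_seqs:
  assumes s: "s \<in> cauchy_seqs Z"
  shows "(\<lambda>n. vscale Z a (s n)) \<in> cauchy_seqs Z"
  unfolding cauchy_seqs_def
proof (intro CollectI conjI allI impI)
  note sc = cauchy_seqs_carrier[OF s]
  show "range (\<lambda>n. vscale Z a (s n)) \<subseteq> vcarrier Z"
    using s by (auto simp: scale_closed sc)
  fix e :: real assume "e > 0"
  then have "e / (\<bar>a\<bar> + 1) > 0" by simp
  then obtain N where N: "\<And>m n. \<lbrakk>m \<ge> N; n \<ge> N\<rbrakk> \<Longrightarrow> vnorm Z (vdiff Z (s m) (s n)) < e / (\<bar>a\<bar> + 1)"
      using cauchy_seqsD[OF s] by metis
  have "vnorm Z (vdiff Z (vscale Z a (s m)) (vscale Z a (s n))) < e" if "m \<ge> N" "n \<ge> N" for m n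
  proof -
    have "vnorm Z (vdiff Z (vscale Z a (s m)) (vscale Z a (s n))) = \<bar>a\<bar> * vnorm Z (vdiff Z (s m) (s n))"
      using s by (simp add: scale_diff[symmetric] sc diff_closed norm_scale)
    also have "\<dots> \<le> (\<bar>a\<bar> + 1) * vnorm Z (vdiff Z (s m) (s n))"
      using s by (intro mult_right_mono norm_nonneg) (auto simp: sc diff_closed)
    also have "\<dots> < e"
      using N that by (auto simp: pos_less_divide_eq mult.commute)
    finally show ?thesis .
  qed
  then show "\<exists>N. \<forall>m\<ge>N. \<forall>n\<ge>N. vnorm Z (vdiff Z (vscale Z a (s m)) (vscale Z a (s n))) < e"
    by blast
qed

lemma null_diffD:
  assumes "(s, t) \<in> null_diff Z"
  shows "s \<in> cauchy_seqs Z" "t \<in> cauchy_seqs Z" "\<And>n. s n \<in> vcarrier Z" "\<And>n. t n \<in> vcarrier Z"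
    "(\<lambda>n. vnorm Z (vdiff Z (s n) (t n))) \<longlonglongrightarrow> 0"
  using assms by (simp_all add: null_diff_def cauchy_seqs_carrier)

lemma equiv_null_diff: "equiv (cauchy_seqs Z) (null_diff Z)"
proof (rule equivI)
  show "null_diff Z \<subseteq> cauchy_seqs Z \<times> cauchy_seqs Z" by (auto simp: null_diff_def)
  show "refl_on (cauchy_seqs Z) (null_diff Z)"
    by (rule refl_onI) (simp add: null_diff_def diff_self cauchy_seqs_carrier norm_zero)
  show "sym (null_diff Z)"
  proof (rule symI)
    fix s t assume st: "(s, t) \<in> null_diff Z"
    show "(t, s) \<in> null_diff Z"
      using null_diffD[OF st] by (simp add: null_diff_def norm_diff_commute)
  qed
  show "trans (null_diff Z)"
  proof (rule transI)
    fix r s t assume rs: "(r, s) \<in> null_diff Z" "(s, t) \<in> null_diff Z"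
    note D = null_diffD[OF rs(1)] null_diffD[OF rs(2)]
    have "(\<lambda>n. vnorm Z (vdiff Z (r n) (t n))) \<longlonglongrightarrow> 0"
    proof (rule tendsto_sandwich)
      show "\<forall>\<^sub>F n in sequentially. 0 \<le> vnorm Z (vdiff Z (r n) (t n))"
        by (intro always_eventually allI norm_nonneg diff_closed D)
      show "\<forall>\<^sub>F n in sequentially. vnorm Z (vdiff Z (r n) (t n)) \<le>
          vnorm Z (vdiff Z (r n) (s n)) + vnorm Z (vdiff Z (s n) (t n))"
        by (intro always_eventually allI norm_diff_triangle D)
      show "(\<lambda>n. vnorm Z (vdiff Z (r n) (s n)) + vnorm Z (vdiff Z (s n) (t n))) \<longlonglongrightarrow> 0"
        by (intro tendsto_add_zero D)
    qed auto
    then show "(r, t) \<in> null_diff Z" using D by (simp add: null_diff_def)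
  qed
qed

text \<open>
  The norm and the bounded functionals are both Lipschitz functions \<open>F\<close>, and this alone makes them
  converge along Cauchy sequences, with a limit that depends only on the class of the sequence.
\<close>

lemma dominated_converges:
  assumes s: "s \<in> cauchy_seqs Z"
    and F: "\<And>x y. \<lbrakk>x \<in> vcarrier Z; y \<in> vcarrier Z\<rbrakk> \<Longrightarrow> \<bar>F x - F y\<bar> \<le> K * vnorm Z (vdiff Z x y)"
  shows "convergent (\<lambda>n. F (s n) :: real)"
proof -
  have "Cauchy (\<lambda>n. F (s n))"
  proof (rule metric_CauchyI)
    fix e :: real assume "e > 0"
    then have "e / (\<bar>K\<bar> + 1) > 0" by simp
    then obtain N where N: "\<And>m n. \<lbrakk>m \<ge> N; n \<ge> N\<rbrakk> \<Longrightarrow> vnorm Z (vdiff Z (s m) (s n)) < e / (\<bar>K\<bar> + 1)"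
      using cauchy_seqsD[OF s] by metis
    have "dist (F (s m)) (F (s n)) < e" if "m \<ge> N" "n \<ge> N" for m n
    proof -
      have "\<bar>F (s m) - F (s n)\<bar> \<le> K * vnorm Z (vdiff Z (s m) (s n))"
        by (intro F cauchy_seqs_carrier[OF s])
      also have "\<dots> \<le> (\<bar>K\<bar> + 1) * vnorm Z (vdiff Z (s m) (s n))"
        by (intro mult_right_mono norm_nonneg diff_closed cauchy_seqs_carrier[OF s]) auto
      also have "\<dots> < e"
        using N that by (auto simp: pos_less_divide_eq mult.commute)
      finally show ?thesis by (simp add: dist_real_def)
    qed
    then show "\<exists>N. \<forall>m\<ge>N. \<forall>n\<ge>N. dist (F (s m)) (F (s n)) < e" by blast
  qed
  then show ?thesis by (rule Cauchy_convergent)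
qed

lemma dominated_lim_eq:
  assumes st: "(s, t) \<in> null_diff Z"
    and F: "\<And>x y. \<lbrakk>x \<in> vcarrier Z; y \<in> vcarrier Z\<rbrakk> \<Longrightarrow> \<bar>F x - F y\<bar> \<le> K * vnorm Z (vdiff Z x y)"
  shows "lim (\<lambda>n. F (s n) :: real) = lim (\<lambda>n. F (t n))"
proof -
  have s: "s \<in> cauchy_seqs Z" and t: "t \<in> cauchy_seqs Z"
    and 0: "(\<lambda>n. vnorm Z (vdiff Z (s n) (t n))) \<longlonglongrightarrow> 0"
    using st by (auto simp: null_diff_def)
  have "(\<lambda>n. F (s n) - F (t n)) \<longlonglongrightarrow> 0"
  proof (rule Lim_null_comparison)
    show "\<forall>\<^sub>F n in sequentially. norm (F (s n) - F (t n)) \<le> K * vnorm Z (vdiff Z (s n) (t n))"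
      by (intro always_eventually allI)
        (simp add: F cauchy_seqs_carrier[OF s] cauchy_seqs_carrier[OF t])
    show "(\<lambda>n. K * vnorm Z (vdiff Z (s n) (t n))) \<longlonglongrightarrow> 0"
      using tendsto_mult_left[OF 0, of K] by simp
  qed
  moreover have "(\<lambda>n. F (s n) - F (t n)) \<longlonglongrightarrow> lim (\<lambda>n. F (s n)) - lim (\<lambda>n. F (t n))"
    by (intro tendsto_diff convergent_LIMSEQ_iff[THEN iffD1] dominated_converges[OF s F] dominated_converges[OF t F])
  ultimately show ?thesis
    using LIMSEQ_unique by fastforce
qed

lemma cclass_eqI: "(s, t) \<in> null_diff Z \<Longrightarrow> compl_class Z s = compl_class Z t"
  by (rule equiv_class_eq[OF equiv_null_diff])

lemma completion_carrier: "vcarrier (nspace_completion Z) = compl_class Z ` cauchy_seqs Z"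
  by (auto simp: nspace_completion_def quotient_def)

lemma completion_zero: "vzero (nspace_completion Z) = compl_class Z (\<lambda>_. vzero Z)"
  by (simp add: nspace_completion_def)

lemma completion_add:
  assumes s: "s \<in> cauchy_seqs Z" and t: "t \<in> cauchy_seqs Z"
  shows "vadd (nspace_completion Z) (compl_class Z s) (compl_class Z t) = compl_class Z (\<lambda>n. vadd Z (s n) (t n))"
proof -
  have "congruent2 (null_diff Z) (null_diff Z) (\<lambda>s t. compl_class Z (\<lambda>n. vadd Z (s n) (t n)))"
  proof (rule congruent2I')
    fix s s' t t' assume st: "(s, s') \<in> null_diff Z" "(t, t') \<in> null_diff Z"
    note c = null_diffD[OF st(1)] null_diffD[OF st(2)]
    have "(\<lambda>n. vnorm Z (vdiff Z (vadd Z (s n) (t n)) (vadd Z (s' n) (t' n)))) \<longlonglongrightarrow> 0"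
    proof (rule tendsto_sandwich)
      show "\<forall>\<^sub>F n in sequentially. 0 \<le> vnorm Z (vdiff Z (vadd Z (s n) (t n)) (vadd Z (s' n) (t' n)))"
        by (intro always_eventually allI norm_nonneg closed c)
      show "\<forall>\<^sub>F n in sequentially. vnorm Z (vdiff Z (vadd Z (s n) (t n)) (vadd Z (s' n) (t' n))) \<le>
          vnorm Z (vdiff Z (s n) (s' n)) + vnorm Z (vdiff Z (t n) (t' n))"
        by (simp add: add_diff_add norm_triangle closed c)
      show "(\<lambda>n. vnorm Z (vdiff Z (s n) (s' n)) + vnorm Z (vdiff Z (t n) (t' n))) \<longlonglongrightarrow> 0"
        by (intro tendsto_add_zero c)
    qed auto
    then show "compl_class Z (\<lambda>n. vadd Z (s n) (t n)) = compl_class Z (\<lambda>n. vadd Z (s' n) (t' n))"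
      by (intro cclass_eqI) (simp add: null_diff_def add_in_cauchy_seqs c)
  qed
  then show ?thesis
    using UN_equiv_class2[OF equiv_null_diff equiv_null_diff _ s t]
    by (simp add: nspace_completion_def)
qed

lemma completion_scale:
  assumes s: "s \<in> cauchy_seqs Z"
  shows "vscale (nspace_completion Z) a (compl_class Z s) = compl_class Z (\<lambda>n. vscale Z a (s n))"
proof -
  have "congruent (null_diff Z) (\<lambda>s. compl_class Z (\<lambda>n. vscale Z a (s n)))"
  proof (rule congruentI)
    fix s s' assume st: "(s, s') \<in> null_diff Z"
    note c = null_diffD[OF st]
    have "vnorm Z (vdiff Z (vscale Z a (s n)) (vscale Z a (s' n))) = \<bar>a\<bar> * vnorm Z (vdiff Z (s n) (s' n))" for n
      by (simp add: scale_diff[symmetric] norm_scale diff_closed c)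
    moreover have "(\<lambda>n. \<bar>a\<bar> * vnorm Z (vdiff Z (s n) (s' n))) \<longlonglongrightarrow> 0"
      by (intro tendsto_mult_right_zero c)
    ultimately show "compl_class Z (\<lambda>n. vscale Z a (s n)) = compl_class Z (\<lambda>n. vscale Z a (s' n))"
      by (intro cclass_eqI) (simp add: null_diff_def scale_in_cauchy_seqs c)
  qed
  then show ?thesis
    using UN_equiv_class[OF equiv_null_diff _ s]
    by (simp add: nspace_completion_def)
qed

lemma norm_dominated:
  "\<lbrakk>x \<in> vcarrier Z; y \<in> vcarrier Z\<rbrakk> \<Longrightarrow> \<bar>vnorm Z x - vnorm Z y\<bar> \<le> 1 * vnorm Z (vdiff Z x y)"
  by (simp add: abs_norm_diff_le)

lemma completion_norm:
  assumes s: "s \<in> cauchy_seqs Z"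
  shows "vnorm (nspace_completion Z) (compl_class Z s) = lim (\<lambda>n. vnorm Z (s n))"
proof -
  have "(\<lambda>s. lim (\<lambda>n. vnorm Z (s n))) ` compl_class Z s = {lim (\<lambda>n. vnorm Z (s n))}"
  proof (rule equalityI)
    have "lim (\<lambda>n. vnorm Z (t n)) = lim (\<lambda>n. vnorm Z (s n))" if "(s, t) \<in> null_diff Z" for t
      by (rule dominated_lim_eq[OF that norm_dominated, symmetric])
    then show "(\<lambda>s. lim (\<lambda>n. vnorm Z (s n))) ` compl_class Z s \<subseteq> {lim (\<lambda>n. vnorm Z (s n))}"
      by auto
    show "{lim (\<lambda>n. vnorm Z (s n))} \<subseteq> (\<lambda>s. lim (\<lambda>n. vnorm Z (s n))) ` compl_class Z s"
      using equiv_class_self[OF equiv_null_diff s] by blast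
  qed
  then show ?thesis
    by (simp add: nspace_completion_def)
qed

lemma completion_norm_LIMSEQ:
  assumes s: "s \<in> cauchy_seqs Z"
  shows "(\<lambda>n. vnorm Z (s n)) \<longlonglongrightarrow> vnorm (nspace_completion Z) (compl_class Z s)"
  using dominated_converges[OF s norm_dominated]
  by (simp add: completion_norm[OF s] convergent_LIMSEQ_iff)

lemma completion_diff:
  "\<lbrakk>s \<in> cauchy_seqs Z; t \<in> cauchy_seqs Z\<rbrakk>
    \<Longrightarrow> vdiff (nspace_completion Z) (compl_class Z s) (compl_class Z t) = compl_class Z (\<lambda>n. vdiff Z (s n) (t n))"
  by (simp add: vdiff_def completion_add completion_scale scale_in_cauchy_seqs)

lemma seminormed_completion: "seminormed_vspace (nspace_completion Z)"
proof -
  note intros = const_in_cauchy_seqs[OF zero_closed] add_in_cauchy_seqs scale_in_cauchy_seqs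
  show ?thesis
  proof
    fix x y assume "x \<in> vcarrier (nspace_completion Z)" "y \<in> vcarrier (nspace_completion Z)"
    then obtain s t where st: "s \<in> cauchy_seqs Z" "x = compl_class Z s" "t \<in> cauchy_seqs Z" "y = compl_class Z t"
      by (auto simp: completion_carrier)
    have "vnorm (nspace_completion Z) (compl_class Z (\<lambda>n. vadd Z (s n) (t n)))
        \<le> vnorm (nspace_completion Z) (compl_class Z s) + vnorm (nspace_completion Z) (compl_class Z t)"
      using st by (intro LIMSEQ_le[OF completion_norm_LIMSEQ tendsto_add[OF completion_norm_LIMSEQ completion_norm_LIMSEQ]])
        (auto intro!: intros norm_triangle cauchy_seqs_carrier)
    then show "vnorm (nspace_completion Z) (vadd (nspace_completion Z) x y)
        \<le> vnorm (nspace_completion Z) x + vnorm (nspace_completion Z) y"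
      using st by (simp add: completion_add)
  next
    fix x a assume "x \<in> vcarrier (nspace_completion Z)"
    then obtain s where s: "s \<in> cauchy_seqs Z" "x = compl_class Z s"
      by (auto simp: completion_carrier)
    have "vnorm (nspace_completion Z) (compl_class Z (\<lambda>n. vscale Z a (s n)))
        = \<bar>a\<bar> * vnorm (nspace_completion Z) (compl_class Z s)"
    proof (rule LIMSEQ_unique[OF completion_norm_LIMSEQ])
      show "(\<lambda>n. vnorm Z (vscale Z a (s n))) \<longlonglongrightarrow> \<bar>a\<bar> * vnorm (nspace_completion Z) (compl_class Z s)"
        using s by (simp add: norm_scale cauchy_seqs_carrier tendsto_mult_left completion_norm_LIMSEQ)
    qed (use s in \<open>simp add: intros\<close>)
    then show "vnorm (nspace_completion Z) (vscale (nspace_completion Z) a x)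
        = \<bar>a\<bar> * vnorm (nspace_completion Z) x"
      using s by (simp add: completion_scale)
  next
    fix x y assume "x \<in> vcarrier (nspace_completion Z)" "y \<in> vcarrier (nspace_completion Z)"
    then obtain s t where st: "s \<in> cauchy_seqs Z" "x = compl_class Z s" "t \<in> cauchy_seqs Z" "y = compl_class Z t"
      by (auto simp: completion_carrier)
    have "vadd Z (s n) (t n) = vadd Z (t n) (s n)" for n
      using st by (intro add_commute) (simp_all add: cauchy_seqs_carrier)
    then show "vadd (nspace_completion Z) x y = vadd (nspace_completion Z) y x"
      using st by (simp add: completion_add)
  qed (auto simp: completion_carrier completion_zero completion_add completion_scale intros
      cauchy_seqs_carrier add_assoc add_zero add_inverse scale_add_right
      scale_add_left scale_scale scale_one)
qed

lemma linear_op_completion: "linear_op Z (nspace_completion Z) (\<lambda>x. compl_class Z (\<lambda>_. x))"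
  by (auto simp: linear_op_def completion_carrier completion_add completion_scale const_in_cauchy_seqs)

lemma norm_completion_embedding:
  "x \<in> vcarrier Z \<Longrightarrow> vnorm (nspace_completion Z) (compl_class Z (\<lambda>_. x)) = vnorm Z x"
  by (simp add: completion_norm const_in_cauchy_seqs)

lemma completion_dense:
  assumes "x \<in> vcarrier (nspace_completion Z)" "\<eta> > 0"
  obtains z where "z \<in> vcarrier Z"
    "vnorm (nspace_completion Z) (vdiff (nspace_completion Z) x (compl_class Z (\<lambda>_. z))) \<le> \<eta>"
proof -
  obtain s where s: "s \<in> cauchy_seqs Z" "x = compl_class Z s"
    using assms by (auto simp: completion_carrier)
  obtain N where N: "\<And>m n. \<lbrakk>m \<ge> N; n \<ge> N\<rbrakk> \<Longrightarrow> vnorm Z (vdiff Z (s m) (s n)) < \<eta>"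
    using cauchy_seqsD[OF s(1) assms(2)] by metis
  have sN: "s N \<in> vcarrier Z" using s by (simp add: cauchy_seqs_carrier)
  then have c: "(\<lambda>_. s N) \<in> cauchy_seqs Z" by (rule const_in_cauchy_seqs)
  have d: "(\<lambda>n. vdiff Z (s n) (s N)) \<in> cauchy_seqs Z"
    using s(1) c by (simp add: vdiff_def add_in_cauchy_seqs scale_in_cauchy_seqs)
  have "vnorm (nspace_completion Z) (compl_class Z (\<lambda>n. vdiff Z (s n) (s N))) \<le> \<eta>"
    by (rule LIMSEQ_le_const2[OF completion_norm_LIMSEQ[OF d]])
       (use N in \<open>auto intro!: exI[of _ N] less_imp_le\<close>)
  then show thesis
    using that[OF sN] s c by (simp add: completion_diff)
qed

text \<open>
  The functional extends by continuity, and the splitting of the norm passes to the limit along a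
  Cauchy sequence.
\<close>

lemma L_line_completion:
  assumes "L_line Z f e"
  shows "\<exists>F. L_line (nspace_completion Z) F (compl_class Z (\<lambda>_. e))"
proof -
  let ?C = "nspace_completion Z"
  have Z: "seminormed_vspace Z" by unfold_locales
  have f: "f \<in> dual Z" and e: "e \<in> vcarrier Z" "vnorm Z e = 1" "f e = 1"
    and split: "\<And>x. x \<in> vcarrier Z \<Longrightarrow> vnorm Z x = \<bar>f x\<bar> + vnorm Z (vdiff Z x (vscale Z (f x) e))"
    using assms by (auto simp: L_line_def)
  have f_le: "\<bar>f x\<bar> \<le> vnorm Z x" if "x \<in> vcarrier Z" for x
    using split[OF that] norm_nonneg[of "vdiff Z x (vscale Z (f x) e)"] that e
    by (simp add: closed)
  have dom: "\<bar>f x - f y\<bar> \<le> 1 * vnorm Z (vdiff Z x y)" if "x \<in> vcarrier Z" "y \<in> vcarrier Z" for x y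
    using f_le[of "vdiff Z x y"] that dual_diff[OF Z f] by (simp add: diff_closed)
  \<comment> \<open>by \<open>dominated_lim_eq\<close> the limit is the same for every representative\<close>
  define F where "F A = lim (\<lambda>n. f ((SOME s. s \<in> A) n))" for A
  have F: "(\<lambda>n. f (s n)) \<longlonglongrightarrow> F (compl_class Z s)" if s: "s \<in> cauchy_seqs Z" for s
  proof -
    have "(SOME t. t \<in> compl_class Z s) \<in> compl_class Z s"
      by (rule someI[of "\<lambda>t. t \<in> compl_class Z s", OF equiv_class_self[OF equiv_null_diff s]])
    then have "F (compl_class Z s) = lim (\<lambda>n. f (s n))"
      using dominated_lim_eq[OF _ dom] by (simp add: F_def)
    then show ?thesis
      using dominated_converges[OF s dom] by (simp add: convergent_LIMSEQ_iff)
  qed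
  have FI: "F (compl_class Z s) = l" if "s \<in> cauchy_seqs Z" "(\<lambda>n. f (s n)) \<longlonglongrightarrow> l" for s l
    using LIMSEQ_unique[OF F[OF that(1)] that(2)] .
  have "L_line ?C F (compl_class Z (\<lambda>_. e))"
    unfolding L_line_def
  proof (intro conjI ballI)
    show "F \<in> dual ?C"
    proof (rule dualI[where K = 1])
      fix x y assume "x \<in> vcarrier ?C" "y \<in> vcarrier ?C"
      then obtain s t where st: "s \<in> cauchy_seqs Z" "x = compl_class Z s" "t \<in> cauchy_seqs Z" "y = compl_class Z t"
        by (auto simp: completion_carrier)
      have "F (compl_class Z (\<lambda>n. vadd Z (s n) (t n))) = F x + F y"
        using st tendsto_add[OF F F] by (intro FI add_in_cauchy_seqs) (auto simp: dual_add[OF f] cauchy_seqs_carrier)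
      then show "F (vadd ?C x y) = F x + F y"
        using st by (simp add: completion_add)
    next
      fix a x assume "x \<in> vcarrier ?C"
      then obtain s where s: "s \<in> cauchy_seqs Z" "x = compl_class Z s"
        by (auto simp: completion_carrier)
      have "F (compl_class Z (\<lambda>n. vscale Z a (s n))) = a * F x"
        using s tendsto_mult_left[OF F] by (intro FI scale_in_cauchy_seqs) (auto simp: dual_scale[OF f] cauchy_seqs_carrier)
      then show "F (vscale ?C a x) = a * F x"
        using s by (simp add: completion_scale)
    next
      fix x assume "x \<in> vcarrier ?C"
      then obtain s where s: "s \<in> cauchy_seqs Z" "x = compl_class Z s"
        by (auto simp: completion_carrier)
      have "\<bar>F x\<bar> \<le> vnorm ?C x"
        unfolding s(2) using s
        by (intro LIMSEQ_le[OF tendsto_rabs[OF F] completion_norm_LIMSEQ]) (auto simp: f_le cauchy_seqs_carrier)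
      then show "\<bar>F x\<bar> \<le> 1 * vnorm ?C x" by simp
    qed
    have ec: "(\<lambda>_. e) \<in> cauchy_seqs Z" using e(1) by (rule const_in_cauchy_seqs)
    then show "compl_class Z (\<lambda>_. e) \<in> vcarrier ?C" by (simp add: completion_carrier)
    show "vnorm ?C (compl_class Z (\<lambda>_. e)) = 1" using e by (simp add: norm_completion_embedding)
    show "F (compl_class Z (\<lambda>_. e)) = 1" using e ec by (intro FI) auto
    fix x assume "x \<in> vcarrier ?C"
    then obtain s where s: "s \<in> cauchy_seqs Z" "x = compl_class Z s"
      by (auto simp: completion_carrier)
    have sc: "s n \<in> vcarrier Z" for n using s by (simp add: cauchy_seqs_carrier)
    define r where "r = (\<lambda>n. vdiff Z (s n) (vscale Z (F x) e))"
    have r: "r \<in> cauchy_seqs Z" "vdiff ?C x (vscale ?C (F x) (compl_class Z (\<lambda>_. e))) = compl_class Z r"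
      using s ec const_in_cauchy_seqs[OF scale_closed[OF e(1)], of "F x"]
      by (simp_all add: r_def completion_scale completion_diff)
         (simp add: vdiff_def add_in_cauchy_seqs scale_in_cauchy_seqs[of "\<lambda>_. _"])
    \<comment> \<open>the coefficient \<open>f (s n)\<close> of the \<open>n\<close>-th splitting may be replaced by its limit\<close>
    have "\<bar>vnorm Z (vdiff Z (s n) (vscale Z (f (s n)) e)) - vnorm Z (r n)\<bar> \<le> \<bar>f (s n) - F x\<bar>" for n
    proof -
      have "vdiff Z (vdiff Z (s n) (vscale Z (f (s n)) e)) (r n) = vscale Z (F x - f (s n)) e"
        using sc e scale_add_left[of e "F x" "- f (s n)"] unfolding r_def
        by (simp add: add_diff_add diff_self scale_diff[symmetric] add_zero closed
            vdiff_def[of _ "s n"]) (simp add: vdiff_def scale_add_right scale_scale closed add_commute add_inverse add_zero)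
      then have "vnorm Z (vdiff Z (vdiff Z (s n) (vscale Z (f (s n)) e)) (r n)) = \<bar>f (s n) - F x\<bar>"
        using e by (simp add: norm_scale abs_minus_commute)
      then show ?thesis
        using abs_norm_diff_le[of "vdiff Z (s n) (vscale Z (f (s n)) e)" "r n"] sc e
        by (simp add: r_def closed)
    qed
    then have "\<forall>\<^sub>F n in sequentially. norm (vnorm Z (vdiff Z (s n) (vscale Z (f (s n)) e)) - vnorm Z (r n))
        \<le> \<bar>f (s n) - F x\<bar>" by simp
    moreover have "(\<lambda>n. \<bar>f (s n) - F x\<bar>) \<longlonglongrightarrow> 0"
      using F[OF s(1)] s(2) by (simp add: LIM_zero tendsto_rabs_zero)
    ultimately have "(\<lambda>n. vnorm Z (vdiff Z (s n) (vscale Z (f (s n)) e)) - vnorm Z (r n)) \<longlonglongrightarrow> 0"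
      by (rule Lim_null_comparison)
    then have "(\<lambda>n. \<bar>f (s n)\<bar> + (vnorm Z (vdiff Z (s n) (vscale Z (f (s n)) e)) - vnorm Z (r n)) + vnorm Z (r n))
        \<longlonglongrightarrow> \<bar>F x\<bar> + 0 + vnorm ?C (compl_class Z r)"
      using F[OF s(1)] s(2) completion_norm_LIMSEQ[OF r(1)] by (intro tendsto_add tendsto_rabs) auto
    then have "(\<lambda>n. vnorm Z (s n)) \<longlonglongrightarrow> \<bar>F x\<bar> + vnorm ?C (compl_class Z r)"
      using split[OF sc] by simp
    then show "vnorm ?C x = \<bar>F x\<bar> + vnorm ?C (vdiff ?C x (vscale ?C (F x) (compl_class Z (\<lambda>_. e))))"
      using LIMSEQ_unique[OF completion_norm_LIMSEQ[OF s(1)]] s(2) r(2) by simp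
  qed
  then show ?thesis by blast
qed

end


section \<open>Atomless measures\<close>

text \<open>
  A set that is not an atom splits into two parts of positive measure, one of which has at most
  half of the measure. This can be repeated.
\<close>

lemma fraction_exists:
  assumes na: "\<not> (\<exists>A. atom M A)" and F: "F \<in> fmeasurable M" "measure M F > 0" and "\<epsilon> > 0"
  obtains B where "B \<in> sets M" "B \<subseteq> F" "0 < measure M B" "measure M B < \<epsilon>"
proof -
  have "\<exists>B\<in>sets M. B \<subseteq> F \<and> 0 < measure M B \<and> measure M B \<le> measure M F / 2 ^ n" for n
  proof (induction n)
    case 0
    then show ?case using F by (intro bexI[of _ F]) (auto simp: fmeasurableD)
  next
    case (Suc n)
    then obtain B where B: "B \<in> sets M" "B \<subseteq> F" "0 < measure M B" "measure M B \<le> measure M F / 2 ^ n"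
      by blast
    have Bf: "B \<in> fmeasurable M" using B F fmeasurableI2 by blast
    have "0 < emeasure M B"
      using B(3) by (simp add: measure_def zero_less_iff_neq_zero) (metis enn2real_0 less_irrefl)
    then obtain C where C: "C \<in> sets M" "C \<subseteq> B" "emeasure M C \<noteq> 0" "emeasure M (B - C) \<noteq> 0"
      using na B(1) unfolding atom_def by blast
    have Cf: "C \<in> fmeasurable M" "B - C \<in> fmeasurable M"
      using fmeasurableI2[OF Bf C(2,1)] fmeasurableI2[OF Bf, of "B - C"] B C by auto
    have pos: "0 < measure M C" "0 < measure M (B - C)"
      using C(3,4) Cf by (simp_all add: emeasure_eq_measure2 zero_less_measure_iff)
    have "measure M (B - C) = measure M B - measure M C"
      using Bf C by (simp add: measurable_measure_Diff)
    then have "measure M C \<le> measure M F / 2 ^ n / 2 \<or> measure M (B - C) \<le> measure M F / 2 ^ n / 2"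
      using B(4) by (cases "measure M C \<le> measure M F / 2 ^ n / 2") auto
    then have "measure M C \<le> measure M F / 2 ^ Suc n \<or> measure M (B - C) \<le> measure M F / 2 ^ Suc n"
      by (simp add: mult.commute)
    then show ?case
    proof
      assume "measure M C \<le> measure M F / 2 ^ Suc n"
      then show ?thesis using C B pos by (intro bexI[of _ C]) auto
    next
      assume "measure M (B - C) \<le> measure M F / 2 ^ Suc n"
      then show ?thesis using C B pos by (intro bexI[of _ "B - C"]) auto
    qed
  qed
  then obtain B where B: "\<And>n. B n \<in> sets M \<and> B n \<subseteq> F \<and> 0 < measure M (B n) \<and> measure M (B n) \<le> measure M F / 2 ^ n"
    by metis
  obtain n where "(1 / 2) ^ n < \<epsilon> / measure M F"
    using real_arch_pow_inv[of "\<epsilon> / measure M F" "1 / 2"] F \<open>\<epsilon> > 0\<close> by auto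
  then have "measure M F / 2 ^ n < \<epsilon>"
    using F by (simp add: field_simps)
  then show thesis
    using B[of n] that[of "B n"] by linarith
qed

text \<open>
  Sierpinski's theorem. A subset is enlarged greedily, each time by at least half of what can still
  be gained without exceeding \<open>t\<close>. If the union \<open>L\<close> stayed below \<open>t\<close>, then some set of small
  positive measure could be added to \<open>L\<close>, and greediness would make every step gain at least
  half of this measure; but the gains tend to 0.
\<close>

lemma atomless_intermediate_value:
  assumes na: "\<not> (\<exists>A. atom M A)" and F: "F \<in> fmeasurable M" and t: "0 \<le> t" "t \<le> measure M F"
  obtains A where "A \<in> sets M" "A \<subseteq> F" "measure M A = t"
proof -
  define P where "P A \<longleftrightarrow> A \<in> sets M \<and> A \<subseteq> F \<and> measure M A \<le> t" for A
  have Pf: "A \<in> fmeasurable M" if "P A" for A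
    using that F by (auto simp: P_def intro: fmeasurableI2)
  have step: "\<exists>B. P B \<and> A \<subseteq> B \<and>
      (\<forall>C. P C \<and> A \<subseteq> C \<longrightarrow> measure M C - measure M A \<le> 2 * (measure M B - measure M A))"
    if A: "P A" for A
  proof -
    define S where "S = measure M ` {C. P C \<and> A \<subseteq> C}"
    have bdd: "bdd_above S" by (auto simp: S_def P_def)
    have AS: "measure M A \<in> S" using A by (auto simp: S_def)
    then have le: "measure M A \<le> Sup S" using bdd by (rule cSup_upper)
    have up: "measure M C \<le> Sup S" if "P C" "A \<subseteq> C" for C
      using that by (intro cSup_upper bdd) (auto simp: S_def)
    show ?thesis
    proof (cases "measure M A = Sup S")
      case True
      then show ?thesis using A up by (intro exI[of _ A]) auto
    next
      case False
      then have "(Sup S + measure M A) / 2 < Sup S" using le by simp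
      then obtain s where "s \<in> S" "(Sup S + measure M A) / 2 < s"
        using less_cSup_iff[of S] bdd AS by blast
      then obtain B where B: "P B" "A \<subseteq> B" "(Sup S + measure M A) / 2 < measure M B"
        by (auto simp: S_def)
      have "measure M C - measure M A \<le> 2 * (measure M B - measure M A)" if "P C" "A \<subseteq> C" for C
        using up[OF that] B(3) by simp
      then show ?thesis using B by blast
    qed
  qed
  have "\<exists>A. \<forall>n. P (A n) \<and> (A n \<subseteq> A (Suc n) \<and> (\<forall>C. P C \<and> A n \<subseteq> C \<longrightarrow>
      measure M C - measure M (A n) \<le> 2 * (measure M (A (Suc n)) - measure M (A n))))"
  proof (rule dependent_nat_choice)
    show "\<exists>A. P A" using t by (intro exI[of _ "{}"]) (auto simp: P_def)
  qed (use step in blast)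
  then obtain A where A: "\<And>n. P (A n)" "\<And>n. A n \<subseteq> A (Suc n)"
    and greedy: "\<And>n C. \<lbrakk>P C; A n \<subseteq> C\<rbrakk> \<Longrightarrow>
      measure M C - measure M (A n) \<le> 2 * (measure M (A (Suc n)) - measure M (A n))"
    by blast
  define L where "L = (\<Union>n. A n)"
  have L: "L \<in> sets M" "L \<subseteq> F" using A(1) by (auto simp: L_def P_def)
  have Lf: "L \<in> fmeasurable M" using L F fmeasurableI2 by blast
  have lim: "(\<lambda>n. measure M (A n)) \<longlonglongrightarrow> measure M L"
    unfolding L_def
  proof (rule Lim_measure_incseq)
    show "range A \<subseteq> sets M" using A(1) by (auto simp: P_def)
    show "incseq A" using A(2) by (rule incseq_SucI)
    show "emeasure M (\<Union>i. A i) \<noteq> \<infinity>" using fmeasurableD2[OF Lf] by (simp add: L_def)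
  qed
  have L_le: "measure M L \<le> t"
    using LIMSEQ_le_const2[OF lim] A(1) by (auto simp: P_def)
  have "measure M L = t"
  proof (rule ccontr)
    assume "measure M L \<noteq> t"
    then have less: "measure M L < t" using L_le by simp
    have FL: "F - L \<in> fmeasurable M" using F L by (intro fmeasurable.Diff Lf)
    have "measure M (F - L) > 0"
      using less t measurable_measure_Diff[OF F L] by simp
    then obtain B where B: "B \<in> sets M" "B \<subseteq> F - L" "0 < measure M B" "measure M B < t - measure M L"
      using fraction_exists[OF na FL, of "t - measure M L"] less by auto
    have Bf: "B \<in> fmeasurable M" using B FL fmeasurableI2 by blast
    have un: "measure M (L \<union> B) = measure M L + measure M B"
      using B Lf Bf by (intro measure_Un_AE) auto
    have "P (L \<union> B)" using B L un by (auto simp: P_def)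
    then have "measure M (L \<union> B) - measure M (A n) \<le> 2 * (measure M (A (Suc n)) - measure M (A n))" for n
      by (intro greedy) (auto simp: L_def)
    moreover have "(\<lambda>n. measure M (L \<union> B) - measure M (A n)) \<longlonglongrightarrow> measure M (L \<union> B) - measure M L"
      by (intro tendsto_intros lim)
    moreover have "(\<lambda>n. 2 * (measure M (A (Suc n)) - measure M (A n))) \<longlonglongrightarrow> 2 * (measure M L - measure M L)"
      by (intro tendsto_intros lim LIMSEQ_Suc)
    ultimately have "measure M (L \<union> B) - measure M L \<le> 2 * (measure M L - measure M L)"
      by (intro LIMSEQ_le) auto
    then show False using un B(3) by simp
  qed
  then show thesis using that L by blast
qed

section \<open>Slicing a set function dominated by the measure\<close>

text \<open>
  The set function \<open>q + K \<mu>\<close> is a measure on \<open>E\<close> with a density \<open>g\<close>. On the set where \<open>g\<close> lies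
  between \<open>k \<delta>\<close> and \<open>(k + 1) \<delta>\<close> it differs from \<open>k \<delta> \<mu>\<close> by at most \<open>\<delta> \<mu>\<close>. The density is
  essentially bounded by \<open>2 K\<close>, so finitely many values of \<open>k\<close> suffice.
\<close>

lemma dominated_slices:
  fixes q :: "'a set \<Rightarrow> real"
  assumes "sigma_finite_measure M" and E: "E \<in> fmeasurable M"
    and add: "\<And>A B. \<lbrakk>A \<in> sets M; B \<in> sets M; A \<subseteq> E; B \<subseteq> E; A \<inter> B = {}\<rbrakk> \<Longrightarrow> q (A \<union> B) = q A + q B"
    and dom: "\<And>A. \<lbrakk>A \<in> sets M; A \<subseteq> E\<rbrakk> \<Longrightarrow> \<bar>q A\<bar> \<le> K * measure M A"
    and \<delta>: "\<delta> > 0"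
  obtains h :: "'a \<Rightarrow> nat" where "h \<in> measurable M (count_space UNIV)" "finite (range h)"
    "\<And>k. \<exists>c. \<forall>A\<in>sets M. A \<subseteq> E \<inter> h -` {k} \<longrightarrow> \<bar>q A - c * measure M A\<bar> \<le> \<delta> * measure M A"
proof -
  interpret sigma_finite_measure M by fact
  have E_sets [measurable]: "E \<in> sets M" using E by (rule fmeasurableD)
  have em: "emeasure M A = ennreal (measure M A)" if "A \<in> sets M" "A \<subseteq> E" for A
    using fmeasurableI2[OF E that(2,1)] by (simp add: emeasure_eq_measure2)
  have fin: "A \<in> fmeasurable M" if "A \<in> sets M" "A \<subseteq> E" for A
    using that E fmeasurableI2 by blast
  define p where "p A = q A + K * measure M A" for A
  have p: "0 \<le> p A" "p A \<le> 2 * K * measure M A" if "A \<in> sets M" "A \<subseteq> E" for A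
    using dom[OF that] by (auto simp: p_def)
  have p_add: "p (A \<union> B) = p A + p B"
    if "A \<in> sets M" "B \<in> sets M" "A \<subseteq> E" "B \<subseteq> E" "A \<inter> B = {}" for A B
  proof -
    have "measure M (A \<union> B) = measure M A + measure M B"
      using that by (intro measure_Un_AE fin) auto
    then show ?thesis using add[OF that] by (simp add: p_def algebra_simps)
  qed
  define N where "N = measure_of (space M) (sets M) (\<lambda>A. ennreal (p (A \<inter> E)))"
  have sets_N [simp]: "sets N = sets M" by (simp add: N_def)
  have N: "emeasure N A = ennreal (p (A \<inter> E))" if "A \<in> sets M" for A
    unfolding N_def
  proof (rule emeasure_measure_of_sigma)
    show "sigma_algebra (space M) (sets M)" by (rule sets.sigma_algebra_axioms)
    have p0: "p {} = 0" using p[of "{}"] by simp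
    then show pos: "positive (sets M) (\<lambda>A. ennreal (p (A \<inter> E)))"
      by (simp add: positive_def)
    show "countably_additive (sets M) (\<lambda>A. ennreal (p (A \<inter> E)))"
    proof (rule sets.empty_continuous_imp_countably_additive[OF pos])
      show "additive (sets M) (\<lambda>A. ennreal (p (A \<inter> E)))"
        unfolding additive_def
      proof (intro ballI impI)
        fix A B assume AB: "A \<in> sets M" "B \<in> sets M" "A \<inter> B = {}"
        have "p ((A \<union> B) \<inter> E) = p (A \<inter> E) + p (B \<inter> E)"
          using AB p_add[of "A \<inter> E" "B \<inter> E"] by (auto simp: Int_Un_distrib2)
        then show "ennreal (p ((A \<union> B) \<inter> E)) = ennreal (p (A \<inter> E)) + ennreal (p (B \<inter> E))"
          using p[of "A \<inter> E"] p[of "B \<inter> E"] AB by (simp add: ennreal_plus)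
      qed
      show "\<forall>A\<in>sets M. ennreal (p (A \<inter> E)) \<noteq> \<infinity>" by simp
      fix A assume A: "range A \<subseteq> sets M" "decseq A" "(\<Inter>i. A i) = {}"
      have "(\<lambda>i. measure M (A i \<inter> E)) \<longlonglongrightarrow> measure M (\<Inter>i. A i \<inter> E)"
      proof (rule Lim_measure_decseq)
        show "range (\<lambda>i. A i \<inter> E) \<subseteq> sets M" using A(1) by auto
        show "decseq (\<lambda>i. A i \<inter> E)" using A(2) by (auto simp: decseq_def)
        show "emeasure M (A i \<inter> E) \<noteq> \<infinity>" for i
          using fmeasurableD2[OF fin[of "A i \<inter> E"]] A(1) by auto
      qed
      moreover have "(\<Inter>i. A i \<inter> E) = {}" using A(3) by blast
      ultimately have "(\<lambda>i. measure M (A i \<inter> E)) \<longlonglongrightarrow> 0" by simp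
      then have "(\<lambda>i. 2 * K * measure M (A i \<inter> E)) \<longlonglongrightarrow> 0"
        by (rule tendsto_mult_right_zero)
      then have "(\<lambda>i. p (A i \<inter> E)) \<longlonglongrightarrow> 0"
      proof (rule Lim_null_comparison[rotated])
        show "\<forall>\<^sub>F i in sequentially. norm (p (A i \<inter> E)) \<le> 2 * K * measure M (A i \<inter> E)"
        proof (intro always_eventually allI)
          fix i
          have "A i \<inter> E \<in> sets M" using A(1) by auto
          then show "norm (p (A i \<inter> E)) \<le> 2 * K * measure M (A i \<inter> E)"
            using p[of "A i \<inter> E"] by simp
        qed
      qed
      then show "(\<lambda>i. ennreal (p (A i \<inter> E))) \<longlonglongrightarrow> 0"
        using tendsto_ennrealI by fastforce
    qed
  qed fact
  have "absolutely_continuous M N"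
    unfolding absolutely_continuous_def
  proof
    fix A assume A: "A \<in> null_sets M"
    then have As: "A \<in> sets M" by auto
    have "A \<inter> E \<in> null_sets M" using A by (intro null_set_Int2) auto
    then have "measure M (A \<inter> E) = 0" by (simp add: measure_eq_0_null_sets)
    then have "p (A \<inter> E) = 0" using p[of "A \<inter> E"] As by simp
    then show "A \<in> null_sets N" using As by (simp add: null_sets_def N)
  qed
  then obtain g where g [measurable]: "g \<in> borel_measurable M" and gN: "density M g = N"
    using Radon_Nikodym sets_N by blast
  have int_g: "(\<integral>\<^sup>+x. g x * indicator A x \<partial>M) = ennreal (p A)" if "A \<in> sets M" "A \<subseteq> E" for A
    using that N[of A] emeasure_density[OF g that(1)] by (simp add: gN Int_absorb2)
  obtain n :: nat where n: "2 * K < real n * \<delta>"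
    using reals_Archimedean3[OF \<delta>] by blast
  \<comment> \<open>all points with \<open>g x \<ge> n \<delta>\<close> are collected in the last slice, which is a null set\<close>
  define h where "h x = nat \<lfloor>enn2real (min (g x) (ennreal (real n * \<delta>))) / \<delta>\<rfloor>" for x
  have trunc: "ennreal (enn2real (min (g x) (ennreal (real n * \<delta>)))) = min (g x) (ennreal (real n * \<delta>))" for x
    by (simp add: min_less_iff_disj)
  have trunc_le: "0 \<le> enn2real (min (g x) (ennreal (real n * \<delta>)))"
      "enn2real (min (g x) (ennreal (real n * \<delta>))) \<le> real n * \<delta>" for x
    using \<delta> by (auto intro!: enn2real_leI)
  have h_le: "h x \<le> n" for x
  proof -
    have "enn2real (min (g x) (ennreal (real n * \<delta>))) / \<delta> \<le> real n"
      using trunc_le(2)[of x] \<delta> by (simp add: field_simps)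
    then show ?thesis unfolding h_def by linarith
  qed
  have h_bounds: "real (h x) * \<delta> \<le> enn2real (min (g x) (ennreal (real n * \<delta>)))"
      "enn2real (min (g x) (ennreal (real n * \<delta>))) < (real (h x) + 1) * \<delta>" for x
  proof -
    let ?r = "enn2real (min (g x) (ennreal (real n * \<delta>))) / \<delta>"
    have "0 \<le> ?r" using trunc_le(1)[of x] \<delta> by simp
    then have "real (h x) \<le> ?r" "?r < real (h x) + 1"
      unfolding h_def by linarith+
    then show "real (h x) * \<delta> \<le> enn2real (min (g x) (ennreal (real n * \<delta>)))"
      "enn2real (min (g x) (ennreal (real n * \<delta>))) < (real (h x) + 1) * \<delta>"
      using \<delta> by (simp_all add: field_simps)
  qed
  have lower: "ennreal (real (h x) * \<delta>) \<le> g x" for x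
    using ennreal_leI[OF h_bounds(1)[of x]] by (simp add: trunc)
  have upper: "g x \<le> ennreal ((real (h x) + 1) * \<delta>)" if "h x < n" for x
  proof -
    have "ennreal ((real (h x) + 1) * \<delta>) \<le> ennreal (real n * \<delta>)"
      using that \<delta> by (intro ennreal_leI mult_right_mono) auto
    moreover have "min (g x) (ennreal (real n * \<delta>)) < ennreal ((real (h x) + 1) * \<delta>)"
      using ennreal_lessI[OF le_less_trans[OF trunc_le(1) h_bounds(2)] h_bounds(2), of x]
      unfolding trunc .
    ultimately show ?thesis by (auto simp: min_def split: if_splits)
  qed
  have slice: "\<exists>c. \<forall>A\<in>sets M. A \<subseteq> E \<inter> h -` {k} \<longrightarrow> \<bar>q A - c * measure M A\<bar> \<le> \<delta> * measure M A" for k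
  proof -
    have low: "real k * \<delta> * measure M A \<le> p A" if A: "A \<in> sets M" "A \<subseteq> E \<inter> h -` {k}" for A
    proof -
      have [measurable]: "A \<in> sets M" by fact
      have "ennreal (real k * \<delta> * measure M A) = (\<integral>\<^sup>+x. ennreal (real k * \<delta>) * indicator A x \<partial>M)"
        using A em[of A] \<delta> by (simp add: nn_integral_cmult_indicator ennreal_mult)
      also have "\<dots> \<le> (\<integral>\<^sup>+x. g x * indicator A x \<partial>M)"
      proof (rule nn_integral_mono)
        fix x
        show "ennreal (real k * \<delta>) * indicator A x \<le> g x * indicator A x"
          using A(2) lower[of x] by (cases "x \<in> A") auto
      qed
      also have "\<dots> = ennreal (p A)" using A by (intro int_g) auto
      finally show ?thesis using p(1)[of A] A by (simp add: ennreal_le_iff)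
    qed
    have up: "p A \<le> (real k + 1) * \<delta> * measure M A"
      if A: "A \<in> sets M" "A \<subseteq> E \<inter> h -` {k}" and "k < n" for A
    proof -
      have [measurable]: "A \<in> sets M" by fact
      have "ennreal (p A) = (\<integral>\<^sup>+x. g x * indicator A x \<partial>M)"
        using A by (intro int_g[symmetric]) auto
      also have "\<dots> \<le> (\<integral>\<^sup>+x. ennreal ((real k + 1) * \<delta>) * indicator A x \<partial>M)"
      proof (rule nn_integral_mono)
        fix x
        show "g x * indicator A x \<le> ennreal ((real k + 1) * \<delta>) * indicator A x"
          using A(2) upper[of x] \<open>k < n\<close> by (cases "x \<in> A") auto
      qed
      also have "\<dots> = ennreal ((real k + 1) * \<delta> * measure M A)"
        using A em[of A] \<delta> by (simp add: nn_integral_cmult_indicator ennreal_mult)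
      finally show ?thesis using \<delta> by (simp add: ennreal_le_iff)
    qed
    consider "k < n" | "k = n" | "k > n" by linarith
    then show ?thesis
    proof cases
      case 1
      have "\<bar>q A - (real k * \<delta> - K) * measure M A\<bar> \<le> \<delta> * measure M A"
        if "A \<in> sets M" "A \<subseteq> E \<inter> h -` {k}" for A
        using low[OF that] up[OF that 1] by (auto simp: p_def algebra_simps)
      then show ?thesis by blast
    next
      case 2
      have "\<bar>q A - 0 * measure M A\<bar> \<le> \<delta> * measure M A" if A: "A \<in> sets M" "A \<subseteq> E \<inter> h -` {k}" for A
      proof -
        have "real n * \<delta> * measure M A \<le> 2 * K * measure M A"
          using order_trans[OF low[OF A] p(2)] A 2 by simp
        then have "measure M A = 0"
          using n mult_strict_right_mono[OF n, of "measure M A"] measure_nonneg[of M A]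
          by (cases "measure M A = 0") auto
        then show ?thesis using dom[of A] A by auto
      qed
      then show ?thesis by blast
    next
      case 3
      then have "E \<inter> h -` {k} = {}" using h_le by (auto dest: leD)
      then show ?thesis using dom[of "{}"] by auto
    qed
  qed
  have "h \<in> measurable M (count_space UNIV)"
    unfolding h_def by measurable
  moreover have "finite (range h)"
    by (rule finite_subset[of _ "{..n}"]) (auto simp: h_le)
  ultimately show thesis using that slice by blast
qed


section \<open>The space \<open>L\<^sub>1\<close>\<close>

abbreviation L1_class :: "'a measure \<Rightarrow> ('a \<Rightarrow> real) \<Rightarrow> ('a \<Rightarrow> real) set" where
  "L1_class M f \<equiv> ae_eq M `` {f}"

lemma equiv_ae_eq: "equiv (Collect (integrable M)) (ae_eq M)"
proof (rule equivI)
  show "ae_eq M \<subseteq> Collect (integrable M) \<times> Collect (integrable M)"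
    by (auto simp: ae_eq_def)
  show "refl_on (Collect (integrable M)) (ae_eq M)"
    by (rule refl_onI) (auto simp: ae_eq_def)
  show "sym (ae_eq M)"
    by (rule symI) (auto simp: ae_eq_def)
  show "trans (ae_eq M)"
    by (rule transI) (auto simp: ae_eq_def elim: eventually_elim2)
qed

lemma L1_class_eqI:
  "\<lbrakk>integrable M f; integrable M g; AE x in M. f x = g x\<rbrakk> \<Longrightarrow> L1_class M f = L1_class M g"
  by (rule equiv_class_eq[OF equiv_ae_eq]) (simp add: ae_eq_def)

lemma L1_class_eq_iff:
  "\<lbrakk>integrable M f; integrable M g\<rbrakk> \<Longrightarrow> L1_class M f = L1_class M g \<longleftrightarrow> (AE x in M. f x = g x)"
  using eq_equiv_class_iff[OF equiv_ae_eq, of f M g] by (simp add: ae_eq_def)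

lemma L1_carrier: "vcarrier (L1 M) = L1_class M ` Collect (integrable M)"
  by (auto simp: L1_def quotient_def)

lemma L1_class_closed: "integrable M f \<Longrightarrow> L1_class M f \<in> vcarrier (L1 M)"
  by (auto simp: L1_carrier)

lemma L1_zero: "vzero (L1 M) = L1_class M (\<lambda>_. 0)"
  by (simp add: L1_def)

lemma L1_add:
  assumes f: "integrable M f" and g: "integrable M g"
  shows "vadd (L1 M) (L1_class M f) (L1_class M g) = L1_class M (\<lambda>x. f x + g x)"
proof -
  have "congruent2 (ae_eq M) (ae_eq M) (\<lambda>f g. L1_class M (\<lambda>x. f x + g x))"
    by (rule congruent2I', rule L1_class_eqI) (auto simp: ae_eq_def)
  then show ?thesis
    using UN_equiv_class2[OF equiv_ae_eq equiv_ae_eq, of _ _ _ f g] f g by (simp add: L1_def)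
qed

lemma L1_scale:
  assumes f: "integrable M f"
  shows "vscale (L1 M) a (L1_class M f) = L1_class M (\<lambda>x. a * f x)"
proof -
  have "congruent (ae_eq M) (\<lambda>f. L1_class M (\<lambda>x. a * f x))"
    by (rule congruentI, rule L1_class_eqI) (auto simp: ae_eq_def)
  then show ?thesis
    using UN_equiv_class[OF equiv_ae_eq, of _ _ f] f by (simp add: L1_def)
qed

text \<open>
  Numbers attached to a class, such as its norm, are encoded as the only element of an image of the
  class; they can be read off from any representative.
\<close>

lemma the_elem_L1_class:
  assumes "integrable M f" and cong: "\<And>g. \<lbrakk>integrable M g; AE x in M. f x = g x\<rbrakk> \<Longrightarrow> F f = F g"
  shows "the_elem (F ` L1_class M f) = F f"
proof -
  have "F g = F f" if "g \<in> L1_class M f" for g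
    using that cong[of g] by (simp add: ae_eq_def)
  moreover have "f \<in> L1_class M f"
    using assms(1) by (simp add: ae_eq_def)
  ultimately have "F ` L1_class M f = {F f}"
    by blast
  then show ?thesis by simp
qed

lemma L1_norm:
  assumes f: "integrable M f"
  shows "vnorm (L1 M) (L1_class M f) = (\<integral>x. \<bar>f x\<bar> \<partial>M)"
  using f by (auto simp: L1_def intro!: the_elem_L1_class integral_cong_AE)

lemma L1_diff:
  assumes f: "integrable M f" and g: "integrable M g"
  shows "vdiff (L1 M) (L1_class M f) (L1_class M g) = L1_class M (\<lambda>x. f x - g x)"
  using f g by (simp add: vdiff_def L1_add L1_scale)

lemma normed_L1: "normed_vspace (L1 M)"
proof
  fix x assume "x \<in> vcarrier (L1 M)"
  then obtain f where f: "integrable M f" "x = L1_class M f" by (auto simp: L1_carrier)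
  have "vnorm (L1 M) x = 0 \<longleftrightarrow> (AE x in M. \<bar>f x\<bar> = 0)"
    using f by (simp add: L1_norm integral_nonneg_eq_0_iff_AE)
  then show "vnorm (L1 M) x = 0 \<longleftrightarrow> x = vzero (L1 M)"
    using f by (simp add: L1_zero L1_class_eq_iff)
next
  fix x y assume "x \<in> vcarrier (L1 M)" "y \<in> vcarrier (L1 M)"
  then obtain f g where fg: "integrable M f" "x = L1_class M f" "integrable M g" "y = L1_class M g"
    by (auto simp: L1_carrier)
  have "(\<integral>x. \<bar>f x + g x\<bar> \<partial>M) \<le> (\<integral>x. \<bar>f x\<bar> + \<bar>g x\<bar> \<partial>M)"
    using fg by (intro integral_mono) auto
  then show "vnorm (L1 M) (vadd (L1 M) x y) \<le> vnorm (L1 M) x + vnorm (L1 M) y"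
    using fg by (simp add: L1_add L1_norm)
qed (auto simp: L1_carrier L1_zero L1_add L1_scale L1_norm algebra_simps abs_mult)

lemma seminormed_L1: "seminormed_vspace (L1 M)"
proof -
  interpret normed_vspace "L1 M" by (rule normed_L1)
  show ?thesis by unfold_locales
qed

text \<open>
  The functional \<open>f \<mapsto> \<integral> f g\<close>, as a function of the class of \<open>f\<close>.
\<close>

definition L1_pairing :: "'a measure \<Rightarrow> ('a \<Rightarrow> real) \<Rightarrow> ('a \<Rightarrow> real) set \<Rightarrow> real" where
  "L1_pairing M g A = the_elem ((\<lambda>f. \<integral>x. f x * g x \<partial>M) ` A)"

lemma integrable_mult_bounded:
  fixes f g :: "'a \<Rightarrow> real"
  assumes "integrable M f" "g \<in> borel_measurable M" "\<And>x. \<bar>g x\<bar> \<le> K"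
  shows "integrable M (\<lambda>x. f x * g x)"
proof (rule Bochner_Integration.integrable_bound)
  show "integrable M (\<lambda>x. K * f x)" using assms(1) by simp
  show "(\<lambda>x. f x * g x) \<in> borel_measurable M" using assms by simp
  have "\<bar>f x\<bar> * \<bar>g x\<bar> \<le> \<bar>K\<bar> * \<bar>f x\<bar>" for x
    using assms(3)[of x] mult_left_mono[of "\<bar>g x\<bar>" "\<bar>K\<bar>" "\<bar>f x\<bar>"] by (simp add: mult.commute)
  then show "AE x in M. norm (f x * g x) \<le> norm (K * f x)"
    by (simp add: abs_mult)
qed

lemma L1_pairing_class:
  assumes "integrable M f" "g \<in> borel_measurable M"
  shows "L1_pairing M g (L1_class M f) = (\<integral>x. f x * g x \<partial>M)"
  unfolding L1_pairing_def using assms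
  by (auto intro!: the_elem_L1_class[where F = "\<lambda>f. \<integral>x. f x * g x \<partial>M"] integral_cong_AE)

lemma L1_pairing_bound:
  assumes "integrable M f" "g \<in> borel_measurable M" "\<And>x. \<bar>g x\<bar> \<le> 1"
  shows "\<bar>L1_pairing M g (L1_class M f)\<bar> \<le> vnorm (L1 M) (L1_class M f)"
proof -
  have "\<bar>\<integral>x. f x * g x \<partial>M\<bar> \<le> (\<integral>x. \<bar>f x * g x\<bar> \<partial>M)"
    by (rule integral_abs_bound)
  also have "\<dots> \<le> (\<integral>x. \<bar>f x\<bar> \<partial>M)"
    using assms mult_left_mono[OF assms(3), of "\<bar>f _\<bar>"]
    by (intro integral_mono integrable_abs integrable_mult_bounded[of _ _ _ 1]) (auto simp: abs_mult)
  finally show ?thesis using assms by (simp add: L1_pairing_class L1_norm)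
qed

lemma L1_pairing_dual:
  assumes g: "g \<in> borel_measurable M" "\<And>x. \<bar>g x\<bar> \<le> 1"
  shows "L1_pairing M g \<in> dual (L1 M)"
proof (rule dualI[where K = 1])
  note int = integrable_mult_bounded[OF _ g]
  fix x y assume "x \<in> vcarrier (L1 M)" "y \<in> vcarrier (L1 M)"
  then show "L1_pairing M g (vadd (L1 M) x y) = L1_pairing M g x + L1_pairing M g y"
    using g by (auto simp: L1_carrier L1_add L1_pairing_class distrib_right int)
next
  fix a x assume "x \<in> vcarrier (L1 M)"
  then show "L1_pairing M g (vscale (L1 M) a x) = a * L1_pairing M g x"
    using g by (auto simp: L1_carrier L1_scale L1_pairing_class mult.assoc)
next
  fix x assume "x \<in> vcarrier (L1 M)"
  then show "\<bar>L1_pairing M g x\<bar> \<le> 1 * vnorm (L1 M) x"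
    using L1_pairing_bound g by (auto simp: L1_carrier)
qed

text \<open>
  Integration against the sign of \<open>f\<close> attains the norm of \<open>f\<close>. At the zero vector every functional
  of norm 1 will do, for instance the one that belongs to a unit vector.
\<close>

lemma L1_norming_functional:
  assumes "nontrivial (L1 M)" "x \<in> vcarrier (L1 M)"
  obtains \<phi> where "\<phi> \<in> dual_sphere (L1 M)" "\<phi> x = vnorm (L1 M) x"
proof -
  interpret normed_vspace "L1 M" by (rule normed_L1)
  note S = seminormed_L1[of M]
  obtain f where f: "integrable M f" "x = L1_class M f" using assms by (auto simp: L1_carrier)
  have main: "\<exists>\<phi>\<in>dual_sphere (L1 M). \<phi> (L1_class M f) = vnorm (L1 M) (L1_class M f)"
    if f: "integrable M f" "vnorm (L1 M) (L1_class M f) \<noteq> 0" for f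
  proof -
    define g where "g x = sgn (f x)" for x
    have g: "g \<in> borel_measurable M" "\<And>x. \<bar>g x\<bar> \<le> 1"
      using f(1) unfolding g_def by (auto simp: sgn_if intro!: borel_measurable_sgn)
    have eq: "L1_pairing M g (L1_class M f) = vnorm (L1 M) (L1_class M f)"
      using f(1) g by (simp add: L1_pairing_class L1_norm) (simp add: g_def abs_sgn)
    let ?r = "inverse (vnorm (L1 M) (L1_class M f))"
    have c: "L1_class M f \<in> vcarrier (L1 M)" using f by (simp add: L1_class_closed)
    have "L1_pairing M g \<in> dual_sphere (L1 M)"
    proof (rule dual_sphereI[OF S L1_pairing_dual[OF g], where e = "vscale (L1 M) ?r (L1_class M f)"])
      show "\<bar>L1_pairing M g x\<bar> \<le> vnorm (L1 M) x" if "x \<in> vcarrier (L1 M)" for x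
        using that L1_pairing_bound g by (auto simp: L1_carrier)
      show "vscale (L1 M) ?r (L1_class M f) \<in> vcarrier (L1 M)"
        using c by (rule scale_closed)
      show "vnorm (L1 M) (vscale (L1 M) ?r (L1_class M f)) = 1"
        using c f(2) norm_nonneg[OF c] by (simp add: norm_scale)
      show "\<bar>L1_pairing M g (vscale (L1 M) ?r (L1_class M f))\<bar> = 1"
        using c f(2) dual_scale[OF L1_pairing_dual[OF g] c] by (simp add: eq)
    qed
    then show ?thesis using eq by blast
  qed
  show thesis
  proof (cases "vnorm (L1 M) x = 0")
    case False
    then show ?thesis using main f that by blast
  next
    case True
    then have x: "x = vzero (L1 M)" using assms norm_eq_zero by blast
    obtain e where "e \<in> vcarrier (L1 M)" "vnorm (L1 M) e = 1"
      by (rule unit_vector_exists[OF normed_L1 assms(1)])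
    then obtain f' where "integrable M f'" "vnorm (L1 M) (L1_class M f') = 1"
      by (auto simp: L1_carrier)
    then obtain \<phi> where "\<phi> \<in> dual_sphere (L1 M)" using main[of f'] by auto
    then show ?thesis
      using that[of \<phi>] dual_zero[OF S dual_sphere_subset] True x by simp
  qed
qed

section \<open>Atoms are one-dimensional L-summands\<close>

text \<open>
  Some set of finite measure meets the atom in a set of positive measure, and then contains the atom
  up to a null set.
\<close>

lemma atom_fmeasurable:
  assumes "sigma_finite_measure M" "atom M A"
  shows "A \<in> fmeasurable M"
proof -
  interpret sigma_finite_measure M by fact
  have A: "A \<in> sets M" "emeasure M A > 0"
      and split: "\<And>B. \<lbrakk>B \<in> sets M; B \<subseteq> A\<rbrakk> \<Longrightarrow> emeasure M B = 0 \<or> emeasure M (A - B) = 0"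
    using assms(2) by (auto simp: atom_def)
  obtain S :: "nat \<Rightarrow> 'a set" where S: "range S \<subseteq> sets M" "(\<Union>i. S i) = space M" "\<And>i. emeasure M (S i) \<noteq> \<infinity>"
    using sigma_finite by blast
  have "\<exists>i. emeasure M (A \<inter> S i) \<noteq> 0"
  proof (rule ccontr)
    assume "\<not> ?thesis"
    then have "emeasure M (\<Union>i. A \<inter> S i) = 0"
      using A S by (intro emeasure_UN_eq_0) auto
    moreover have "(\<Union>i. A \<inter> S i) = A"
      using S(2) sets.sets_into_space[OF A(1)] by auto
    ultimately show False using A by simp
  qed
  then obtain i where i: "emeasure M (A \<inter> S i) \<noteq> 0" by blast
  have AS: "A \<inter> S i \<in> sets M" using A S by auto
  then have "emeasure M (A - A \<inter> S i) = 0" using split[of "A \<inter> S i"] i by auto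
  then have "emeasure M A = emeasure M (A \<inter> S i)"
    using emeasure_Un_null_set[of "A \<inter> S i" M "A - A \<inter> S i"] A AS
    by (simp add: null_sets_def Un_Diff_Int Int_absorb2 Int_Diff_Un)
  also have "\<dots> \<le> emeasure M (S i)"
    using S AS by (intro emeasure_mono) auto
  also have "\<dots> < \<infinity>" using S(3)[of i] by (simp add: less_top)
  finally show ?thesis using A by (simp add: fmeasurable_def)
qed

text \<open>
  An integrable function does not change its sign on an atom, because the part of the atom where it
  is positive is either null or everything.
\<close>

lemma atom_integral_abs:
  fixes f :: "'a \<Rightarrow> real"
  assumes A: "atom M A" and f: "integrable M f"
  shows "(\<integral>x. \<bar>f x\<bar> * indicator A x \<partial>M) = \<bar>\<integral>x. f x * indicator A x \<partial>M\<bar>"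
proof -
  have [measurable]: "A \<in> sets M" "f \<in> borel_measurable M" using A f by (auto simp: atom_def)
  have A_sp: "A \<subseteq> space M" by (simp add: sets.sets_into_space)
  define B where "B = {x \<in> A. f x > 0}"
  have [measurable]: "B \<in> sets M"
  proof -
    have "B = A \<inter> {x \<in> space M. f x > 0}" using A_sp by (auto simp: B_def)
    then show ?thesis by simp
  qed
  have "emeasure M B = 0 \<or> emeasure M (A - B) = 0"
    using A by (auto simp: atom_def B_def)
  then show ?thesis
  proof
    assume "emeasure M B = 0"
    then have "AE x in M. x \<notin> B" by (intro AE_not_in) (simp add: null_sets_def)
    then have "(\<integral>x. \<bar>f x\<bar> * indicator A x \<partial>M) = (\<integral>x. - (f x * indicator A x) \<partial>M)"
      by (intro integral_cong_AE) (auto simp: B_def indicator_def elim!: eventually_mono)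
    moreover have "(\<integral>x. \<bar>f x\<bar> * indicator A x \<partial>M) \<ge> 0" by simp
    ultimately show ?thesis by simp
  next
    assume "emeasure M (A - B) = 0"
    then have "AE x in M. x \<notin> A - B" by (intro AE_not_in) (simp add: null_sets_def)
    then have "(\<integral>x. \<bar>f x\<bar> * indicator A x \<partial>M) = (\<integral>x. f x * indicator A x \<partial>M)"
      by (intro integral_cong_AE) (auto simp: B_def indicator_def elim!: eventually_mono)
    moreover have "(\<integral>x. \<bar>f x\<bar> * indicator A x \<partial>M) \<ge> 0" by simp
    ultimately show ?thesis by simp
  qed
qed

text \<open>
  Subtracting its mean over \<open>A\<close> from an integrable function makes the integral over \<open>A\<close>
  vanish; by \<open>atom_integral_abs\<close> the difference then vanishes on \<open>A\<close>. So a function is the sum of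
  a multiple of the indicator of \<open>A\<close> and of a function that lives off \<open>A\<close>.
\<close>

lemma L_line_if_atom:
  assumes sf: "sigma_finite_measure M" and A: "atom M A"
  shows "\<exists>\<phi> e. L_line (L1 M) \<phi> e"
proof -
  have Af: "A \<in> fmeasurable M" using sf A by (rule atom_fmeasurable)
  then have [measurable]: "A \<in> sets M" by (rule fmeasurableD)
  define a where "a = measure M A"
  have a: "a > 0"
    using A Af by (simp add: a_def atom_def emeasure_eq_measure2)
  have int1: "integrable M (indicator A :: 'a \<Rightarrow> real)"
    using Af by (simp add: fmeasurable_def)
  define e where "e x = indicator A x / a" for x :: 'a
  have e: "integrable M e" unfolding e_def using int1 by simp
  let ?\<phi> = "L1_pairing M (indicator A)"
  have int: "integrable M (\<lambda>x. f x * indicator A x)" if "integrable M f" for f :: "'a \<Rightarrow> real"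
    using integrable_mult_bounded[of M f "indicator A" 1] that by (simp add: indicator_def)
  have \<phi>: "?\<phi> (L1_class M f) = (\<integral>x. f x * indicator A x \<partial>M)" if "integrable M f" for f
    using that by (simp add: L1_pairing_class)
  have "L_line (L1 M) ?\<phi> (L1_class M e)"
    unfolding L_line_def
  proof (intro conjI ballI)
    show "?\<phi> \<in> dual (L1 M)"
      by (rule L1_pairing_dual) (auto simp: indicator_def)
    show "L1_class M e \<in> vcarrier (L1 M)" using e by (rule L1_class_closed)
    have "(\<integral>x. \<bar>e x\<bar> \<partial>M) = (\<integral>x. indicator A x / a \<partial>M)"
      using a by (simp add: e_def)
    then show "vnorm (L1 M) (L1_class M e) = 1"
      using e a by (simp add: L1_norm a_def sets.Int_space_eq2)
    have "(\<integral>x. e x * indicator A x \<partial>M) = (\<integral>x. indicator A x / a \<partial>M)"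
      by (intro Bochner_Integration.integral_cong) (auto simp: e_def indicator_def)
    then show "?\<phi> (L1_class M e) = 1"
      using e a by (simp add: \<phi> a_def sets.Int_space_eq2)
    fix x assume "x \<in> vcarrier (L1 M)"
    then obtain f where f: "integrable M f" "x = L1_class M f" by (auto simp: L1_carrier)
    define t where "t = (\<integral>x. f x * indicator A x \<partial>M)"
    have g: "integrable M (\<lambda>x. f x - t * e x)" using f e by simp
    \<comment> \<open>\<open>f - t e\<close> has mean zero on the atom, and therefore vanishes there\<close>
    have "(\<integral>x. (f x - t * e x) * indicator A x \<partial>M)
        = (\<integral>x. f x * indicator A x \<partial>M) - (\<integral>x. t * (indicator A x / a) \<partial>M)"
    proof (subst Bochner_Integration.integral_diff[symmetric])
      show "integrable M (\<lambda>x. f x * indicator A x)" by (rule int[OF f(1)])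
      show "integrable M (\<lambda>x. t * (indicator A x / a))" using int1 by simp
    qed (auto simp: e_def indicator_def intro!: Bochner_Integration.integral_cong)
    also have "\<dots> = 0"
      using a by (simp add: t_def[symmetric] a_def sets.Int_space_eq2)
    finally have on_A: "(\<integral>x. \<bar>f x - t * e x\<bar> * indicator A x \<partial>M) = 0"
      using atom_integral_abs[OF A g] by simp
    have off_A: "integrable M (\<lambda>x. \<bar>f x\<bar> * indicator (- A) x)"
    proof -
      have "integrable M (\<lambda>x. \<bar>f x\<bar> - \<bar>f x\<bar> * indicator A x)"
        using f int[of "\<lambda>x. \<bar>f x\<bar>"] by simp
      then show ?thesis
        by (rule Bochner_Integration.integrable_cong[THEN iffD1, rotated -1]) (auto simp: indicator_def)
    qed
    have split: "(\<integral>x. \<bar>h x\<bar> \<partial>M) = (\<integral>x. \<bar>h x\<bar> * indicator A x \<partial>M) + (\<integral>x. \<bar>f x\<bar> * indicator (- A) x \<partial>M)"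
      if "integrable M h" "\<And>x. x \<notin> A \<Longrightarrow> h x = f x" for h
    proof (subst Bochner_Integration.integral_add[symmetric])
      show "integrable M (\<lambda>x. \<bar>h x\<bar> * indicator A x)" using int[of "\<lambda>x. \<bar>h x\<bar>"] that(1) by simp
    qed (use that off_A in \<open>auto simp: indicator_def intro!: Bochner_Integration.integral_cong\<close>)
    have "(\<integral>x. \<bar>f x\<bar> \<partial>M) = \<bar>t\<bar> + (\<integral>x. \<bar>f x - t * e x\<bar> \<partial>M)"
      using split[OF f(1)] split[OF g] on_A atom_integral_abs[OF A f(1)]
      by (simp add: t_def e_def)
    moreover have "vscale (L1 M) (?\<phi> x) (L1_class M e) = L1_class M (\<lambda>x. t * e x)"
      using f e by (simp add: \<phi> t_def L1_scale)
    ultimately show "vnorm (L1 M) x = \<bar>?\<phi> x\<bar> + vnorm (L1 M) (vdiff (L1 M) x (vscale (L1 M) (?\<phi> x) (L1_class M e)))"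
      using f e g by (simp add: L1_diff L1_norm \<phi> t_def)
  qed
  then show ?thesis by blast
qed


section \<open>Step functions\<close>

lemma multiplier_exists:
  assumes "c \<ge> 0" "\<eta> > 0"
  obtains N :: nat where "N > 0" "2 / N * c \<le> (\<eta>::real)"
proof -
  obtain N :: nat where N: "2 * c / \<eta> < N" using reals_Archimedean2 by blast
  have "0 \<le> 2 * c / \<eta>" using assms by simp
  then have pos: "real N > 0" using N by linarith
  have "2 * c \<le> N * \<eta>" using N assms(2) by (simp add: pos_divide_less_eq)
  then show thesis using pos that[of N] by (simp add: pos_divide_le_eq mult.commute)
qed

lemma divide_plus_one_mult_le: "\<lbrakk>S \<ge> 0; \<eta> > 0\<rbrakk> \<Longrightarrow> \<eta> / (S + 1) * S \<le> (\<eta>::real)"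
  by (simp add: field_simps)

definition step :: "(nat \<Rightarrow> 'a set) \<Rightarrow> nat \<Rightarrow> (nat \<Rightarrow> real) \<Rightarrow> 'a \<Rightarrow> real" where
  "step P m b x = (\<Sum>k<m. b k * indicator (P k) x)"

definition cells :: "'a measure \<Rightarrow> (nat \<Rightarrow> 'a set) \<Rightarrow> nat \<Rightarrow> bool" where
  "cells M P m \<longleftrightarrow> disjoint_family_on P {..<m} \<and> (\<forall>k<m. P k \<in> fmeasurable M)"

lemma step_in:
  assumes "disjoint_family_on P {..<m}" "x \<in> P j" "j < m"
  shows "step P m b x = b j"
proof -
  have "b k * indicator (P k) x = (if k = j then b j else 0)" if "k \<in> {..<m}" for k
    using assms that by (auto simp: disjoint_family_on_def indicator_def)
  then have "step P m b x = (\<Sum>k<m. if k = j then b j else 0)"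
    unfolding step_def by (intro sum.cong) auto
  then show ?thesis using assms(3) by simp
qed

lemma step_out: "(\<And>k. k < m \<Longrightarrow> x \<notin> P k) \<Longrightarrow> step P m b x = 0"
  by (simp add: step_def)

lemma step_apply:
  assumes "disjoint_family_on P {..<m}" "F 0 = (0::real)"
  shows "F (step P m b x) = step P m (\<lambda>k. F (b k)) x"
proof (cases "\<exists>j<m. x \<in> P j")
  case True
  then show ?thesis using step_in[OF assms(1)] by metis
next
  case False
  then show ?thesis using assms(2) by (simp add: step_out)
qed

lemma step_indicator: "indicator A x * step P m b x = step (\<lambda>k. A \<inter> P k) m b x"
  unfolding step_def sum_distrib_left by (rule sum.cong) (auto simp: indicator_def)

lemma step_sum:
  "(\<Sum>i<n. a i * step P m (b i) x) = step P m (\<lambda>k. \<Sum>i<n. a i * b i k) x"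
proof -
  have "(\<Sum>i<n. a i * step P m (b i) x) = (\<Sum>i<n. \<Sum>k<m. a i * b i k * indicator (P k) x)"
    unfolding step_def sum_distrib_left mult.assoc ..
  also have "\<dots> = (\<Sum>k<m. \<Sum>i<n. a i * b i k * indicator (P k) x)"
    by (rule sum.swap)
  finally show ?thesis unfolding step_def sum_distrib_right .
qed

lemma cells_Int: "cells M P m \<Longrightarrow> A \<in> sets M \<Longrightarrow> cells M (\<lambda>k. A \<inter> P k) m"
  by (auto simp: cells_def disjoint_family_on_def Int_commute[of A] intro: fmeasurable_Int_fmeasurable)

lemma indicator_integrable: "A \<in> fmeasurable M \<Longrightarrow> integrable M (indicator A :: 'a \<Rightarrow> real)"
  by (simp add: fmeasurable_def)

lemma integral_indicator_measure:
  "A \<in> fmeasurable M \<Longrightarrow> (\<integral>x. indicator A x \<partial>M) = measure M A"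
  by (simp add: fmeasurableD sets.Int_space_eq2)

lemma step_integrable: "cells M P m \<Longrightarrow> integrable M (step P m b)"
  unfolding step_def cells_def by (intro Bochner_Integration.integrable_sum) (auto simp: indicator_integrable)

lemma integral_step: "cells M P m \<Longrightarrow> (\<integral>x. step P m b x \<partial>M) = (\<Sum>k<m. b k * measure M (P k))"
  unfolding step_def
  by (subst Bochner_Integration.integral_sum)
     (auto simp: cells_def indicator_integrable integral_indicator_measure fmeasurableD sets.Int_space_eq2)

lemma integral_abs_step:
  assumes "cells M P m"
  shows "(\<integral>x. \<bar>step P m b x\<bar> \<partial>M) = (\<Sum>k<m. \<bar>b k\<bar> * measure M (P k))"
proof -
  have "\<bar>step P m b x\<bar> = step P m (\<lambda>k. \<bar>b k\<bar>) x" for x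
    using assms step_apply[of P m abs] by (simp add: cells_def)
  then show ?thesis using integral_step[OF assms] by simp
qed

lemma dual_L1_sum:
  assumes "\<phi> \<in> dual (L1 M)" "finite I" "\<And>i. i \<in> I \<Longrightarrow> integrable M (f i)"
  shows "\<phi> (L1_class M (\<lambda>x. \<Sum>i\<in>I. c i * f i x)) = (\<Sum>i\<in>I. c i * \<phi> (L1_class M (f i)))"
  using assms(2,3)
proof (induction I)
  case empty
  then show ?case
    using dual_zero[OF seminormed_L1 assms(1)] by (simp add: L1_zero)
next
  case (insert j I)
  then have int: "integrable M (\<lambda>x. c j * f j x)" "integrable M (\<lambda>x. \<Sum>i\<in>I. c i * f i x)"
    "integrable M (f j)" by auto
  have "L1_class M (\<lambda>x. \<Sum>i\<in>insert j I. c i * f i x)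
      = vadd (L1 M) (vscale (L1 M) (c j) (L1_class M (f j))) (L1_class M (\<lambda>x. \<Sum>i\<in>I. c i * f i x))"
    using insert int by (simp add: L1_add L1_scale)
  moreover have "vscale (L1 M) (c j) (L1_class M (f j)) \<in> vcarrier (L1 M)"
    using int by (simp add: L1_scale L1_class_closed)
  ultimately show ?case
    using insert int by (simp add: dual_add[OF assms(1)] dual_scale[OF assms(1)] L1_class_closed)
qed

lemma dual_step:
  assumes "\<phi> \<in> dual (L1 M)" "cells M P m"
  shows "\<phi> (L1_class M (step P m b)) = (\<Sum>k<m. b k * \<phi> (L1_class M (indicator (P k))))"
  using dual_L1_sum[OF assms(1), of "{..<m}" "\<lambda>k. indicator (P k)" b] assms(2)
  by (simp add: step_def[abs_def] cells_def indicator_integrable)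

section \<open>Thin sets that look uniformly distributed to finitely many functionals\<close>

lemma dual_indicator_UN:
  assumes "\<phi> \<in> dual (L1 M)" "finite I" "disjoint_family_on A I" "\<And>i. i \<in> I \<Longrightarrow> A i \<in> fmeasurable M"
  shows "\<phi> (L1_class M (indicator (\<Union>i\<in>I. A i))) = (\<Sum>i\<in>I. \<phi> (L1_class M (indicator (A i))))"
proof -
  have "(indicator (\<Union>i\<in>I. A i) :: 'a \<Rightarrow> real) = (\<lambda>x. \<Sum>i\<in>I. 1 * indicator (A i) x)"
    using indicator_UN_disjoint[OF assms(2,3)] by (auto simp: fun_eq_iff)
  then show ?thesis
    using dual_L1_sum[OF assms(1,2), of "\<lambda>i. indicator (A i)" "\<lambda>_. 1"] assms(4)
    by (simp add: indicator_integrable)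
qed

text \<open>
  Induction on the set of functionals: two slicings are combined by pairing their index functions.
\<close>

lemma joint_slices:
  assumes sf: "sigma_finite_measure M" and E: "E \<in> fmeasurable M"
    and \<Phi>: "finite \<Phi>" "\<Phi> \<subseteq> dual (L1 M)" and \<delta>: "\<delta> > 0"
  shows "\<exists>h :: 'a \<Rightarrow> nat. h \<in> measurable M (count_space UNIV) \<and> finite (range h) \<and>
    (\<forall>k. \<forall>\<phi>\<in>\<Phi>. \<exists>c. \<forall>A\<in>sets M. A \<subseteq> E \<inter> h -` {k} \<longrightarrow>
        \<bar>\<phi> (L1_class M (indicator A)) - c * measure M A\<bar> \<le> \<delta> * measure M A)"
  using \<Phi>
proof (induction \<Phi>)
  case empty
  show ?case by (intro exI[of _ "\<lambda>_. 0"]) auto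
next
  case (insert \<phi> \<Phi>)
  then obtain h :: "'a \<Rightarrow> nat" where h: "h \<in> measurable M (count_space UNIV)" "finite (range h)"
    and h_slice: "\<And>k \<psi>. \<psi> \<in> \<Phi> \<Longrightarrow> \<exists>c. \<forall>A\<in>sets M. A \<subseteq> E \<inter> h -` {k} \<longrightarrow>
        \<bar>\<psi> (L1_class M (indicator A)) - c * measure M A\<bar> \<le> \<delta> * measure M A"
    by auto
  have \<phi>: "\<phi> \<in> dual (L1 M)" using insert by simp
  obtain K where K: "\<And>x. x \<in> vcarrier (L1 M) \<Longrightarrow> \<bar>\<phi> x\<bar> \<le> K * vnorm (L1 M) x"
    using dual_bounded[OF seminormed_L1 \<phi>] by blast
  obtain g :: "'a \<Rightarrow> nat" where g: "g \<in> measurable M (count_space UNIV)" "finite (range g)"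
    and g_slice: "\<And>k. \<exists>c. \<forall>A\<in>sets M. A \<subseteq> E \<inter> g -` {k} \<longrightarrow>
        \<bar>\<phi> (L1_class M (indicator A)) - c * measure M A\<bar> \<le> \<delta> * measure M A"
  proof (rule dominated_slices[OF sf E _ _ \<delta>, of "\<lambda>A. \<phi> (L1_class M (indicator A))" K])
    fix A B assume AB: "A \<in> sets M" "B \<in> sets M" "A \<subseteq> E" "B \<subseteq> E" "A \<inter> B = {}"
    then have f: "A \<in> fmeasurable M" "B \<in> fmeasurable M" using E fmeasurableI2 by blast+
    have "L1_class M (indicator (A \<union> B)) = vadd (L1 M) (L1_class M (indicator A)) (L1_class M (indicator B))"
      using f indicator_add[OF AB(5), where ?'b = real] by (simp add: L1_add indicator_integrable)
    then show "\<phi> (L1_class M (indicator (A \<union> B))) = \<phi> (L1_class M (indicator A)) + \<phi> (L1_class M (indicator B))"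
      using f by (simp add: dual_add[OF \<phi>] L1_class_closed indicator_integrable)
  next
    fix A assume A: "A \<in> sets M" "A \<subseteq> E"
    then have f: "A \<in> fmeasurable M" using E fmeasurableI2 by blast
    then show "\<bar>\<phi> (L1_class M (indicator A))\<bar> \<le> K * measure M A"
      using K[of "L1_class M (indicator A)"]
      by (simp add: L1_class_closed indicator_integrable L1_norm integral_indicator_measure)
  qed blast
  define f where "f x = prod_encode (h x, g x)" for x
  have "f \<in> measurable M (count_space UNIV)"
  proof -
    have "f -` {k} \<inter> space M \<in> sets M" for k
    proof -
      have "f -` {k} \<inter> space M = (h -` {fst (prod_decode k)} \<inter> space M) \<inter> (g -` {snd (prod_decode k)} \<inter> space M)"
        by (auto simp: f_def)
      then show ?thesis
        using measurable_sets[OF h(1)] measurable_sets[OF g(1)] by simp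
    qed
    then show ?thesis
      by (simp add: measurable_count_space_eq2_countable)
  qed
  moreover have "finite (range f)"
  proof -
    have "range f \<subseteq> prod_encode ` (range h \<times> range g)" by (auto simp: f_def)
    then show ?thesis using h(2) g(2) by (meson finite_SigmaI finite_imageI finite_subset)
  qed
  moreover have "\<exists>c. \<forall>A\<in>sets M. A \<subseteq> E \<inter> f -` {k} \<longrightarrow>
      \<bar>\<psi> (L1_class M (indicator A)) - c * measure M A\<bar> \<le> \<delta> * measure M A" if "\<psi> \<in> insert \<phi> \<Phi>" for \<psi> k
  proof -
    have sub: "E \<inter> f -` {k} \<subseteq> E \<inter> h -` {fst (prod_decode k)}" "E \<inter> f -` {k} \<subseteq> E \<inter> g -` {snd (prod_decode k)}"
      by (auto simp: f_def)
    show ?thesis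
    proof (cases "\<psi> = \<phi>")
      case True
      obtain c where "\<forall>A\<in>sets M. A \<subseteq> E \<inter> g -` {snd (prod_decode k)} \<longrightarrow>
          \<bar>\<phi> (L1_class M (indicator A)) - c * measure M A\<bar> \<le> \<delta> * measure M A"
        by (rule exE[OF g_slice])
      then show ?thesis using sub(2) True by (intro exI[of _ c]) (meson order_trans)
    next
      case False
      then have "\<psi> \<in> \<Phi>" using that by simp
      from h_slice[OF this] obtain c where "\<forall>A\<in>sets M. A \<subseteq> E \<inter> h -` {fst (prod_decode k)} \<longrightarrow>
          \<bar>\<psi> (L1_class M (indicator A)) - c * measure M A\<bar> \<le> \<delta> * measure M A"
        by (rule exE)
      then show ?thesis using sub(1) by (intro exI[of _ c]) (meson order_trans)
    qed
  qed
  ultimately show ?case by blast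
qed

text \<open>
  On a slice every \<open>\<phi>\<close> is nearly proportional to \<open>\<mu>\<close>, so a part that has the fraction \<open>1/N\<close> of the
  measure of the slice also has nearly the fraction \<open>1/N\<close> of its \<open>\<phi>\<close>-value. Such a part is
  taken from each slice.
\<close>

lemma fair_fraction:
  assumes sf: "sigma_finite_measure M" and na: "\<not> (\<exists>A. atom M A)" and E: "E \<in> fmeasurable M"
    and \<Phi>: "finite \<Phi>" "\<Phi> \<subseteq> dual (L1 M)" and \<delta>: "\<delta> > 0" and N: "N > (0::nat)"
  obtains A where "A \<in> sets M" "A \<subseteq> E" "measure M A = measure M E / N"
    "\<And>\<phi>. \<phi> \<in> \<Phi> \<Longrightarrow> \<bar>real N * \<phi> (L1_class M (indicator A)) - \<phi> (L1_class M (indicator E))\<bar> \<le> \<delta>"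
proof -
  \<comment> \<open>the error \<open>\<theta>\<close> is made twice: for the fraction of a slice and for the slice itself\<close>
  define \<theta> where "\<theta> = \<delta> / (2 * (measure M E + 1))"
  have \<theta>: "\<theta> > 0" "2 * \<theta> * measure M E \<le> \<delta>"
    using \<delta> by (auto simp: \<theta>_def field_simps add_pos_nonneg)
  obtain h :: "'a \<Rightarrow> nat" where h [measurable]: "h \<in> measurable M (count_space UNIV)" and fin: "finite (range h)"
    and slice: "\<And>k \<phi>. \<phi> \<in> \<Phi> \<Longrightarrow> \<exists>c. \<forall>A\<in>sets M. A \<subseteq> E \<inter> h -` {k} \<longrightarrow>
        \<bar>\<phi> (L1_class M (indicator A)) - c * measure M A\<bar> \<le> \<theta> * measure M A"
    using joint_slices[OF sf E \<Phi> \<theta>(1)] by blast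
  define Q where "Q k = E \<inter> h -` {k}" for k
  have Q: "Q k \<in> fmeasurable M" for k
  proof (rule fmeasurableI2[OF E])
    have "Q k = E \<inter> (h -` {k} \<inter> space M)"
      using sets.sets_into_space[OF fmeasurableD[OF E]] by (auto simp: Q_def)
    then show "Q k \<in> sets M"
      using measurable_sets[OF h, of "{k}"] fmeasurableD[OF E] by auto
  qed (auto simp: Q_def)
  have "\<exists>A. A \<in> sets M \<and> A \<subseteq> Q k \<and> measure M A = measure M (Q k) / N" for k
  proof -
    have "measure M (Q k) \<le> real N * measure M (Q k)"
      using N mult_right_mono[of 1 "real N" "measure M (Q k)"] by simp
    then have "measure M (Q k) / N \<le> measure M (Q k)" using N by (simp add: field_simps)
    then show ?thesis
      using atomless_intermediate_value[OF na Q, of "measure M (Q k) / N" k] by (metis measure_nonneg of_nat_0_le_iff zero_le_divide_iff)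
  qed
  then obtain A where A: "\<And>k. A k \<in> sets M" "\<And>k. A k \<subseteq> Q k" "\<And>k. measure M (A k) = measure M (Q k) / N"
    by metis
  have Af: "A k \<in> fmeasurable M" for k using fmeasurableI2[OF Q A(2,1)] .
  have disjQ: "disjoint_family_on Q (range h)" by (auto simp: disjoint_family_on_def Q_def)
  have disjA: "disjoint_family_on A (range h)"
    using disjQ A(2) by (fastforce simp: disjoint_family_on_def)
  have EQ: "E = (\<Union>k\<in>range h. Q k)" by (auto simp: Q_def)
  have muE: "measure M E = (\<Sum>k\<in>range h. measure M (Q k))"
    unfolding EQ using fin disjQ Q by (intro measure_finite_Union) (auto simp: fmeasurableD2)
  show thesis
  proof
    let ?A = "\<Union>k\<in>range h. A k"
    show "?A \<in> sets M" using A fin by (intro sets.finite_UN) auto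
    show "?A \<subseteq> E" using A(2) by (fastforce simp: Q_def)
    have "measure M ?A = (\<Sum>k\<in>range h. measure M (A k))"
      using fin disjA Af by (intro measure_finite_Union) (auto simp: fmeasurableD2)
    then show "measure M ?A = measure M E / N"
      by (simp add: A(3) muE sum_divide_distrib)
    fix \<phi> assume \<phi>: "\<phi> \<in> \<Phi>"
    let ?p = "\<lambda>B. \<phi> (L1_class M (indicator B))"
    have each: "\<bar>N * ?p (A k) - ?p (Q k)\<bar> \<le> 2 * \<theta> * measure M (Q k)" for k
    proof -
      obtain c where c: "\<And>B. \<lbrakk>B \<in> sets M; B \<subseteq> Q k\<rbrakk> \<Longrightarrow> \<bar>?p B - c * measure M B\<bar> \<le> \<theta> * measure M B"
        using slice[OF \<phi>, of k] by (auto simp: Q_def)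
      have "\<bar>N * (?p (A k) - c * measure M (A k))\<bar> \<le> N * (\<theta> * measure M (A k))"
        using c[OF A(1,2)] by (simp add: abs_mult mult_left_mono)
      then have "\<bar>N * ?p (A k) - c * measure M (Q k)\<bar> \<le> \<theta> * measure M (Q k)"
        using N by (simp add: A(3) right_diff_distrib)
      moreover have "\<bar>?p (Q k) - c * measure M (Q k)\<bar> \<le> \<theta> * measure M (Q k)"
        using c[OF fmeasurableD[OF Q] order_refl] .
      ultimately show ?thesis by linarith
    qed
    have "N * ?p ?A - ?p E = (\<Sum>k\<in>range h. N * ?p (A k) - ?p (Q k))"
      using dual_indicator_UN[of \<phi> M "range h" A] dual_indicator_UN[of \<phi> M "range h" Q]
        \<phi> \<Phi>(2) fin disjA disjQ Af Q unfolding EQ[symmetric]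
      by (simp add: sum_subtractf sum_distrib_left subset_iff)
    also have "\<bar>\<dots>\<bar> \<le> (\<Sum>k\<in>range h. 2 * \<theta> * measure M (Q k))"
      by (rule order_trans[OF sum_abs sum_mono]) (rule each)
    also have "\<dots> \<le> \<delta>"
      using \<theta>(2) by (simp add: muE sum_distrib_left)
    finally show "\<bar>N * ?p ?A - ?p E\<bar> \<le> \<delta>" .
  qed
qed

lemma thin_set_exists:
  assumes sf: "sigma_finite_measure M" and na: "\<not> (\<exists>A. atom M A)" and P: "cells M P m"
    and \<Phi>: "finite \<Phi>" "\<Phi> \<subseteq> dual (L1 M)" and \<delta>: "\<delta> > 0" and N: "N > (0::nat)"
  obtains A where "A \<in> sets M" "\<And>k. k < m \<Longrightarrow> measure M (A \<inter> P k) = measure M (P k) / N"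
    "\<And>k \<phi>. \<lbrakk>k < m; \<phi> \<in> \<Phi>\<rbrakk> \<Longrightarrow>
      \<bar>real N * \<phi> (L1_class M (indicator (A \<inter> P k))) - \<phi> (L1_class M (indicator (P k)))\<bar> \<le> \<delta>"
proof -
  define good where "good k A \<longleftrightarrow> A \<in> sets M \<and> A \<subseteq> P k \<and> measure M A = measure M (P k) / N \<and>
     (\<forall>\<phi>\<in>\<Phi>. \<bar>real N * \<phi> (L1_class M (indicator A)) - \<phi> (L1_class M (indicator (P k)))\<bar> \<le> \<delta>)" for k A
  have "\<exists>A. good k A" if "k < m" for k
  proof -
    have "P k \<in> fmeasurable M" using P that by (simp add: cells_def)
    then obtain A where "A \<in> sets M" "A \<subseteq> P k" "measure M A = measure M (P k) / N"
      "\<And>\<phi>. \<phi> \<in> \<Phi> \<Longrightarrow> \<bar>real N * \<phi> (L1_class M (indicator A)) - \<phi> (L1_class M (indicator (P k)))\<bar> \<le> \<delta>"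
      by (rule fair_fraction[OF sf na _ \<Phi> \<delta> N]) (rule that)
    then show ?thesis by (intro exI[of _ A]) (simp add: good_def)
  qed
  then have "\<forall>k. \<exists>A. k < m \<longrightarrow> good k A" by blast
  then obtain A where "\<forall>k. k < m \<longrightarrow> good k (A k)" by (rule choice[THEN exE])
  then have good: "good k (A k)" if "k < m" for k using that by blast
  have A: "A k \<in> sets M" "A k \<subseteq> P k" "measure M (A k) = measure M (P k) / N" if "k < m" for k
    using good[OF that] by (simp_all only: good_def)
  have fair: "\<bar>real N * \<phi> (L1_class M (indicator (A k))) - \<phi> (L1_class M (indicator (P k)))\<bar> \<le> \<delta>"
    if "k < m" "\<phi> \<in> \<Phi>" for k \<phi>
    using good[OF that(1)] that(2) unfolding good_def by blast
  have eq: "(\<Union>j<m. A j) \<inter> P k = A k" if "k < m" for k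
  proof -
    have "A j \<inter> P k \<subseteq> A k" if "j < m" for j
    proof (cases "j = k")
      case False
      then have "P j \<inter> P k = {}"
        using P \<open>k < m\<close> that by (simp add: cells_def disjoint_family_on_def)
      then show ?thesis using A(2)[OF that] by blast
    qed simp
    then show ?thesis using A(2)[OF \<open>k < m\<close>] \<open>k < m\<close> by blast
  qed
  show thesis
  proof (rule that)
    show "(\<Union>j<m. A j) \<in> sets M" using A(1) by (intro sets.finite_UN) auto
  qed (simp_all only: eq A(3) fair)
qed

lemma integral_thin:
  assumes P: "cells M P m" and A: "A \<in> sets M" and N: "N > (0::nat)"
    and frac: "\<And>k. k < m \<Longrightarrow> measure M (A \<inter> P k) = measure M (P k) / N"
  shows "(\<integral>x. indicator A x * \<bar>step P m b x\<bar> \<partial>M) = (\<integral>x. \<bar>step P m b x\<bar> \<partial>M) / N"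
proof -
  have "indicator A x * \<bar>step P m b x\<bar> = \<bar>step (\<lambda>k. A \<inter> P k) m b x\<bar>" for x
    by (simp add: step_indicator[symmetric] abs_mult)
  then show ?thesis
    using integral_abs_step[OF P] integral_abs_step[OF cells_Int[OF P A]] frac
    by (simp add: sum_divide_distrib)
qed

lemma thin_integrable:
  assumes "integrable M f" "A \<in> sets M"
  shows "integrable M (\<lambda>x. real N * (indicator A x * f x))"
  using integrable_mult_indicator[OF assms(2,1)] by simp

text \<open>
  On step functions over the given cells, multiplication by \<open>N 1\<^sub>A\<close> preserves the norm exactly. An
  error that depends on the step function would not do for the injective norm, where one \<open>A\<close> has to
  serve an infinite family of step functions.
\<close>

lemma norm_thin:
  assumes P: "cells M P m" and A: "A \<in> sets M" and N: "N > (0::nat)"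
    and frac: "\<And>k. k < m \<Longrightarrow> measure M (A \<inter> P k) = measure M (P k) / N"
  shows "(\<integral>x. \<bar>N * (indicator A x * step P m b x)\<bar> \<partial>M) = (\<integral>x. \<bar>step P m b x\<bar> \<partial>M)"
  using integral_thin[OF assms, of b] N by (simp add: abs_mult)

text \<open>
  Pointwise, the distance between \<open>N 1\<^sub>A f\<close> and \<open>g\<close> is at least the sum of the absolute values,
  less twice the absolute value of \<open>1\<^sub>A g\<close>, whose integral is \<open>1/N\<close> times the norm of \<open>g\<close>.
\<close>

lemma norm_thin_diff:
  assumes P: "cells M P m" and A: "A \<in> sets M" and N: "N > (0::nat)"
    and frac: "\<And>k. k < m \<Longrightarrow> measure M (A \<inter> P k) = measure M (P k) / N"
  shows "(\<integral>x. \<bar>step P m b x\<bar> \<partial>M) + (1 - 2 / N) * (\<integral>x. \<bar>step P m c x\<bar> \<partial>M)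
    \<le> (\<integral>x. \<bar>N * (indicator A x * step P m b x) - step P m c x\<bar> \<partial>M)"
proof -
  let ?f = "step P m b" and ?g = "step P m c"
  note f = step_integrable[OF P, of b] and g = step_integrable[OF P, of c]
  note 1 = thin_integrable[OF integrable_abs[OF f] A, of N]
    and 2 = thin_integrable[OF integrable_abs[OF g] A, of 2]
  have "(\<integral>x. N * (indicator A x * \<bar>?f x\<bar>) + \<bar>?g x\<bar> - 2 * (indicator A x * \<bar>?g x\<bar>) \<partial>M)
      \<le> (\<integral>x. \<bar>N * (indicator A x * ?f x) - ?g x\<bar> \<partial>M)"
  proof (rule integral_mono)
    show "integrable M (\<lambda>x. N * (indicator A x * \<bar>?f x\<bar>) + \<bar>?g x\<bar> - 2 * (indicator A x * \<bar>?g x\<bar>))"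
      using 1 2 g by simp
    show "integrable M (\<lambda>x. \<bar>N * (indicator A x * ?f x) - ?g x\<bar>)"
      using thin_integrable[OF f A, of N] g by simp
    fix x
    have "\<bar>real N * ?f x\<bar> = real N * \<bar>?f x\<bar>" by (simp add: abs_mult)
    then show "N * (indicator A x * \<bar>?f x\<bar>) + \<bar>?g x\<bar> - 2 * (indicator A x * \<bar>?g x\<bar>)
        \<le> \<bar>N * (indicator A x * ?f x) - ?g x\<bar>"
      by (cases "x \<in> A") auto
  qed
  moreover have "(\<integral>x. N * (indicator A x * \<bar>?f x\<bar>) + \<bar>?g x\<bar> - 2 * (indicator A x * \<bar>?g x\<bar>) \<partial>M)
      = N * (\<integral>x. indicator A x * \<bar>?f x\<bar> \<partial>M) + (\<integral>x. \<bar>?g x\<bar> \<partial>M) - 2 * (\<integral>x. indicator A x * \<bar>?g x\<bar> \<partial>M)"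
    using 1 2 g by simp
  ultimately show ?thesis
    using N by (simp add: integral_thin[OF assms] algebra_simps)
qed

lemma dual_thin:
  assumes P: "cells M P m" and A: "A \<in> sets M" and \<phi>: "\<phi> \<in> dual (L1 M)"
    and fair: "\<And>k. k < m \<Longrightarrow>
      \<bar>real N * \<phi> (L1_class M (indicator (A \<inter> P k))) - \<phi> (L1_class M (indicator (P k)))\<bar> \<le> \<delta>"
  shows "\<bar>\<phi> (L1_class M (\<lambda>x. N * (indicator A x * step P m b x))) - \<phi> (L1_class M (step P m b))\<bar>
    \<le> \<delta> * (\<Sum>k<m. \<bar>b k\<bar>)"
proof -
  note PA = cells_Int[OF P A]
  have "L1_class M (\<lambda>x. N * (indicator A x * step P m b x))
      = vscale (L1 M) N (L1_class M (step (\<lambda>k. A \<inter> P k) m b))"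
    using step_integrable[OF PA, of b] by (simp add: L1_scale step_indicator)
  then have "\<phi> (L1_class M (\<lambda>x. N * (indicator A x * step P m b x)))
      = N * (\<Sum>k<m. b k * \<phi> (L1_class M (indicator (A \<inter> P k))))"
    using step_integrable[OF PA, of b] by (simp add: dual_scale[OF \<phi>] L1_class_closed dual_step[OF \<phi> PA])
  then have "\<phi> (L1_class M (\<lambda>x. N * (indicator A x * step P m b x))) - \<phi> (L1_class M (step P m b))
      = (\<Sum>k<m. b k * (real N * \<phi> (L1_class M (indicator (A \<inter> P k))) - \<phi> (L1_class M (indicator (P k)))))"
    by (simp add: dual_step[OF \<phi> P] sum_distrib_left sum_subtractf algebra_simps)
  also have "\<bar>\<dots>\<bar> \<le> (\<Sum>k<m. \<bar>b k\<bar> * \<delta>)"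
    using fair by (intro order_trans[OF sum_abs sum_mono]) (auto simp: abs_mult mult_left_mono)
  finally show ?thesis by (simp only: sum_distrib_right[symmetric] mult.commute[of \<delta>])
qed

lemma spread_steps:
  assumes sf: "sigma_finite_measure M" and na: "\<not> (\<exists>A. atom M A)" and P: "cells M P m"
  shows "spread (L1 M) (L1_class M (step P m b)) (L1_class M (step P m c))"
  unfolding spread_def
proof (intro allI impI, elim conjE)
  fix \<Phi> and \<eta> :: real assume \<Phi>: "finite \<Phi>" "\<Phi> \<subseteq> dual (L1 M)" and \<eta>: "\<eta> > 0"
  let ?n = "\<integral>x. \<bar>step P m c x\<bar> \<partial>M" and ?s = "\<Sum>k<m. \<bar>b k\<bar>"
  have n0: "?n \<ge> 0" and s0: "?s \<ge> 0" by (auto intro: sum_nonneg)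
  obtain N :: nat where N: "N > 0" "2 / N * ?n \<le> \<eta>"
    using multiplier_exists[OF n0 \<eta>] .
  obtain A where A: "A \<in> sets M" "\<And>k. k < m \<Longrightarrow> measure M (A \<inter> P k) = measure M (P k) / N"
    and fair: "\<And>k \<phi>. \<lbrakk>k < m; \<phi> \<in> \<Phi>\<rbrakk> \<Longrightarrow>
      \<bar>real N * \<phi> (L1_class M (indicator (A \<inter> P k))) - \<phi> (L1_class M (indicator (P k)))\<bar> \<le> \<eta> / (?s + 1)"
    using thin_set_exists[OF sf na P \<Phi> _ N(1), of "\<eta> / (?s + 1)"] \<eta> s0 by auto
  define w where "w x = N * (indicator A x * step P m b x)" for x
  note ib = step_integrable[OF P, of b] and ic = step_integrable[OF P, of c]
  have iw: "integrable M w" unfolding w_def using ib A(1) by (rule thin_integrable)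
  show "\<exists>w\<in>vcarrier (L1 M). vnorm (L1 M) w \<le> vnorm (L1 M) (L1_class M (step P m b)) + \<eta> \<and>
      (\<forall>f\<in>\<Phi>. \<bar>f w - f (L1_class M (step P m b))\<bar> \<le> \<eta>) \<and>
      vnorm (L1 M) (L1_class M (step P m b)) + vnorm (L1 M) (L1_class M (step P m c)) - \<eta>
        \<le> vnorm (L1 M) (vdiff (L1 M) w (L1_class M (step P m c)))"
  proof (intro bexI conjI ballI)
    show "L1_class M w \<in> vcarrier (L1 M)" using iw by (rule L1_class_closed)
    show "vnorm (L1 M) (L1_class M w) \<le> vnorm (L1 M) (L1_class M (step P m b)) + \<eta>"
      using norm_thin[OF P A(1) N(1) A(2)] iw ib \<eta> by (simp add: L1_norm w_def)
    show "vnorm (L1 M) (L1_class M (step P m b)) + vnorm (L1 M) (L1_class M (step P m c)) - \<eta>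
        \<le> vnorm (L1 M) (vdiff (L1 M) (L1_class M w) (L1_class M (step P m c)))"
    proof -
      have "integrable M (\<lambda>x. w x - step P m c x)" using iw ic by simp
      then show ?thesis
        using norm_thin_diff[OF P A(1) N(1) A(2), of b c] iw ib ic N(2)
        by (simp add: L1_norm L1_diff) (simp add: w_def left_diff_distrib)
    qed
  next
    fix f assume f: "f \<in> \<Phi>"
    have "\<bar>f (L1_class M w) - f (L1_class M (step P m b))\<bar> \<le> \<eta> / (?s + 1) * ?s"
      unfolding w_def using f \<Phi>(2) by (intro dual_thin P A(1) fair) auto
    also have "\<dots> \<le> \<eta>" using s0 \<eta> by (rule divide_plus_one_mult_le)
    finally show "\<bar>f (L1_class M w) - f (L1_class M (step P m b))\<bar> \<le> \<eta>" .
  qed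
qed

section \<open>Density of step functions\<close>

lemma simple_approximation:
  assumes f: "integrable M (f :: 'a \<Rightarrow> real)" and "\<epsilon> > 0"
  obtains s where "Bochner_Integration.simple_bochner_integrable M s" "(\<integral>x. \<bar>f x - s x\<bar> \<partial>M) < \<epsilon>"
proof -
  obtain y where "has_bochner_integral M f y"
    using f by (rule integrable.cases)
  then obtain s where s: "\<And>i. Bochner_Integration.simple_bochner_integrable M (s i)"
      and lim: "(\<lambda>i. \<integral>\<^sup>+x. norm (f x - s i x) \<partial>M) \<longlonglongrightarrow> 0"
    by (rule has_bochner_integral.cases) (rule that)
  have "\<forall>\<^sub>F i in sequentially. (\<integral>\<^sup>+x. norm (f x - s i x) \<partial>M) < ennreal \<epsilon>"
    using lim \<open>\<epsilon> > 0\<close> by (intro order_tendstoD(2)) auto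
  then obtain i where i: "(\<integral>\<^sup>+x. norm (f x - s i x) \<partial>M) < ennreal \<epsilon>"
    by (auto simp: eventually_sequentially)
  have "integrable M (s i)"
    by (rule integrable.intros[OF has_bochner_integral_simple_bochner_integrable[OF s]])
  then have "(\<integral>\<^sup>+x. norm (f x - s i x) \<partial>M) = ennreal (\<integral>x. norm (f x - s i x) \<partial>M)"
    using f by (intro nn_integral_eq_integral) auto
  then show thesis
    using that[of "s i"] s[of i] i by (simp add: ennreal_less_iff)
qed

text \<open>
  The cells are the level sets of the tuple \<open>(s\<^sub>0, ..., s\<^sub>n\<^sub>-\<^sub>1)\<close>, except for the set where all
  components vanish, whose measure may be infinite.
\<close>

lemma common_cells:
  fixes n :: nat
  assumes s: "\<And>i. i < n \<Longrightarrow> Bochner_Integration.simple_bochner_integrable M (s i :: 'a \<Rightarrow> real)"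
  obtains P m b where "cells M P m" "\<And>i x. \<lbrakk>i < n; x \<in> space M\<rbrakk> \<Longrightarrow> s i x = step P m (b i) x"
proof -
  have sf: "simple_function M (s i)" and fin: "emeasure M {x \<in> space M. s i x \<noteq> 0} \<noteq> \<infinity>"
    if "i < n" for i using s[OF that] by (auto elim: simple_bochner_integrable.cases)
  define V where "V x = map (\<lambda>i. s i x) [0..<n]" for x
  define R where "R = V ` space M - {replicate n 0}"
  have sub: "V ` space M \<subseteq> {vs. set vs \<subseteq> (\<Union>i<n. s i ` space M) \<and> length vs = n}"
    by (fastforce simp: V_def)
  have "finite (\<Union>i<n. s i ` space M)"
    using sf by (auto simp: simple_function_def)
  then have "finite R"
    unfolding R_def by (intro finite_Diff finite_subset[OF sub] finite_lists_length_eq)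
  then obtain vs where vs: "bij_betw vs {..<card R} R"
    using ex_bij_betw_nat_finite by (metis atLeast0LessThan)
  define P where "P k = {x \<in> space M. V x = vs k}" for k
  have R_len: "length v = n" "\<exists>i<n. v ! i \<noteq> 0" if "v \<in> R" for v
  proof -
    show len: "length v = n" using that by (auto simp: R_def V_def)
    show "\<exists>i<n. v ! i \<noteq> 0"
      using that len by (auto simp: R_def) (metis len nth_equalityI length_replicate nth_replicate)
  qed
  have P: "cells M P (card R)"
    unfolding cells_def
  proof (intro conjI allI impI)
    show "disjoint_family_on P {..<card R}"
      using vs by (auto simp: disjoint_family_on_def P_def bij_betw_def inj_on_def)
    fix k assume "k < card R"
    then have k: "vs k \<in> R" using vs by (auto simp: bij_betw_def)
    obtain i where i: "i < n" "vs k ! i \<noteq> 0" using R_len[OF k] by blast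
    have eq: "P k = {x \<in> space M. \<forall>i<n. s i x = vs k ! i}"
      using R_len(1)[OF k] by (auto simp: P_def V_def list_eq_iff_nth_eq)
    have [measurable]: "s i \<in> borel_measurable M" if "i < n" for i
      using sf[OF that] by (rule borel_measurable_simple_function)
    have "{x \<in> space M. \<forall>i<n. s i x = vs k ! i} \<in> sets M"
    proof -
      have "{x \<in> space M. \<forall>i\<in>{..<n}. s i x = vs k ! i} \<in> sets M"
        by (intro sets.sets_Collect_finite_All) (auto intro: borel_measurable_eq)
      then show ?thesis by (simp add: lessThan_def)
    qed
    then have "P k \<in> sets M" by (simp add: eq)
    show "P k \<in> fmeasurable M"
    proof (rule fmeasurableI2[of "{x \<in> space M. s i x \<noteq> 0}"])
      show "{x \<in> space M. s i x \<noteq> 0} \<in> fmeasurable M"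
        using fin[OF i(1)] i(1) by (auto simp: fmeasurable_def less_top)
      show "P k \<subseteq> {x \<in> space M. s i x \<noteq> 0}" using i by (auto simp: eq)
    qed fact
  qed
  show thesis
  proof (rule that[OF P])
    fix i x assume ix: "i < n" "x \<in> space M"
    show "s i x = step P (card R) (\<lambda>k. vs k ! i) x"
    proof (cases "V x \<in> R")
      case True
      then have "V x \<in> vs ` {..<card R}" using vs by (simp add: bij_betw_def)
      then obtain k where k: "k < card R" "V x = vs k" by auto
      then have "step P (card R) (\<lambda>k. vs k ! i) x = vs k ! i"
        using P ix by (intro step_in) (auto simp: cells_def P_def)
      moreover have "V x ! i = s i x" using ix by (simp add: V_def)
      ultimately show ?thesis using k by simp
    next
      case False
      then have "V x = replicate n 0" using ix by (auto simp: R_def)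
      then have "V x ! i = 0" using ix by simp
      then have "s i x = 0" using ix by (simp add: V_def)
      moreover have "step P (card R) (\<lambda>k. vs k ! i) x = 0"
        using False vs by (intro step_out) (auto simp: P_def bij_betw_def)
      ultimately show ?thesis by simp
    qed
  qed
qed

lemma steps_dense:
  fixes n :: nat
  assumes z: "\<And>i. i < n \<Longrightarrow> z i \<in> vcarrier (L1 M)" and "\<epsilon> > 0"
  obtains P m b where "cells M P m"
    "\<And>i. i < n \<Longrightarrow> vnorm (L1 M) (vdiff (L1 M) (z i) (L1_class M (step P m (b i)))) < \<epsilon>"
proof -
  have "\<exists>f. integrable M f \<and> z i = L1_class M f" if "i < n" for i
    using z[OF that] by (auto simp: L1_carrier)
  then obtain f where f: "\<And>i. i < n \<Longrightarrow> integrable M (f i)" "\<And>i. i < n \<Longrightarrow> z i = L1_class M (f i)"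
    by metis
  have "\<exists>s. Bochner_Integration.simple_bochner_integrable M s \<and> (\<integral>x. \<bar>f i x - s x\<bar> \<partial>M) < \<epsilon>" if "i < n" for i
    using simple_approximation[OF f(1)[OF that] \<open>\<epsilon> > 0\<close>] by blast
  then obtain s where s: "\<And>i. i < n \<Longrightarrow> Bochner_Integration.simple_bochner_integrable M (s i)"
    "\<And>i. i < n \<Longrightarrow> (\<integral>x. \<bar>f i x - s i x\<bar> \<partial>M) < \<epsilon>" by metis
  show thesis
  proof (rule common_cells[of n M s])
    show "Bochner_Integration.simple_bochner_integrable M (s i)" if "i < n" for i
      using that by (rule s(1))
  next
    fix P m b
    assume P: "cells M P m" "\<And>i x. \<lbrakk>i < n; x \<in> space M\<rbrakk> \<Longrightarrow> s i x = step P m (b i) x"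
    show thesis
    proof (rule that[OF P(1)])
    fix i assume i: "i < n"
    have "(\<integral>x. \<bar>f i x - s i x\<bar> \<partial>M) = (\<integral>x. \<bar>f i x - step P m (b i) x\<bar> \<partial>M)"
      using P(2)[OF i] by (intro Bochner_Integration.integral_cong) auto
    then show "vnorm (L1 M) (vdiff (L1 M) (z i) (L1_class M (step P m (b i)))) < \<epsilon>"
      using s(2)[OF i] f[OF i] step_integrable[OF P(1), of "b i"] by (simp add: L1_diff L1_norm)
    qed
  qed
qed

lemma spread_L1:
  assumes sf: "sigma_finite_measure M" and na: "\<not> (\<exists>A. atom M A)"
    and x: "x \<in> vcarrier (L1 M)" and y: "y \<in> vcarrier (L1 M)"
  shows "spread (L1 M) x y"
proof (rule spread_dense[OF seminormed_L1 seminormed_L1 _ _ x y, where J = "\<lambda>x. x"])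
  show "linear_op (L1 M) (L1 M) (\<lambda>x. x)" by (simp add: linear_op_def)
  fix \<eta> :: real assume \<eta>: "\<eta> > 0"
  define z where "z i = (if i = 0 then x else y)" for i :: nat
  have "z i \<in> vcarrier (L1 M)" for i using x y by (simp add: z_def)
  then obtain P m b where P: "cells M P m"
    "\<And>i. i < 2 \<Longrightarrow> vnorm (L1 M) (vdiff (L1 M) (z i) (L1_class M (step P m (b i)))) < \<eta>"
    using steps_dense[of 2 z M \<eta>] \<eta> by blast
  show "\<exists>x'\<in>vcarrier (L1 M). \<exists>y'\<in>vcarrier (L1 M). spread (L1 M) x' y' \<and>
        vnorm (L1 M) (vdiff (L1 M) x x') \<le> \<eta> \<and> vnorm (L1 M) (vdiff (L1 M) y y') \<le> \<eta>"
  proof (intro bexI conjI)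
    show "spread (L1 M) (L1_class M (step P m (b 0))) (L1_class M (step P m (b 1)))"
      using sf na P(1) by (rule spread_steps)
    show "vnorm (L1 M) (vdiff (L1 M) x (L1_class M (step P m (b 0)))) \<le> \<eta>"
      "vnorm (L1 M) (vdiff (L1 M) y (L1_class M (step P m (b 1)))) \<le> \<eta>"
      using P(2)[of 0] P(2)[of 1] by (simp_all add: z_def)
  qed (simp_all add: L1_class_closed step_integrable[OF P(1)])
qed simp


section \<open>Norming functionals\<close>

context seminormed_vspace
begin

text \<open>
  Fixing the values off the carrier makes the pointwise order antisymmetric, as is needed for Zorn's
  lemma.
\<close>

definition sublinear :: "('a \<Rightarrow> real) \<Rightarrow> bool" where
  "sublinear p \<longleftrightarrow>
     (\<forall>x\<in>vcarrier Z. \<forall>y\<in>vcarrier Z. p (vadd Z x y) \<le> p x + p y) \<and>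
     (\<forall>x\<in>vcarrier Z. \<forall>t\<ge>0. p (vscale Z t x) = t * p x) \<and>
     (\<forall>x. x \<notin> vcarrier Z \<longrightarrow> p x = 0)"

lemma sublinear_add: "\<lbrakk>sublinear p; x \<in> vcarrier Z; y \<in> vcarrier Z\<rbrakk> \<Longrightarrow> p (vadd Z x y) \<le> p x + p y"
  and sublinear_scale: "\<lbrakk>sublinear p; x \<in> vcarrier Z; t \<ge> 0\<rbrakk> \<Longrightarrow> p (vscale Z t x) = t * p x"
  by (simp_all add: sublinear_def)

lemma sublinear_minus: "\<lbrakk>sublinear p; x \<in> vcarrier Z\<rbrakk> \<Longrightarrow> - p (vscale Z (-1) x) \<le> p x"
  using sublinear_add[of p x "vscale Z (-1) x"] sublinear_scale[of p x 0]
  by (simp add: add_inverse scale_closed scale_zero_left)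

lemma sublinearI:
  assumes add: "\<And>x y. \<lbrakk>x \<in> vcarrier Z; y \<in> vcarrier Z\<rbrakk> \<Longrightarrow> p (vadd Z x y) \<le> p x + p y"
    and zero: "p (vzero Z) = 0"
    and scale: "\<And>t x. \<lbrakk>x \<in> vcarrier Z; t > 0\<rbrakk> \<Longrightarrow> p (vscale Z t x) \<le> t * p x"
    and off: "\<And>x. x \<notin> vcarrier Z \<Longrightarrow> p x = 0"
  shows "sublinear p"
  unfolding sublinear_def
proof (intro conjI ballI allI impI)
  fix x and t :: real assume x: "x \<in> vcarrier Z" and "t \<ge> 0"
  show "p (vscale Z t x) = t * p x"
  proof (cases "t = 0")
    case True
    then show ?thesis using x by (simp add: scale_zero_left zero)
  next
    case False
    then have t: "t > 0" using \<open>t \<ge> 0\<close> by simp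
    have "p (vscale Z (1 / t) (vscale Z t x)) \<le> 1 / t * p (vscale Z t x)"
      using x t by (intro scale scale_closed) auto
    then have "t * p x \<le> p (vscale Z t x)"
      using x t by (simp add: scale_scale scale_one field_simps)
    then show ?thesis using scale[OF x t] by simp
  qed
qed (use add off in auto)

text \<open>
  The correction of \<open>p\<close> from below that makes it linear along \<open>y\<close>: it keeps the value of \<open>p\<close> at
  \<open>y\<close> and has the value \<open>- p y\<close> at \<open>- y\<close>.
\<close>

definition tilt :: "('a \<Rightarrow> real) \<Rightarrow> 'a \<Rightarrow> 'a \<Rightarrow> real" where
  "tilt p y x = (if x \<in> vcarrier Z then INF t\<in>{0..}. p (vadd Z x (vscale Z t y)) - t * p y else 0)"

context
  fixes p y assumes p: "sublinear p" and y: "y \<in> vcarrier Z"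
begin

lemma tilt_bdd_below:
  assumes x: "x \<in> vcarrier Z"
  shows "bdd_below ((\<lambda>t. p (vadd Z x (vscale Z t y)) - t * p y) ` {0..})"
proof (rule bdd_belowI2[where m = "- p (vscale Z (-1) x)"])
  fix t :: real assume t: "t \<in> {0..}"
  have "p (vadd Z (vadd Z x (vscale Z t y)) (vscale Z (-1) x))
      \<le> p (vadd Z x (vscale Z t y)) + p (vscale Z (-1) x)"
    using x y by (intro sublinear_add[OF p] closed)
  also have "vadd Z (vadd Z x (vscale Z t y)) (vscale Z (-1) x) = vscale Z t y"
    using add_diff_cancel[of x "vscale Z t y"] x y by (simp add: vdiff_def closed)
  finally show "- p (vscale Z (-1) x) \<le> p (vadd Z x (vscale Z t y)) - t * p y"
    using t y by (simp add: sublinear_scale[OF p])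
qed

lemma tilt_le: "\<lbrakk>x \<in> vcarrier Z; t \<ge> 0\<rbrakk> \<Longrightarrow> tilt p y x \<le> p (vadd Z x (vscale Z t y)) - t * p y"
  unfolding tilt_def by (simp, rule cINF_lower[OF tilt_bdd_below]) auto

lemma tilt_greatest:
  assumes "x \<in> vcarrier Z" "\<And>t. t \<ge> 0 \<Longrightarrow> c \<le> p (vadd Z x (vscale Z t y)) - t * p y"
  shows "c \<le> tilt p y x"
  using assms unfolding tilt_def by (auto intro!: cINF_greatest)

lemma tilt_le_self: "x \<in> vcarrier Z \<Longrightarrow> tilt p y x \<le> p x"
  using tilt_le[of x 0] y by (simp add: scale_zero_left add_zero_right)

lemma sublinear_tilt: "sublinear (tilt p y)"
proof (rule sublinearI)
  fix x x' assume x: "x \<in> vcarrier Z" "x' \<in> vcarrier Z"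
  have both: "tilt p y (vadd Z x x') \<le>
      (p (vadd Z x (vscale Z t y)) - t * p y) + (p (vadd Z x' (vscale Z s y)) - s * p y)"
    if "t \<ge> 0" "s \<ge> 0" for t s
  proof -
    have "tilt p y (vadd Z x x') \<le> p (vadd Z (vadd Z x x') (vscale Z (t + s) y)) - (t + s) * p y"
      using x that by (intro tilt_le closed) auto
    also have "vadd Z (vadd Z x x') (vscale Z (t + s) y)
        = vadd Z (vadd Z x (vscale Z t y)) (vadd Z x' (vscale Z s y))"
      using x y by (simp add: scale_add_left add_assoc add_left_commute closed)
    also have "p \<dots> \<le> p (vadd Z x (vscale Z t y)) + p (vadd Z x' (vscale Z s y))"
      using x y by (intro sublinear_add[OF p] closed)
    finally show ?thesis by (simp add: algebra_simps)
  qed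
  have "tilt p y (vadd Z x x') - (p (vadd Z x' (vscale Z s y)) - s * p y) \<le> tilt p y x" if "s \<ge> 0" for s
    using both[OF _ that] by (intro tilt_greatest x) (simp add: algebra_simps)
  then have "tilt p y (vadd Z x x') - tilt p y x \<le> tilt p y x'"
    by (intro tilt_greatest x) (simp add: algebra_simps)
  then show "tilt p y (vadd Z x x') \<le> tilt p y x + tilt p y x'" by simp
next
  have "0 \<le> tilt p y (vzero Z)"
    using y by (intro tilt_greatest closed) (simp add: add_zero closed sublinear_scale[OF p])
  moreover have "tilt p y (vzero Z) \<le> 0"
    using tilt_le_self[OF zero_closed] sublinear_scale[OF p zero_closed, of 0]
    by (simp add: scale_zero_right)
  ultimately show "tilt p y (vzero Z) = 0" by simp
next
  fix a x assume x: "x \<in> vcarrier Z" and a: "(a::real) > 0"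
  have "tilt p y (vscale Z a x) / a \<le> tilt p y x"
  proof (rule tilt_greatest[OF x])
    fix t :: real assume t: "t \<ge> 0"
    have "tilt p y (vscale Z a x) \<le> p (vadd Z (vscale Z a x) (vscale Z (a * t) y)) - (a * t) * p y"
      using x a t by (intro tilt_le closed) auto
    also have "vadd Z (vscale Z a x) (vscale Z (a * t) y) = vscale Z a (vadd Z x (vscale Z t y))"
      using x y by (simp add: scale_add_right scale_scale closed)
    also have "p \<dots> = a * p (vadd Z x (vscale Z t y))"
      using x y a by (intro sublinear_scale[OF p] closed) auto
    finally show "tilt p y (vscale Z a x) / a \<le> p (vadd Z x (vscale Z t y)) - t * p y"
      using a by (simp add: field_simps)
  qed
  then show "tilt p y (vscale Z a x) \<le> a * tilt p y x"
    using a by (simp add: field_simps)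
qed (simp add: tilt_def)

end

text \<open>
  By Zorn's lemma, since the infimum of a chain of sublinear functionals below \<open>q\<close> is again
  sublinear; it is finite because a sublinear \<open>p\<close> below \<open>q\<close> satisfies \<open>p x \<ge> - q (- x)\<close>.
\<close>

lemma minimal_sublinear_exists:
  assumes q: "sublinear q"
  obtains m where "sublinear m" "\<And>x. m x \<le> q x"
    "\<And>p. \<lbrakk>sublinear p; \<And>x. p x \<le> m x\<rbrakk> \<Longrightarrow> p = m"
proof -
  define A where "A = {p. sublinear p \<and> (\<forall>x. p x \<le> q x)}"
  define R where "R p p' \<longleftrightarrow> (\<forall>x. p' x \<le> p x)" for p p' :: "'a \<Rightarrow> real"
  have "\<exists>m\<in>A. \<forall>p\<in>A. R m p \<longrightarrow> p = m"
  proof (rule predicate_Zorn)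
    show "partial_order_on A (relation_of R A)"
      by (rule partial_order_on_relation_ofI) (auto simp: R_def fun_eq_iff intro: order_trans antisym)
  next
    fix C assume C: "C \<in> Chains (relation_of R A)"
    have CA: "C \<subseteq> A" and chain: "\<And>p p'. \<lbrakk>p \<in> C; p' \<in> C\<rbrakk> \<Longrightarrow> R p p' \<or> R p' p"
      using C by (auto simp: Chains_def relation_of_def)
    have sub: "sublinear p" and le_q: "p x \<le> q x" if "p \<in> C" for p x
      using that CA by (auto simp: A_def)
    show "\<exists>u\<in>A. \<forall>a\<in>C. R a u"
    proof (cases "C = {}")
      case True
      then show ?thesis using q by (auto simp: A_def)
    next
      case False
      then obtain p0 where p0: "p0 \<in> C" by blast
      define u where "u x = (INF p\<in>C. p x)" for x
      have bdd: "bdd_below ((\<lambda>p. p x) ` C)" for x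
      proof (cases "x \<in> vcarrier Z")
        case True
        show ?thesis
        proof (rule bdd_belowI2[where m = "- q (vscale Z (-1) x)"])
          fix p assume p: "p \<in> C"
          show "- q (vscale Z (-1) x) \<le> p x"
            using sublinear_minus[OF sub[OF p] True] le_q[OF p, of "vscale Z (-1) x"] by linarith
        qed
      next
        case False
        then have zero: "p x = 0" if "p \<in> C" for p
          using sub[OF that] by (simp add: sublinear_def)
        show ?thesis
          by (rule bdd_belowI2[where m = 0]) (use zero in fastforce)
      qed
      have lower: "u x \<le> p x" if "p \<in> C" for p x
        unfolding u_def using bdd that by (rule cINF_lower)
      have greatest: "c \<le> u x" if "\<And>p. p \<in> C \<Longrightarrow> c \<le> p x" for c x
        unfolding u_def using False that by (rule cINF_greatest)
      have "sublinear u"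
      proof (rule sublinearI)
        fix x y assume xy: "x \<in> vcarrier Z" "y \<in> vcarrier Z"
        have "u (vadd Z x y) \<le> p x + p' y" if pp: "p \<in> C" "p' \<in> C" for p p'
        proof -
          obtain r where r: "r \<in> C" "r x \<le> p x" "r y \<le> p' y"
            using chain[OF pp] pp by (auto simp: R_def)
          then show ?thesis
            using lower[OF r(1), of "vadd Z x y"] sublinear_add[OF sub[OF r(1)] xy] by linarith
        qed
        then have "u (vadd Z x y) - p' y \<le> u x" if "p' \<in> C" for p'
          using that by (intro greatest) (simp add: algebra_simps)
        then have "u (vadd Z x y) - u x \<le> u y"
          by (intro greatest) (simp add: algebra_simps)
        then show "u (vadd Z x y) \<le> u x + u y" by simp
      next
        have "p (vzero Z) = 0" if "p \<in> C" for p
          using sublinear_scale[OF sub[OF that] zero_closed, of 0] by (simp add: scale_zero_right)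
        then have "(\<lambda>p. p (vzero Z)) ` C = (\<lambda>_. 0) ` C" by (intro image_cong) auto
        then show "u (vzero Z) = 0" using False by (simp add: u_def)
      next
        fix t x assume x: "x \<in> vcarrier Z" and t: "(t::real) > 0"
        have "u (vscale Z t x) / t \<le> u x"
        proof (rule greatest)
          fix p assume p: "p \<in> C"
          have "u (vscale Z t x) \<le> t * p x"
            using lower[OF p, of "vscale Z t x"] sublinear_scale[OF sub[OF p] x, of t] t by simp
          then show "u (vscale Z t x) / t \<le> p x" using t by (simp add: field_simps)
        qed
        then show "u (vscale Z t x) \<le> t * u x" using t by (simp add: field_simps)
      next
        fix x assume "x \<notin> vcarrier Z"
        then have "p x = 0" if "p \<in> C" for p
          using sub[OF that] by (simp add: sublinear_def)
        then have "(\<lambda>p. p x) ` C = (\<lambda>_. 0) ` C" by (intro image_cong) auto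
        then show "u x = 0" using False by (simp add: u_def)
      qed
      moreover have "u x \<le> q x" for x
        using lower[OF p0, of x] le_q[OF p0, of x] by linarith
      ultimately show ?thesis
        using lower by (intro bexI[of _ u]) (auto simp: A_def R_def)
    qed
  qed
  then obtain m where m: "m \<in> A" "\<And>p. \<lbrakk>p \<in> A; R m p\<rbrakk> \<Longrightarrow> p = m" by blast
  show thesis
  proof (rule that[of m])
    show "sublinear m" "m x \<le> q x" for x using m(1) by (auto simp: A_def)
    fix p assume p: "sublinear p" "\<And>x. p x \<le> m x"
    have "p x \<le> q x" for x using p(2)[of x] m(1) by (auto simp: A_def intro: order_trans)
    then show "p = m" using p by (intro m(2)) (auto simp: A_def R_def)
  qed
qed

text \<open>
  The Hahn-Banach theorem for a single vector. A minimal sublinear functional \<open>m\<close> is linear: tilting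
  it along \<open>y\<close> cannot lower it, which says that \<open>m x + m y \<le> m (x + y)\<close>. Minimising below the norm
  tilted along \<open>x0\<close> ensures that \<open>m (- x0)\<close> is at most \<open>- \<parallel>x0\<parallel>\<close>.
\<close>

lemma norming_functional:
  assumes x0: "x0 \<in> vcarrier Z" "vnorm Z x0 \<noteq> 0"
  obtains f where "f \<in> dual_sphere Z" "f x0 = vnorm Z x0"
proof -
  define n where "n x = (if x \<in> vcarrier Z then vnorm Z x else 0)" for x
  have n: "sublinear n"
    by (auto simp: sublinear_def n_def closed norm_triangle norm_scale)
  obtain m where m: "sublinear m" "\<And>x. m x \<le> tilt n x0 x"
      and minimal: "\<And>p. \<lbrakk>sublinear p; \<And>x. p x \<le> m x\<rbrakk> \<Longrightarrow> p = m"
    using minimal_sublinear_exists[OF sublinear_tilt[OF n x0(1)]] by metis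
  have m_le: "m x \<le> vnorm Z x" if "x \<in> vcarrier Z" for x
    using m(2)[of x] tilt_le_self[OF n x0(1) that] that by (simp add: n_def)
  have m_add: "m (vadd Z x y) = m x + m y" if xy: "x \<in> vcarrier Z" "y \<in> vcarrier Z" for x y
  proof -
    have "tilt m y x' \<le> m x'" for x'
      using tilt_le_self[OF m(1) xy(2), of x'] m(1) by (cases "x' \<in> vcarrier Z") (auto simp: tilt_def sublinear_def)
    then have "tilt m y = m"
      by (intro minimal sublinear_tilt[OF m(1) xy(2)])
    then have "m x \<le> m (vadd Z x y) - m y"
      using tilt_le[OF m(1) xy(2,1), of 1] xy by (simp add: scale_one)
    then show ?thesis using sublinear_add[OF m(1) xy] by simp
  qed
  have m_minus: "m (vscale Z (-1) x) = - m x" if "x \<in> vcarrier Z" for x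
    using m_add[OF that scale_closed[OF that, of "-1"]] sublinear_scale[OF m(1) that, of 0] that
    by (simp add: add_inverse scale_zero_left)
  have m_scale: "m (vscale Z t x) = t * m x" if x: "x \<in> vcarrier Z" for t x
  proof (cases "t \<ge> 0")
    case True
    then show ?thesis using sublinear_scale[OF m(1) x] by simp
  next
    case False
    have "m (vscale Z t x) = m (vscale Z (-1) (vscale Z (-t) x))"
      using x by (simp add: scale_scale)
    then show ?thesis
      using False x by (simp add: m_minus scale_closed sublinear_scale[OF m(1)])
  qed
  have m_abs: "\<bar>m x\<bar> \<le> vnorm Z x" if "x \<in> vcarrier Z" for x
    using m_le[OF that] m_le[OF scale_closed[OF that, of "-1"]] that
    by (simp add: m_minus norm_minus abs_le_iff)
  have "m (vscale Z (-1) x0) \<le> tilt n x0 (vscale Z (-1) x0)" by (rule m(2))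
  also have "\<dots> \<le> n (vadd Z (vscale Z (-1) x0) (vscale Z 1 x0)) - 1 * n x0"
    using x0 by (intro tilt_le[OF n x0(1)] closed) auto
  also have "vadd Z (vscale Z (-1) x0) (vscale Z 1 x0) = vzero Z"
    using x0 by (simp add: scale_one add_commute[of _ x0] add_inverse closed)
  finally have "vnorm Z x0 \<le> m x0"
    using x0 by (simp add: n_def norm_zero m_minus zero_closed)
  then have mx0: "m x0 = vnorm Z x0" using m_le[OF x0(1)] by simp
  have Z: "seminormed_vspace Z" by unfold_locales
  have dual: "m \<in> dual Z"
    by (rule dualI[where K = 1]) (simp_all add: m_add m_scale m_abs)
  have pos: "vnorm Z x0 > 0" using x0 norm_nonneg[OF x0(1)] by simp
  have "m \<in> dual_sphere Z"
    by (rule dual_sphereI[OF Z dual m_abs, of "vscale Z (inverse (vnorm Z x0)) x0"])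
       (use x0 pos in \<open>simp_all add: closed norm_scale m_scale mx0\<close>)
  then show thesis using that mx0 by blast
qed

end

section \<open>The injective norm\<close>

definition tensor_sum ::
    "'a nspace \<Rightarrow> 'b nspace \<Rightarrow> nat \<Rightarrow> (nat \<Rightarrow> 'a) \<Rightarrow> (nat \<Rightarrow> 'b) \<Rightarrow> ('a \<Rightarrow> 'b \<Rightarrow> real) \<Rightarrow> real" where
  "tensor_sum Z X n z x = (\<lambda>B. \<Sum>i<n. elem_tensor Z X (z i) (x i) B)"

text \<open>
  If a dual sphere were empty, then the injective norm would be the unspecified supremum of the empty
  set of reals.
\<close>

locale tensor_pair =
  Z: seminormed_vspace Z + X: seminormed_vspace X for Z :: "'a nspace" and X :: "'b nspace" +
  assumes dual_sphere_Z: "dual_sphere Z \<noteq> {}" and dual_sphere_X: "dual_sphere X \<noteq> {}"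
begin

abbreviation "T \<equiv> inj_tensor Z X"
abbreviation "elem \<equiv> elem_tensor Z X"
abbreviation "tsum \<equiv> tensor_sum Z X"

lemma Z: "seminormed_vspace Z" by (rule Z.seminormed_vspace_axioms)
lemma X: "seminormed_vspace X" by (rule X.seminormed_vspace_axioms)

lemma T_simps:
  "vzero T = (\<lambda>_. 0)" "vadd T = (\<lambda>u v B. u B + v B)" "vscale T = (\<lambda>a u B. a * u B)"
  "vdiff T u v = (\<lambda>B. u B - v B)"
  by (simp_all add: inj_tensor_def vdiff_def)

lemma T_carrier:
  "vcarrier T = {tsum n z x | n z x. \<forall>i<n. z i \<in> vcarrier Z \<and> x i \<in> vcarrier X}"
  by (auto simp: inj_tensor_def tensor_sum_def)

lemma tsum_closed: "(\<And>i. i < n \<Longrightarrow> z i \<in> vcarrier Z \<and> x i \<in> vcarrier X) \<Longrightarrow> tsum n z x \<in> vcarrier T"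
  by (auto simp: T_carrier)

lemma elem_add_left:
  "\<lbrakk>z \<in> vcarrier Z; z' \<in> vcarrier Z; x \<in> vcarrier X\<rbrakk> \<Longrightarrow> elem (vadd Z z z') x = (\<lambda>B. elem z x B + elem z' x B)"
  by (auto simp: elem_tensor_def bilinear_form_def linear_op_def real_nspace_def fun_eq_iff)

lemma elem_scale_left:
  "\<lbrakk>z \<in> vcarrier Z; x \<in> vcarrier X\<rbrakk> \<Longrightarrow> elem (vscale Z a z) x = (\<lambda>B. a * elem z x B)"
  by (auto simp: elem_tensor_def bilinear_form_def linear_op_def real_nspace_def fun_eq_iff)

lemma elem_scale_right:
  "\<lbrakk>z \<in> vcarrier Z; x \<in> vcarrier X\<rbrakk> \<Longrightarrow> elem z (vscale X a x) = (\<lambda>B. a * elem z x B)"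
  by (auto simp: elem_tensor_def bilinear_form_def linear_op_def real_nspace_def fun_eq_iff)

lemma elem_diff_left:
  "\<lbrakk>z \<in> vcarrier Z; z' \<in> vcarrier Z; x \<in> vcarrier X\<rbrakk> \<Longrightarrow> elem (vdiff Z z z') x = (\<lambda>B. elem z x B - elem z' x B)"
  by (simp add: vdiff_def elem_add_left elem_scale_left Z.closed)

lemma elem_as_tsum: "elem z x = tsum 1 (\<lambda>_. z) (\<lambda>_. x)"
  by (simp add: tensor_sum_def)

lemma elem_closed: "\<lbrakk>z \<in> vcarrier Z; x \<in> vcarrier X\<rbrakk> \<Longrightarrow> elem z x \<in> vcarrier T"
  unfolding elem_as_tsum by (rule tsum_closed) auto

lemma tsum_Suc: "tsum (Suc n) z x = vadd T (tsum n z x) (elem (z n) (x n))"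
  by (simp add: tensor_sum_def T_simps)

lemma tsum_diff:
  assumes "\<And>i. i < n \<Longrightarrow> z i \<in> vcarrier Z \<and> z' i \<in> vcarrier Z \<and> x i \<in> vcarrier X"
  shows "vdiff T (tsum n z x) (tsum n z' x) = tsum n (\<lambda>i. vdiff Z (z i) (z' i)) x"
  using assms by (simp add: T_simps tensor_sum_def elem_diff_left sum_subtractf)

lemma tsum_eval:
  assumes "f \<in> dual Z" "g \<in> dual X"
  shows "tsum n z x (\<lambda>z x. f z * g x) = (\<Sum>i<n. f (z i) * g (x i))"
proof -
  have "bilinear_form Z X (\<lambda>z x. f z * g x)"
    using assms by (auto simp: bilinear_form_def linear_op_def real_nspace_def dual_add dual_scale algebra_simps)
  then show ?thesis by (simp add: tensor_sum_def elem_tensor_def)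
qed

lemma norm_T: "vnorm T u = (SUP (f, g) \<in> dual_sphere Z \<times> dual_sphere X. \<bar>u (\<lambda>z x. f z * g x)\<bar>)"
  by (simp add: inj_tensor_def)

lemma tsum_eval_le:
  assumes zx: "\<And>i. i < n \<Longrightarrow> z i \<in> vcarrier Z \<and> x i \<in> vcarrier X"
    and fg: "f \<in> dual_sphere Z" "g \<in> dual_sphere X"
  shows "\<bar>tsum n z x (\<lambda>z x. f z * g x)\<bar> \<le> (\<Sum>i<n. vnorm Z (z i) * vnorm X (x i))"
proof -
  have "\<bar>\<Sum>i<n. f (z i) * g (x i)\<bar> \<le> (\<Sum>i<n. \<bar>f (z i) * g (x i)\<bar>)" by (rule sum_abs)
  also have "\<dots> \<le> (\<Sum>i<n. vnorm Z (z i) * vnorm X (x i))"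
  proof (rule sum_mono)
    fix i assume "i \<in> {..<n}"
    then have "z i \<in> vcarrier Z" "x i \<in> vcarrier X" using zx by auto
    then show "\<bar>f (z i) * g (x i)\<bar> \<le> vnorm Z (z i) * vnorm X (x i)"
      unfolding abs_mult
      by (intro mult_mono dual_sphere_bound[OF Z fg(1)] dual_sphere_bound[OF X fg(2)] Z.norm_nonneg) auto
  qed
  finally show ?thesis using fg by (simp add: tsum_eval dual_sphere_subset)
qed

lemma norm_T_upper:
  assumes u: "u \<in> vcarrier T" and fg: "f \<in> dual_sphere Z" "g \<in> dual_sphere X"
  shows "\<bar>u (\<lambda>z x. f z * g x)\<bar> \<le> vnorm T u"
proof -
  obtain n z x where rep: "u = tsum n z x" "\<forall>i<n. z i \<in> vcarrier Z \<and> x i \<in> vcarrier X"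
    using u by (auto simp: T_carrier)
  have "bdd_above ((\<lambda>(f, g). \<bar>u (\<lambda>z x. f z * g x)\<bar>) ` (dual_sphere Z \<times> dual_sphere X))"
    by (rule bdd_aboveI2[where M = "\<Sum>i<n. vnorm Z (z i) * vnorm X (x i)"])
       (use rep tsum_eval_le in auto)
  from cSUP_upper[OF _ this, of "(f, g)"] show ?thesis
    using fg by (simp add: norm_T)
qed

lemma norm_T_least:
  assumes "\<And>f g. \<lbrakk>f \<in> dual_sphere Z; g \<in> dual_sphere X\<rbrakk> \<Longrightarrow> \<bar>u (\<lambda>z x. f z * g x)\<bar> \<le> c"
  shows "vnorm T u \<le> c"
  unfolding norm_T using dual_sphere_Z dual_sphere_X assms by (intro cSUP_least) auto

lemma norm_tsum_le:
  assumes "\<And>i. i < n \<Longrightarrow> z i \<in> vcarrier Z \<and> x i \<in> vcarrier X"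
  shows "vnorm T (tsum n z x) \<le> (\<Sum>i<n. vnorm Z (z i) * vnorm X (x i))"
  by (intro norm_T_least tsum_eval_le assms)

lemma T_add_closed:
  assumes "u \<in> vcarrier T" "v \<in> vcarrier T"
  shows "(\<lambda>B. u B + v B) \<in> vcarrier T"
proof -
  obtain n z x where u: "u = tsum n z x" "\<forall>i<n. z i \<in> vcarrier Z \<and> x i \<in> vcarrier X"
    using assms(1) by (auto simp: T_carrier)
  obtain k z' x' where v: "v = tsum k z' x'" "\<forall>i<k. z' i \<in> vcarrier Z \<and> x' i \<in> vcarrier X"
    using assms(2) by (auto simp: T_carrier)
  have "tsum n z x B + tsum j z' x' B =
      tsum (n + j) (\<lambda>i. if i < n then z i else z' (i - n)) (\<lambda>i. if i < n then x i else x' (i - n)) B" for j B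
    by (induction j) (simp_all add: tensor_sum_def)
  then have "(\<lambda>B. u B + v B) =
      tsum (n + k) (\<lambda>i. if i < n then z i else z' (i - n)) (\<lambda>i. if i < n then x i else x' (i - n))"
    using u v by (simp add: fun_eq_iff)
  then show ?thesis
    using u v by (auto intro!: tsum_closed)
qed

lemma T_scale_closed:
  assumes "u \<in> vcarrier T"
  shows "(\<lambda>B. a * u B) \<in> vcarrier T"
proof -
  obtain n z x where u: "u = tsum n z x" "\<forall>i<n. z i \<in> vcarrier Z \<and> x i \<in> vcarrier X"
    using assms by (auto simp: T_carrier)
  then have "(\<lambda>B. a * u B) = tsum n (\<lambda>i. vscale Z a (z i)) x"
    by (simp add: tensor_sum_def elem_scale_left sum_distrib_left)
  then show ?thesis using u by (auto intro!: tsum_closed Z.closed)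
qed

lemma T_norm_scale:
  assumes u: "u \<in> vcarrier T"
  shows "vnorm T (\<lambda>B. a * u B) = \<bar>a\<bar> * vnorm T u"
proof -
  have le: "vnorm T (\<lambda>B. a * u B) \<le> \<bar>a\<bar> * vnorm T u" if "u \<in> vcarrier T" for a u
    using norm_T_upper[OF that] by (intro norm_T_least) (simp add: abs_mult mult_left_mono)
  show ?thesis
  proof (cases "a = 0")
    case True
    have "vnorm T (\<lambda>_. 0) = 0"
      using dual_sphere_Z dual_sphere_X by (simp add: norm_T case_prod_unfold)
    then show ?thesis using True by simp
  next
    case False
    have "vnorm T (\<lambda>B. inverse a * (a * u B)) \<le> \<bar>inverse a\<bar> * vnorm T (\<lambda>B. a * u B)"
      using T_scale_closed[OF u] by (rule le)
    then have "\<bar>a\<bar> * vnorm T u \<le> vnorm T (\<lambda>B. a * u B)"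
      using False by (simp add: field_simps)
    then show ?thesis using le[OF u, of a] by simp
  qed
qed

lemma seminormed_T: "seminormed_vspace T"
proof
  show "vzero T \<in> vcarrier T"
    using tsum_closed[of 0] by (simp add: T_simps tensor_sum_def)
  fix u v assume "u \<in> vcarrier T" "v \<in> vcarrier T"
  then show "vnorm T (vadd T u v) \<le> vnorm T u + vnorm T v"
    using norm_T_upper[of u] norm_T_upper[of v]
    by (intro norm_T_least) (simp add: T_simps, meson abs_triangle_ineq add_mono order_trans)
qed (simp_all add: T_simps T_add_closed T_scale_closed T_norm_scale algebra_simps)

lemma dual_tsum:
  assumes \<phi>: "\<phi> \<in> dual T" and zx: "\<And>i. i < n \<Longrightarrow> z i \<in> vcarrier Z \<and> x i \<in> vcarrier X"
  shows "\<phi> (tsum n z x) = (\<Sum>i<n. \<phi> (elem (z i) (x i)))"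
  using zx
proof (induction n)
  case 0
  have "tsum 0 z x = vzero T" by (simp add: tensor_sum_def T_simps)
  then show ?case using dual_zero[OF seminormed_T \<phi>] by simp
next
  case (Suc n)
  then have "tsum n z x \<in> vcarrier T" "elem (z n) (x n) \<in> vcarrier T"
    by (auto intro!: tsum_closed elem_closed)
  then show ?case using Suc by (simp add: tsum_Suc dual_add[OF \<phi>])
qed

lemma norm_elem_le: "\<lbrakk>z \<in> vcarrier Z; x \<in> vcarrier X\<rbrakk> \<Longrightarrow> vnorm T (elem z x) \<le> vnorm Z z * vnorm X x"
  using norm_tsum_le[of 1 "\<lambda>_. z" "\<lambda>_. x"] by (simp add: elem_as_tsum)

lemma dual_partial:
  assumes \<phi>: "\<phi> \<in> dual T" and x: "x \<in> vcarrier X"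
  shows "(\<lambda>z. \<phi> (elem z x)) \<in> dual Z"
proof -
  obtain K where K: "K > 0" "\<And>u. u \<in> vcarrier T \<Longrightarrow> \<bar>\<phi> u\<bar> \<le> K * vnorm T u"
    using dual_bounded[OF seminormed_T \<phi>] by metis
  show ?thesis
  proof (rule dualI[where K = "K * vnorm X x"])
    fix z z' assume z: "z \<in> vcarrier Z" "z' \<in> vcarrier Z"
    have "elem (vadd Z z z') x = vadd T (elem z x) (elem z' x)"
      using z x by (simp add: elem_add_left T_simps)
    then show "\<phi> (elem (vadd Z z z') x) = \<phi> (elem z x) + \<phi> (elem z' x)"
      using z x by (simp add: dual_add[OF \<phi>] elem_closed)
  next
    fix a z assume z: "z \<in> vcarrier Z"
    have "elem (vscale Z a z) x = vscale T a (elem z x)"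
      using z x by (simp add: elem_scale_left T_simps)
    then show "\<phi> (elem (vscale Z a z) x) = a * \<phi> (elem z x)"
      using z x by (simp add: dual_scale[OF \<phi>] elem_closed)
  next
    fix z assume z: "z \<in> vcarrier Z"
    have "\<bar>\<phi> (elem z x)\<bar> \<le> K * vnorm T (elem z x)"
      using z x by (intro K elem_closed)
    also have "\<dots> \<le> K * (vnorm Z z * vnorm X x)"
      using norm_elem_le[OF z x] K(1) by simp
    finally show "\<bar>\<phi> (elem z x)\<bar> \<le> K * vnorm X x * vnorm Z z" by (simp add: mult_ac)
  qed
qed

end

section \<open>Tensoring an L-summand with a line\<close>

text \<open>
  If the second factor is a line through the unit vector \<open>x0\<close>, then every tensor has the form
  \<open>z \<otimes> x0\<close>, and \<open>z \<mapsto> z \<otimes> x0\<close> is isometric. The summand of \<open>Z\<close> is carried over.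
\<close>

lemma (in tensor_pair) L_line_tensor:
  assumes line: "vcarrier X = range (\<lambda>t. vscale X t x0)" and x0: "x0 \<in> vcarrier X" "vnorm X x0 = 1"
    and norming: "\<And>z. z \<in> vcarrier Z \<Longrightarrow> \<exists>f\<in>dual_sphere Z. f z = vnorm Z z"
    and L: "L_line Z f e"
  shows "\<exists>F E. L_line T F E"
proof -
  obtain g where g: "g \<in> dual_sphere X" "g x0 = 1"
    using X.norming_functional[OF x0(1)] x0(2) by auto
  have gd: "g \<in> dual X" using g(1) by (rule dual_sphere_subset)
  have f: "f \<in> dual Z" and e: "e \<in> vcarrier Z" "vnorm Z e = 1" "f e = 1"
    and split: "\<And>z. z \<in> vcarrier Z \<Longrightarrow> vnorm Z z = \<bar>f z\<bar> + vnorm Z (vdiff Z z (vscale Z (f z) e))"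
    using L by (auto simp: L_line_def)
  have eval: "elem z x0 (\<lambda>z x. h z * g x) = h z" if "h \<in> dual Z" for h z
    using tsum_eval[OF that gd, of 1 "\<lambda>_. z" "\<lambda>_. x0"] g by (simp add: elem_as_tsum)
  have norm: "vnorm T (elem z x0) = vnorm Z z" if z: "z \<in> vcarrier Z" for z
  proof (rule antisym)
    show "vnorm T (elem z x0) \<le> vnorm Z z" using norm_elem_le[OF z x0(1)] x0(2) by simp
    obtain h where h: "h \<in> dual_sphere Z" "h z = vnorm Z z" using norming[OF z] by blast
    then show "vnorm Z z \<le> vnorm T (elem z x0)"
      using norm_T_upper[OF elem_closed[OF z x0(1)] h(1) g(1)] eval[OF dual_sphere_subset[OF h(1)], of z]
      by simp
  qed
  have rep_sum: "\<exists>w\<in>vcarrier Z. tsum n z x = elem w x0"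
    if "\<And>i. i < n \<Longrightarrow> z i \<in> vcarrier Z \<and> x i \<in> vcarrier X" for n z x
    using that
  proof (induction n)
    case 0
    have "elem (vscale Z 0 e) x0 = tsum 0 z x"
      by (simp only: elem_scale_left[OF e(1) x0(1)]) (simp add: tensor_sum_def)
    then show ?case using e by (metis Z.scale_closed)
  next
    case (Suc n)
    then obtain w where w: "w \<in> vcarrier Z" "tsum n z x = elem w x0" by auto
    have zn: "z n \<in> vcarrier Z" "x n \<in> vcarrier X" using Suc.prems by auto
    then obtain t where t: "x n = vscale X t x0" using line by auto
    have "elem (z n) (x n) = elem (vscale Z t (z n)) x0"
      using zn x0 by (simp add: t elem_scale_right elem_scale_left)
    then have "tsum (Suc n) z x = elem (vadd Z w (vscale Z t (z n))) x0"
      using w zn x0 by (simp add: tsum_Suc T_simps elem_add_left Z.closed)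
    then show ?case using w zn by (metis Z.add_closed Z.scale_closed)
  qed
  have rep: "\<exists>w\<in>vcarrier Z. u = elem w x0" if "u \<in> vcarrier T" for u
    using that rep_sum by (auto simp: T_carrier)
  define F where "F u = u (\<lambda>z x. f z * g x)" for u :: "('a \<Rightarrow> 'b \<Rightarrow> real) \<Rightarrow> real"
  have F: "F (elem z x0) = f z" for z
    using eval[OF f] by (simp add: F_def)
  have f_le: "\<bar>f z\<bar> \<le> vnorm Z z" if "z \<in> vcarrier Z" for z
    using split[OF that] Z.norm_nonneg[of "vdiff Z z (vscale Z (f z) e)"] that e
    by (simp add: Z.closed)
  have "L_line T F (elem e x0)"
    unfolding L_line_def
  proof (intro conjI ballI)
    show "F \<in> dual T"
    proof (rule dualI[where K = 1])
      fix u assume "u \<in> vcarrier T"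
      then obtain w where "w \<in> vcarrier Z" "u = elem w x0" using rep by blast
      then show "\<bar>F u\<bar> \<le> 1 * vnorm T u" using f_le by (simp add: F norm)
    qed (simp_all add: F_def T_simps)
    show "elem e x0 \<in> vcarrier T" using e x0 by (simp add: elem_closed)
    show "vnorm T (elem e x0) = 1" "F (elem e x0) = 1" using e by (simp_all add: norm F)
    fix u assume "u \<in> vcarrier T"
    then obtain w where w: "w \<in> vcarrier Z" "u = elem w x0" using rep by blast
    have "vdiff T u (vscale T (F u) (elem e x0)) = elem (vdiff Z w (vscale Z (f w) e)) x0"
      using w e x0 by (simp add: F T_simps elem_diff_left elem_scale_left Z.closed)
    then show "vnorm T u = \<bar>F u\<bar> + vnorm T (vdiff T u (vscale T (F u) (elem e x0)))"
      using split[OF w(1)] w e by (simp add: F norm Z.closed)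
  qed
  then show ?thesis by blast
qed

lemma banach_line:
  assumes "banach_vspace X" and x0: "x0 \<in> vcarrier X" "vnorm X x0 = 1"
  defines "Y \<equiv> X\<lparr>vcarrier := range (\<lambda>t. vscale X t x0)\<rparr>"
  shows "banach_vspace Y"
proof -
  interpret banach_vspace X by fact
  have sub: "vscale X t x0 \<in> vcarrier X" for t using x0 by (simp add: scale_closed)
  have Y_simps: "vcarrier Y = range (\<lambda>t. vscale X t x0)" "vzero Y = vzero X" "vadd Y = vadd X"
    "vscale Y = vscale X" "vnorm Y = vnorm X" "vdiff Y = vdiff X"
    by (auto simp: Y_def vdiff_def fun_eq_iff)
  have diff: "vdiff X (vscale X s x0) (vscale X t x0) = vscale X (s - t) x0" for s t
    using x0 scale_add_left[of x0 s "-t"] by (simp add: vdiff_def scale_scale)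
  have "normed_vspace Y"
  proof
    show "vzero Y \<in> vcarrier Y"
      using scale_zero_left[OF x0(1)] by (simp add: Y_simps) (metis rangeI)
    show "vadd Y x y \<in> vcarrier Y" if "x \<in> vcarrier Y" "y \<in> vcarrier Y" for x y
      using that x0 by (auto simp: Y_simps scale_add_left[symmetric])
    show "vscale Y a x \<in> vcarrier Y" if "x \<in> vcarrier Y" for a x
      using that x0 by (auto simp: Y_simps scale_scale)
  qed (use sub in \<open>auto simp: Y_simps add_assoc add_zero add_inverse scale_add_right
      scale_add_left scale_scale scale_one norm_eq_zero norm_zero norm_triangle norm_scale intro: add_commute\<close>)
  moreover have "\<exists>x\<in>vcarrier Y. (\<lambda>n. vnorm Y (vdiff Y (s n) x)) \<longlonglongrightarrow> 0" if s: "s \<in> cauchy_seqs Y" for s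
  proof -
    have "s n \<in> range (\<lambda>t. vscale X t x0)" for n
      using s by (auto simp: cauchy_seqs_def Y_simps)
    then have "\<exists>t. s n = vscale X t x0" for n
      by (blast dest: rangeE)
    then obtain t where t: "\<And>n. s n = vscale X (t n) x0" by metis
    have "Cauchy t"
    proof (rule metric_CauchyI)
      fix e :: real assume "e > 0"
      then have "\<exists>N. \<forall>m\<ge>N. \<forall>n\<ge>N. vnorm Y (vdiff Y (s m) (s n)) < e"
        using s by (simp add: cauchy_seqs_def)
      then show "\<exists>N. \<forall>m\<ge>N. \<forall>n\<ge>N. dist (t m) (t n) < e"
        using x0 by (simp add: Y_simps t diff norm_scale dist_real_def)
    qed
    then obtain l where "t \<longlonglongrightarrow> l" by (auto simp: Cauchy_convergent_iff convergent_def)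
    then have "(\<lambda>n. \<bar>t n - l\<bar>) \<longlonglongrightarrow> 0"
      by (intro tendsto_rabs_zero) (simp add: LIM_zero)
    then show ?thesis
      using x0 by (intro bexI[of _ "vscale X l x0"]) (simp_all add: Y_simps t diff norm_scale)
  qed
  ultimately show ?thesis
    by (simp add: banach_vspace_def banach_vspace_axioms_def)
qed

section \<open>Tensors of step functions spread\<close>

lemma tensor_pair_L1:
  assumes "nontrivial (L1 M)" "banach_vspace X" "nontrivial X"
  shows "tensor_pair (L1 M) X"
proof -
  interpret X: banach_vspace X by fact
  interpret L: normed_vspace "L1 M" by (rule normed_L1)
  obtain x where "x \<in> vcarrier X" "vnorm X x \<noteq> 0"
    using unit_vector_exists[OF X.normed_vspace_axioms assms(3)] by (metis zero_neq_one)
  then have "dual_sphere X \<noteq> {}" using X.norming_functional by blast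
  moreover have "dual_sphere (L1 M) \<noteq> {}"
    using L1_norming_functional[OF assms(1) L.zero_closed] by blast
  ultimately show ?thesis by unfold_locales
qed

locale L1_tensor = tensor_pair "L1 M" X for M :: "'a measure" and X :: "'b nspace" +
  assumes nontrivial_L1: "nontrivial (L1 M)"
begin

text \<open>
  The injective norm of \<open>\<Sum>i. f\<^sub>i \<otimes> x\<^sub>i\<close> is the norm of the operator \<open>g \<mapsto> \<Sum>i. g(x\<^sub>i) f\<^sub>i\<close>: the
  functional on \<open>L\<^sub>1\<close> in the definition of the injective norm can be chosen to norm the value of
  the operator, and no choice gives more. The next two lemmas are the two inequalities.
\<close>

lemma slice_norm_le:
  assumes f: "\<And>i. i < n \<Longrightarrow> integrable M (f i)" and x: "\<And>i. i < n \<Longrightarrow> x i \<in> vcarrier X"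
    and g: "g \<in> dual_sphere X"
  shows "(\<integral>t. \<bar>\<Sum>i<n. g (x i) * f i t\<bar> \<partial>M) \<le> vnorm T (tsum n (\<lambda>i. L1_class M (f i)) x)"
proof -
  let ?F = "\<lambda>t. \<Sum>i<n. g (x i) * f i t"
  have F: "integrable M ?F" using f by auto
  obtain \<phi> where \<phi>: "\<phi> \<in> dual_sphere (L1 M)" "\<phi> (L1_class M ?F) = vnorm (L1 M) (L1_class M ?F)"
    using L1_norming_functional[OF nontrivial_L1 L1_class_closed[OF F]] by blast
  note \<phi>d = dual_sphere_subset[OF \<phi>(1)] and gd = dual_sphere_subset[OF g]
  have "\<phi> (L1_class M ?F) = (\<Sum>i<n. g (x i) * \<phi> (L1_class M (f i)))"
    using f by (intro dual_L1_sum[OF \<phi>d]) auto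
  also have "\<dots> = tsum n (\<lambda>i. L1_class M (f i)) x (\<lambda>z x. \<phi> z * g x)"
    by (simp add: tsum_eval[OF \<phi>d gd] mult.commute)
  finally have "vnorm (L1 M) (L1_class M ?F) = tsum n (\<lambda>i. L1_class M (f i)) x (\<lambda>z x. \<phi> z * g x)"
    using \<phi>(2) by simp
  also have "\<dots> \<le> vnorm T (tsum n (\<lambda>i. L1_class M (f i)) x)"
    using norm_T_upper[OF tsum_closed \<phi>(1) g] f x by (meson L1_class_closed abs_le_D1)
  finally show ?thesis using F by (simp add: L1_norm)
qed

lemma tsum_norm_le:
  assumes f: "\<And>i. i < n \<Longrightarrow> integrable M (f i)" and x: "\<And>i. i < n \<Longrightarrow> x i \<in> vcarrier X"
    and c: "\<And>g. g \<in> dual_sphere X \<Longrightarrow> (\<integral>t. \<bar>\<Sum>i<n. g (x i) * f i t\<bar> \<partial>M) \<le> c"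
  shows "vnorm T (tsum n (\<lambda>i. L1_class M (f i)) x) \<le> c"
proof (rule norm_T_least)
  fix \<phi> g assume \<phi>: "\<phi> \<in> dual_sphere (L1 M)" and g: "g \<in> dual_sphere X"
  let ?F = "\<lambda>t. \<Sum>i<n. g (x i) * f i t"
  have F: "integrable M ?F" using f by auto
  note \<phi>d = dual_sphere_subset[OF \<phi>] and gd = dual_sphere_subset[OF g]
  have "tsum n (\<lambda>i. L1_class M (f i)) x (\<lambda>z x. \<phi> z * g x) = (\<Sum>i<n. g (x i) * \<phi> (L1_class M (f i)))"
    by (simp add: tsum_eval[OF \<phi>d gd] mult.commute)
  also have "\<dots> = \<phi> (L1_class M ?F)"
    using f by (intro dual_L1_sum[OF \<phi>d, symmetric]) auto
  also have "\<bar>\<dots>\<bar> \<le> vnorm (L1 M) (L1_class M ?F)"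
    using F by (intro dual_sphere_bound[OF seminormed_L1 \<phi>] L1_class_closed)
  also have "\<dots> \<le> c" using c[OF g] F by (simp add: L1_norm)
  finally show "\<bar>tsum n (\<lambda>i. L1_class M (f i)) x (\<lambda>z x. \<phi> z * g x)\<bar> \<le> c" .
qed

text \<open>
  All values \<open>\<Sum>i. g(x\<^sub>i) f\<^sub>i\<close> of the tensor as an operator are step functions over the same cells,
  so multiplication by \<open>N 1\<^sub>A\<close> keeps the norm of each value and moves it by nearly twice its
  norm. Taking suprema over \<open>g\<close> gives the same for the tensor. A functional on the tensor product
  enters only through its restrictions \<open>z \<mapsto> \<phi> (z \<otimes> x\<^sub>i)\<close>, which are finitely many functionals on
  \<open>L\<^sub>1\<close>.
\<close>

lemma spread_step_tensor:
  fixes b :: "nat \<Rightarrow> nat \<Rightarrow> real"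
  assumes sf: "sigma_finite_measure M" and na: "\<not> (\<exists>A. atom M A)" and P: "cells M P m"
    and x: "\<And>i. i < n \<Longrightarrow> x i \<in> vcarrier X"
  defines "u \<equiv> tsum n (\<lambda>i. L1_class M (step P m (b i))) x"
  shows "spread T u u"
  unfolding spread_def
proof (intro allI impI, elim conjE)
  fix \<Phi> and \<eta> :: real assume \<Phi>: "finite \<Phi>" "\<Phi> \<subseteq> dual T" and \<eta>: "\<eta> > 0"
  note int = step_integrable[OF P]
  have u: "u \<in> vcarrier T"
    unfolding u_def using x int by (intro tsum_closed) (auto intro: L1_class_closed)
  define S where "S = (\<Sum>i<n. \<Sum>k<m. \<bar>b i k\<bar>)"
  have S: "S \<ge> 0" by (auto simp: S_def intro: sum_nonneg)
  obtain N :: nat where N: "N > 0" "2 / N * vnorm T u \<le> \<eta>"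
    using multiplier_exists[OF seminormed_vspace.norm_nonneg[OF seminormed_T u] \<eta>] .
  define \<Psi> where "\<Psi> = (\<lambda>(\<phi>, i) z. \<phi> (elem z (x i))) ` (\<Phi> \<times> {..<n})"
  have \<Psi>: "finite \<Psi>" "\<Psi> \<subseteq> dual (L1 M)"
    using \<Phi> x by (auto simp: \<Psi>_def intro!: dual_partial)
  have \<delta>: "\<eta> / (S + 1) > 0" using \<eta> S by simp
  obtain A where A: "A \<in> sets M" "\<And>k. k < m \<Longrightarrow> measure M (A \<inter> P k) = measure M (P k) / N"
    and fair: "\<And>k \<psi>. \<lbrakk>k < m; \<psi> \<in> \<Psi>\<rbrakk> \<Longrightarrow>
      \<bar>real N * \<psi> (L1_class M (indicator (A \<inter> P k))) - \<psi> (L1_class M (indicator (P k)))\<bar> \<le> \<eta> / (S + 1)"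
    by (rule thin_set_exists[OF sf na P \<Psi> \<delta> N(1)]) (rule that)
  define h where "h i t = N * (indicator A t * step P m (b i) t)" for i t
  have ih: "integrable M (h i)" for i
    unfolding h_def using int A(1) by (rule thin_integrable)
  define w where "w = tsum n (\<lambda>i. L1_class M (h i)) x"
  have w: "w \<in> vcarrier T"
    unfolding w_def using x ih by (intro tsum_closed) (auto intro: L1_class_closed)
  have diff: "vdiff T w u = tsum n (\<lambda>i. L1_class M (\<lambda>t. h i t - step P m (b i) t)) x"
    unfolding w_def u_def using x ih int
    by (subst tsum_diff) (auto simp: L1_class_closed L1_diff)
  let ?c = "\<lambda>g k. \<Sum>i<n. g (x i) * b i k"
  have slice_u: "(\<Sum>i<n. g (x i) * step P m (b i) t) = step P m (?c g) t" for g t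
    by (rule step_sum)
  have slice_w: "(\<Sum>i<n. g (x i) * h i t) = N * (indicator A t * step P m (?c g) t)" for g t
    unfolding slice_u[symmetric] h_def sum_distrib_left by (rule sum.cong) (auto simp: mult_ac)
  have slice_diff: "(\<Sum>i<n. g (x i) * (h i t - step P m (b i) t))
      = N * (indicator A t * step P m (?c g) t) - step P m (?c g) t" for g t
    by (simp only: right_diff_distrib sum_subtractf slice_u slice_w)
  have u_slice: "(\<integral>t. \<bar>step P m (?c g) t\<bar> \<partial>M) \<le> vnorm T u" if "g \<in> dual_sphere X" for g
    using slice_norm_le[of n "\<lambda>i. step P m (b i)" x g] x int that by (simp only: slice_u u_def)
  show "\<exists>w\<in>vcarrier T. vnorm T w \<le> vnorm T u + \<eta> \<and> (\<forall>f\<in>\<Phi>. \<bar>f w - f u\<bar> \<le> \<eta>) \<and>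
      vnorm T u + vnorm T u - \<eta> \<le> vnorm T (vdiff T w u)"
  proof (intro bexI conjI ballI)
    have "vnorm T w \<le> vnorm T u"
      unfolding w_def
    proof (rule tsum_norm_le)
      fix g assume g: "g \<in> dual_sphere X"
      show "(\<integral>t. \<bar>\<Sum>i<n. g (x i) * h i t\<bar> \<partial>M) \<le> vnorm T u"
        using norm_thin[OF P A(1) N(1) A(2), of "?c g"] u_slice[OF g] unfolding slice_w by simp
    qed (use ih x in auto)
    then show "vnorm T w \<le> vnorm T u + \<eta>" using \<eta> by simp
  next
    have "vnorm T u \<le> (vnorm T (vdiff T w u) + \<eta>) / 2"
      unfolding u_def
    proof (rule tsum_norm_le)
      fix g assume g: "g \<in> dual_sphere X"
      let ?n = "\<integral>t. \<bar>step P m (?c g) t\<bar> \<partial>M"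
      have "?n + (1 - 2 / N) * ?n \<le> (\<integral>t. \<bar>N * (indicator A t * step P m (?c g) t) - step P m (?c g) t\<bar> \<partial>M)"
        by (rule norm_thin_diff[OF P A(1) N(1) A(2)])
      also have "\<dots> \<le> vnorm T (vdiff T w u)"
        using slice_norm_le[of n "\<lambda>i t. h i t - step P m (b i) t" x g] x int ih g
        unfolding slice_diff diff by (simp only: Bochner_Integration.integrable_diff)
      finally have "?n + (1 - 2 / N) * ?n \<le> vnorm T (vdiff T w u)" .
      moreover have "2 / N * ?n \<le> 2 / N * vnorm T u"
        using u_slice[OF g] by (intro mult_left_mono) auto
      ultimately have "?n \<le> (vnorm T (vdiff T w u) + \<eta>) / 2"
        using N(2) by (simp add: left_diff_distrib)
      then show "(\<integral>t. \<bar>\<Sum>i<n. g (x i) * step P m (b i) t\<bar> \<partial>M)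
          \<le> (vnorm T (vdiff T w (tsum n (\<lambda>i. L1_class M (step P m (b i))) x)) + \<eta>) / 2"
        by (simp only: slice_u u_def)
    qed (use int x in auto)
    then show "vnorm T u + vnorm T u - \<eta> \<le> vnorm T (vdiff T w u)" by simp
  next
    fix \<phi> assume \<phi>: "\<phi> \<in> \<Phi>"
    then have \<phi>d: "\<phi> \<in> dual T" using \<Phi> by blast
    have "\<phi> w - \<phi> u = (\<Sum>i<n. \<phi> (elem (L1_class M (h i)) (x i)) - \<phi> (elem (L1_class M (step P m (b i))) (x i)))"
      using x ih int by (simp add: w_def u_def dual_tsum[OF \<phi>d] L1_class_closed sum_subtractf)
    also have "\<bar>\<dots>\<bar> \<le> (\<Sum>i<n. \<eta> / (S + 1) * (\<Sum>k<m. \<bar>b i k\<bar>))"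
    proof (rule order_trans[OF sum_abs sum_mono])
      fix i assume i: "i \<in> {..<n}"
      then have \<psi>: "(\<lambda>z. \<phi> (elem z (x i))) \<in> \<Psi>" using \<phi> by (auto simp: \<Psi>_def)
      show "\<bar>\<phi> (elem (L1_class M (h i)) (x i)) - \<phi> (elem (L1_class M (step P m (b i))) (x i))\<bar>
          \<le> \<eta> / (S + 1) * (\<Sum>k<m. \<bar>b i k\<bar>)"
        unfolding h_def[abs_def]
        using dual_thin[OF P A(1), of "\<lambda>z. \<phi> (elem z (x i))" N "\<eta> / (S + 1)" "b i"] fair[OF _ \<psi>] \<psi> \<Psi>(2)
        by blast
    qed
    also have "\<dots> = \<eta> / (S + 1) * S" by (simp add: S_def sum_distrib_left)
    also have "\<dots> \<le> \<eta>" using S \<eta> by (rule divide_plus_one_mult_le)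
    finally show "\<bar>\<phi> w - \<phi> u\<bar> \<le> \<eta>" .
  qed (rule w)
qed

lemma step_tensors_dense:
  assumes u: "u \<in> vcarrier T" and \<eta>: "\<eta> > 0"
  obtains P m n b x where "cells M P m" "\<And>i. i < n \<Longrightarrow> x i \<in> vcarrier X"
    "vnorm T (vdiff T u (tsum n (\<lambda>i. L1_class M (step P m (b i))) x)) \<le> \<eta>"
proof -
  obtain n z x where rep: "u = tsum n z x" "\<forall>i<n. z i \<in> vcarrier (L1 M) \<and> x i \<in> vcarrier X"
    using u by (auto simp: T_carrier)
  define S where "S = (\<Sum>i<n. vnorm X (x i))"
  have S: "S \<ge> 0" unfolding S_def using rep by (intro sum_nonneg X.norm_nonneg) auto
  have \<delta>: "\<eta> / (S + 1) > 0" using \<eta> S by simp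
  show thesis
  proof (rule steps_dense[of n z M, OF _ \<delta>])
    show "z i \<in> vcarrier (L1 M)" if "i < n" for i using rep that by blast
  next
    fix P m b assume P: "cells M P m"
      and near: "\<And>i. i < n \<Longrightarrow> vnorm (L1 M) (vdiff (L1 M) (z i) (L1_class M (step P m (b i)))) < \<eta> / (S + 1)"
    note c = L1_class_closed[OF step_integrable[OF P]]
    have "vnorm T (vdiff T u (tsum n (\<lambda>i. L1_class M (step P m (b i))) x))
        = vnorm T (tsum n (\<lambda>i. vdiff (L1 M) (z i) (L1_class M (step P m (b i)))) x)"
      unfolding rep(1) using rep c by (subst tsum_diff) auto
    also have "\<dots> \<le> (\<Sum>i<n. vnorm (L1 M) (vdiff (L1 M) (z i) (L1_class M (step P m (b i)))) * vnorm X (x i))"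
      using rep c by (intro norm_tsum_le) (auto intro: Z.closed)
    also have "\<dots> \<le> (\<Sum>i<n. \<eta> / (S + 1) * vnorm X (x i))"
      using rep near by (intro sum_mono mult_right_mono X.norm_nonneg) (auto intro: less_imp_le)
    also have "\<dots> = \<eta> / (S + 1) * S" by (simp add: S_def sum_distrib_left)
    also have "\<dots> \<le> \<eta>" using S \<eta> by (rule divide_plus_one_mult_le)
    finally show thesis using rep P by (intro that[of P m n x b]) auto
  qed
qed

lemma DD2P_tensor:
  assumes sf: "sigma_finite_measure M" and na: "\<not> (\<exists>A. atom M A)"
  shows "DD2P (inj_tensor_hat (L1 M) X)"
  unfolding inj_tensor_hat_def
proof (rule DD2P_if_spread)
  interpret T: seminormed_vspace T by (rule seminormed_T)
  let ?C = "nspace_completion T"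
  show C: "seminormed_vspace ?C" by (rule T.seminormed_completion)
  interpret C: seminormed_vspace ?C by (rule C)
  let ?J = "\<lambda>u. compl_class T (\<lambda>_. u)"
  fix U assume U: "U \<in> vcarrier ?C"
  show "spread ?C U U"
  proof (rule spread_dense[OF seminormed_T C T.linear_op_completion T.norm_completion_embedding U U])
    fix \<eta> :: real assume \<eta>: "\<eta> > 0"
    then have \<eta>2: "\<eta> / 2 > 0" by simp
    obtain u where u: "u \<in> vcarrier T" "vnorm ?C (vdiff ?C U (?J u)) \<le> \<eta> / 2"
      using T.completion_dense[OF U \<eta>2] by blast
    obtain P m n b x where P: "cells M P m" and x: "\<And>i. i < n \<Longrightarrow> x i \<in> vcarrier X"
      and near: "vnorm T (vdiff T u (tsum n (\<lambda>i. L1_class M (step P m (b i))) x)) \<le> \<eta> / 2"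
      by (rule step_tensors_dense[OF u(1) \<eta>2]) (rule that)
    let ?v = "tsum n (\<lambda>i. L1_class M (step P m (b i))) x"
    have v: "?v \<in> vcarrier T"
      using x by (intro tsum_closed) (auto intro: L1_class_closed step_integrable[OF P])
    have Jc: "?J u \<in> vcarrier ?C" if "u \<in> vcarrier T" for u
      using T.linear_op_completion that by (auto simp: linear_op_def)
    have "vnorm ?C (vdiff ?C U (?J ?v)) \<le> vnorm ?C (vdiff ?C U (?J u)) + vnorm ?C (vdiff ?C (?J u) (?J ?v))"
      using U Jc u(1) v by (intro C.norm_diff_triangle)
    also have "vdiff ?C (?J u) (?J ?v) = ?J (vdiff T u ?v)"
      using linear_op_diff[OF seminormed_T T.linear_op_completion u(1) v] by simp
    also have "vnorm ?C \<dots> = vnorm T (vdiff T u ?v)"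
      using u(1) v by (intro T.norm_completion_embedding T.closed)
    finally have near_v: "vnorm ?C (vdiff ?C U (?J ?v)) \<le> \<eta>" using u(2) near by simp
    have "spread T ?v ?v" by (rule spread_step_tensor[OF sf na P]) (rule x)
    then show "\<exists>x'\<in>vcarrier T. \<exists>y'\<in>vcarrier T. spread T x' y' \<and>
        vnorm ?C (vdiff ?C U (?J x')) \<le> \<eta> \<and> vnorm ?C (vdiff ?C U (?J y')) \<le> \<eta>"
      using near_v v by (intro bexI[of _ ?v] conjI)
  qed
qed

end

section \<open>The equivalence\<close>

theorem corollary3p3:
  fixes M :: "'a measure"
  assumes "sigma_finite_measure M"
    and "localizable M"
    and "nontrivial (L1 M)"
    and universe: "\<exists>X :: 'x nspace. banach_vspace X \<and> nontrivial X"
  shows "((\<forall>X :: 'x nspace. banach_vspace X \<and> nontrivial X \<longrightarrow> DD2P (inj_tensor_hat (L1 M) X))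
            \<longleftrightarrow> DD2P (L1 M))
       \<and> (DD2P (L1 M) \<longleftrightarrow> daugavet_property (L1 M))
       \<and> (daugavet_property (L1 M) \<longleftrightarrow> \<not> (\<exists>A. atom M A))"
proof (cases "\<exists>A. atom M A")
  case False
  have "DD2P (inj_tensor_hat (L1 M) X)" if "banach_vspace X" "nontrivial X" for X :: "'x nspace"
  proof -
    interpret tensor_pair "L1 M" X using assms(3) that by (rule tensor_pair_L1)
    interpret L1_tensor M X by unfold_locales fact
    show ?thesis using assms(1) False by (rule DD2P_tensor)
  qed
  moreover have "DD2P (L1 M)"
    by (intro DD2P_if_spread seminormed_L1 spread_L1 assms(1) False)
  moreover have "daugavet_property (L1 M)"
    by (intro daugavet_if_spread normed_L1 spread_L1 assms(1) False)
  ultimately show ?thesis using False by blast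
next
  case True
  then obtain A where "atom M A" by blast
  then obtain \<phi> e where L: "L_line (L1 M) \<phi> e"
    using L_line_if_atom[OF assms(1)] by blast
  obtain X :: "'x nspace" where X: "banach_vspace X" "nontrivial X" using universe by blast
  then have normed: "normed_vspace X" by (simp add: banach_vspace_def)
  obtain x0 where x0: "x0 \<in> vcarrier X" "vnorm X x0 = 1" "x0 \<noteq> vzero X"
    using unit_vector_exists[OF normed X(2)] .
  \<comment> \<open>a one-dimensional space on which the first condition is tested\<close>
  define Y where "Y = X\<lparr>vcarrier := range (\<lambda>t. vscale X t x0)\<rparr>"
  have Y: "banach_vspace Y" unfolding Y_def using X(1) x0(1,2) by (rule banach_line)
  have Y_line: "vcarrier Y = range (\<lambda>t. vscale Y t x0)" by (simp add: Y_def)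
  have x0Y: "x0 \<in> vcarrier Y" "vnorm Y x0 = 1"
    using x0 normed_vspace.scale_one[OF normed x0(1)] by (auto simp: Y_def image_iff intro!: exI[of _ 1])
  have "nontrivial Y" using x0Y x0(3) by (auto simp: nontrivial_def Y_def)
  interpret tensor_pair "L1 M" Y using assms(3) Y \<open>nontrivial Y\<close> by (rule tensor_pair_L1)
  have norming: "\<exists>f\<in>dual_sphere (L1 M). f z = vnorm (L1 M) z" if "z \<in> vcarrier (L1 M)" for z
    using L1_norming_functional[OF assms(3) that] by metis
  then have "\<exists>F E. L_line (inj_tensor (L1 M) Y) F E"
    by (rule L_line_tensor[OF Y_line x0Y _ L])
  then obtain F E where "L_line (inj_tensor (L1 M) Y) F E" by (elim exE)
  from seminormed_vspace.L_line_completion[OF seminormed_T this]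
  obtain F' where "L_line (inj_tensor_hat (L1 M) Y) F' (compl_class (inj_tensor (L1 M) Y) (\<lambda>_. E))"
    unfolding inj_tensor_hat_def by (elim exE)
  moreover have "seminormed_vspace (inj_tensor_hat (L1 M) Y)"
    unfolding inj_tensor_hat_def using seminormed_T by (rule seminormed_vspace.seminormed_completion)
  ultimately have "\<not> DD2P (inj_tensor_hat (L1 M) Y)"
    by (intro not_DD2P_if_L_line)
  then show ?thesis
    using True Y \<open>nontrivial Y\<close> not_DD2P_if_L_line[OF seminormed_L1 L]
      not_daugavet_if_L_line[OF seminormed_L1 L] by blast
qed

end
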